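(* There is a well-defined map $\Phi$, defined on the set of families $\{J_n(q,\mathcal K)\}_{n\in\mathbb N^*}$ of colored Jones polynomials of ($0$-framed) knots in $S^3$, such that for every ($0$-framed) knot $\mathcal K$ in $S^3$, $$\Phi\big(\{J_n(q,\mathcal K)\}_{n\in\mathbb N^*}\big)=\{ADO_r(A,\mathcal K)\}_{r\in\mathbb N^*}.$$ In other words, the family of colored Jones polynomials of a knot determines its family of ADO polynomials.
   Context: $\mathbb N^*=\{1,2,\dots\}$. Knots are oriented, framed, in $S^3$. For $r\in\mathbb N^*$, $\zeta_{2r}=e^{i\pi/r}$. $\{n\}=q^n-q^{-n}$, $[n]=\{n\}/\{1\}$, $[n]!=\prod_{i=1}^n[i]$, $\binom{n}{k}_q=\frac{[n]!}{[n-k]![k]!}$. $A$ is a formal variable, also written $q^\alpha$ or $\zeta_{2r}^\alpha$; $\{\alpha+k\}_q=q^kA-q^{-k}A^{-1}$ and $\{\alpha+k;n\}_q=\prod_{i=0}^{n-1}\{\alpha+k-i\}_q$ (similarly with $q$ replaced by $\zeta_{2r}$). ADO invariant. Write $\zeta=\zeta_{2r}$. Let $V$ be the module with basis $v_0,\dots,v_{r-1}$ over $\mathbb Z[\zeta,A^{\pm1}]$ with $Ev_0=0$, $Ev_i=v_{i-1}$, $F^{(n)}v_i=\binom{n+i}{n}_{\zeta}\{\alpha-i;n\}_{\zeta}\,v_{n+i}$ (zero if $n+i\ge r$), $Kv_i=\zeta^{\alpha-2i}v_i$, $\zeta^{\frac{H\otimes H}{2}}(v_i\otimes v_j)=\zeta^{\frac{\alpha^2}{2}}\zeta^{-(i+j)\alpha}\zeta^{2ij}v_i\otimes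 v_j$ ($\zeta^{\alpha^2/2}$ a formal invertible symbol); this is the highest weight $\alpha$, $r$-dimensional module of the unrolled quantum $\mathfrak{sl}_2$ at $\zeta$, with $F^{(n)}=\{1\}^nF^n/[n]!$. With $R$-matrix $R=\zeta^{\frac{H\otimes H}{2}}\sum_{n=0}^{r-1}\zeta^{\frac{n(n-1)}{2}}E^n\otimes F^{(n)}$, its inverse, and pivotal element $K^{1-r}$, the Reshetikhin–Turaev operator of a 1-1 tangle with closure the framed knot $\mathcal K$ is a scalar on $V$; this scalar is $ADO_r(A,\mathcal K)$. It lies in $\zeta^{\frac{f\alpha^2}{2}}\mathbb Z[\zeta,A^{\pm1}]$, $f$ the framing, hence in $\mathbb Z[\zeta,A^{\pm1}]$ for $0$-framed knots. Colored Jones polynomials. $J_n(q,\mathcal K)\in\mathbb Z[q^{\pm1}]$ is the $n$-th colored Jones polynomial (color: the $(n+1)$-dimensional irreducible representation $V_n$ of quantum $\mathfrak{sl}_2$), normalized by $J_n(q,\text{unknot})=1$: $J_n(q^2,\mathcal K)$ is the scalar by which the Reshetikhin–Turaev operator of a 1-1 tangle with $0$-framed closure $\mathcal K$ acts on $V_n$, using $R=q^{\frac{H\otimes H}{2}}\sum_{n\ge 0}\frac{\{1\}^nq^{n(n-1)/2}}{[n]!}E^n\otimes F^n$ and pivotal element $K=q^H$, where $[E,F]=\frac{K-K^{-1}}{q-q^{-1}}$. *)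

theory Defs
  imports
    Complex_Main
    "HOL-Library.FuncSet"
    "HOL-Library.Poly_Mapping"
    "HOL-Computational_Algebra.Formal_Laurent_Series"
begin

section \<open>Oriented tangle diagrams and knots\<close>

text \<open>
  An oriented framed tangle is given by a generic (blackboard framed) diagram, cut by horizontal
  lines into slices and read from bottom to top.  A slice \<open>(k, e)\<close> is the elementary piece \<open>e\<close>
  with \<open>k\<close> vertical strands on its left and any number of vertical strands on its right.  The six
  pieces below are Turaev's generators of the category of framed oriented tangles: crossings of
  two upward strands, and the four oriented caps and cups; a crossing with other orientations is
  obtained by rotating one of these with caps and cups.  In \<open>Cross_Pos\<close> the strand from bottom
  left to top right is the upper one.
\<close>

datatype strand = Up | Down

datatype piece =
    Cross_Pos | Cross_Neg
  | Cap_Down_Up | Cap_Up_Down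
  | Cup_Up_Down | Cup_Down_Up

primrec src :: "piece \<Rightarrow> strand list" where
  "src Cross_Pos = [Up, Up]"
| "src Cross_Neg = [Up, Up]"
| "src Cap_Down_Up = [Down, Up]"
| "src Cap_Up_Down = [Up, Down]"
| "src Cup_Up_Down = []"
| "src Cup_Down_Up = []"

primrec tgt :: "piece \<Rightarrow> strand list" where
  "tgt Cross_Pos = [Up, Up]"
| "tgt Cross_Neg = [Up, Up]"
| "tgt Cap_Down_Up = []"
| "tgt Cap_Up_Down = []"
| "tgt Cup_Up_Down = [Up, Down]"
| "tgt Cup_Down_Up = [Down, Up]"

type_synonym slice = "nat \<times> piece"
type_synonym diagram = "slice list"

fun attach :: "slice \<Rightarrow> strand list \<Rightarrow> strand list" where
  "attach (k, e) s = take k s @ tgt e @ drop (k + length (src e)) s"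

fun attachable :: "slice \<Rightarrow> strand list \<Rightarrow> bool" where
  "attachable (k, e) s \<longleftrightarrow>
     k + length (src e) \<le> length s \<and> take (length (src e)) (drop k s) = src e"

fun is_tangle :: "strand list \<Rightarrow> diagram \<Rightarrow> strand list \<Rightarrow> bool" where
  "is_tangle s [] t \<longleftrightarrow> s = t"
| "is_tangle s (\<sigma> # D) t \<longleftrightarrow> attachable \<sigma> s \<and> is_tangle (attach \<sigma> s) D t"

fun levels :: "strand list \<Rightarrow> diagram \<Rightarrow> strand list list" where
  "levels s [] = [s]"
| "levels s (\<sigma> # D) = s # levels (attach \<sigma> s) D"

text \<open>
  \<open>(h, p)\<close> is the intersection of the diagram with the horizontal line number \<open>h\<close> in its \<open>p\<close>-th
  strand.  The arcs are the pieces of strand joining two such points inside one slice;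
  \<open>m\<close> is the number of strands at the bottom of the slice.
\<close>

fun piece_arcs :: "nat \<Rightarrow> nat \<Rightarrow> piece \<Rightarrow> ((nat \<times> nat) \<times> (nat \<times> nat)) set" where
  "piece_arcs h k e =
     (if e \<in> {Cross_Pos, Cross_Neg} then
        {((h, k), (Suc h, Suc k)), ((h, Suc k), (Suc h, k))}
      else if e \<in> {Cap_Down_Up, Cap_Up_Down} then {((h, k), (h, Suc k))}
      else {((Suc h, k), (Suc h, Suc k))})"

fun slice_arcs :: "nat \<Rightarrow> nat \<Rightarrow> slice \<Rightarrow> ((nat \<times> nat) \<times> (nat \<times> nat)) set" where
  "slice_arcs h m (k, e) =
     {((h, p), (Suc h, p)) | p. p < k}
     \<union> piece_arcs h k e
     \<union> {((h, k + length (src e) + p), (Suc h, k + length (tgt e) + p)) | p.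
          k + length (src e) + p < m}"

definition diagram_points :: "strand list \<Rightarrow> diagram \<Rightarrow> (nat \<times> nat) set" where
  "diagram_points s D = {(h, p). h \<le> length D \<and> p < length (levels s D ! h)}"

definition diagram_arcs :: "strand list \<Rightarrow> diagram \<Rightarrow> ((nat \<times> nat) \<times> (nat \<times> nat)) set" where
  "diagram_arcs s D = (\<Union>h<length D. slice_arcs h (length (levels s D ! h)) (D ! h))"

definition one_component :: "strand list \<Rightarrow> diagram \<Rightarrow> bool" where
  "one_component s D \<longleftrightarrow>
     (\<forall>x \<in> diagram_points s D. \<forall>y \<in> diagram_points s D.
        (x, y) \<in> (diagram_arcs s D \<union> (diagram_arcs s D)\<inverse>)\<^sup>*)"

definition writhe :: "diagram \<Rightarrow> int" where
  "writhe D = int (length (filter (\<lambda>\<sigma>. snd \<sigma> = Cross_Pos) D))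
            - int (length (filter (\<lambda>\<sigma>. snd \<sigma> = Cross_Neg) D))"

text \<open>
  Diagrams of 1-1 tangles whose closure is a knot; the blackboard framing of the closure is the
  writhe.  Every oriented 0-framed knot in the 3-sphere is the closure of such a tangle, and all
  invariants below are read off such a tangle.
\<close>

definition zero_framed_knots :: "diagram set" where
  "zero_framed_knots = {D. is_tangle [Up] D [Up] \<and> one_component [Up] D \<and> writhe D = 0}"

section \<open>The Reshetikhin--Turaev operator\<close>

text \<open>
  A matrix \<open>M\<close> has entries \<open>M out in\<close>: the entry is the coefficient of the basis vector \<open>out\<close> in
  the image of the basis vector \<open>in\<close>.  An operator on the tensor square of a module with basis
  \<open>v\<^sub>0, \<dots>, v\<^bsub>d-1\<^esub>\<close> is indexed by pairs, \<open>(i, j)\<close> standing for the tensor product of \<open>v\<^sub>i\<close>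
  and \<open>v\<^sub>j\<close>.  The pivotal element acts diagonally, \<open>v\<^sub>i\<close> having eigenvalue \<open>pivotal i\<close>.
\<close>

record 'a rt_data =
  rt_dim :: nat
  Rmat :: "nat \<times> nat \<Rightarrow> nat \<times> nat \<Rightarrow> 'a"
  pivotal :: "nat \<Rightarrow> 'a"
  pivotal_inv :: "nat \<Rightarrow> 'a"

definition Rinv :: "'a::comm_ring_1 rt_data \<Rightarrow> nat \<times> nat \<Rightarrow> nat \<times> nat \<Rightarrow> 'a" where
  "Rinv T = (let I = {..<rt_dim T} \<times> {..<rt_dim T} in
     SOME S. \<forall>x\<in>I. \<forall>y\<in>I.
       (\<Sum>z\<in>I. Rmat T x z * S z y) = (if x = y then 1 else 0) \<and>
       (\<Sum>z\<in>I. S x z * Rmat T z y) = (if x = y then 1 else 0))"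

text \<open>
  Upward strands carry the module, downward strands its dual with the dual basis.  A positive
  crossing acts by \<open>R\<close> followed by the flip, a negative one by the inverse of this operator.
  The right (co)evaluations involve the pivotal element \<open>g\<close>: \<open>v \<otimes> f\<close> is sent to \<open>f (g v)\<close>, and
  \<open>1\<close> to the sum of the \<open>v\<^sub>i\<^sup>* \<otimes> g\<inverse> v\<^sub>i\<close>.
\<close>

fun piece_op :: "'a::comm_ring_1 rt_data \<Rightarrow> piece \<Rightarrow> nat list \<Rightarrow> nat list \<Rightarrow> 'a" where
  "piece_op T Cross_Pos [a, b] [i, j] = Rmat T (b, a) (i, j)"
| "piece_op T Cross_Neg [a, b] [i, j] = Rinv T (a, b) (j, i)"
| "piece_op T Cap_Down_Up [] [i, j] = (if i = j then 1 else 0)"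
| "piece_op T Cap_Up_Down [] [i, j] = (if i = j then pivotal T i else 0)"
| "piece_op T Cup_Up_Down [a, b] [] = (if a = b then 1 else 0)"
| "piece_op T Cup_Down_Up [a, b] [] = (if a = b then pivotal_inv T a else 0)"
| "piece_op T _ _ _ = 0"

fun slice_op :: "'a::comm_ring_1 rt_data \<Rightarrow> slice \<Rightarrow> nat list \<Rightarrow> nat list \<Rightarrow> 'a" where
  "slice_op T (k, e) ys xs =
     (if take k ys = take k xs
         \<and> drop (k + length (tgt e)) ys = drop (k + length (src e)) xs
      then piece_op T e (take (length (tgt e)) (drop k ys)) (take (length (src e)) (drop k xs))
      else 0)"

fun rt_op :: "'a::comm_ring_1 rt_data \<Rightarrow> strand list \<Rightarrow> diagram \<Rightarrow> nat list \<Rightarrow> nat list \<Rightarrow> 'a" where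
  "rt_op T s [] ys xs = (if ys = xs then 1 else 0)"
| "rt_op T s (\<sigma> # D) ys xs =
     (\<Sum>zs | length zs = length (attach \<sigma> s) \<and> set zs \<subseteq> {..<rt_dim T}.
        rt_op T (attach \<sigma> s) D ys zs * slice_op T \<sigma> zs xs)"

definition rt_scalar :: "'a::comm_ring_1 rt_data \<Rightarrow> diagram \<Rightarrow> 'a" where
  "rt_scalar T D =
     (THE c. \<forall>i<rt_dim T. \<forall>j<rt_dim T. rt_op T [Up] D [j] [i] = (if j = i then c else 0))"

primrec mat_pow :: "nat \<Rightarrow> (nat \<Rightarrow> nat \<Rightarrow> 'a::comm_ring_1) \<Rightarrow> nat \<Rightarrow> nat \<Rightarrow> nat \<Rightarrow> 'a" where
  "mat_pow d M 0 = (\<lambda>j i. if j = i then 1 else 0)"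
| "mat_pow d M (Suc n) = (\<lambda>j i. \<Sum>k<d. M j k * mat_pow d M n k i)"

section \<open>Quantum integers\<close>

text \<open>\<open>qbrace q k\<close> is \<open>{k}\<close>, \<open>qint q k\<close> is \<open>[k]\<close>.\<close>

definition qbrace :: "'a::field \<Rightarrow> int \<Rightarrow> 'a" where
  "qbrace q k = q powi k - q powi (- k)"

definition qint :: "'a::field \<Rightarrow> int \<Rightarrow> 'a" where
  "qint q k = qbrace q k / qbrace q 1"

definition qfact :: "'a::field \<Rightarrow> nat \<Rightarrow> 'a" where
  "qfact q n = (\<Prod>i=1..n. qint q (int i))"

definition qbinom :: "'a::field \<Rightarrow> nat \<Rightarrow> nat \<Rightarrow> 'a" where
  "qbinom q n k = qfact q n / (qfact q (n - k) * qfact q k)"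

section \<open>Colored Jones polynomials\<close>

text \<open>
  The irreducible module of dimension \<open>n + 1\<close> at the quantum parameter \<open>q = s\<^sup>2\<close>, in the basis
  given by \<open>E v\<^sub>i = v\<^bsub>i-1\<^esub>\<close>, \<open>F v\<^sub>i = [i+1] [n-i] v\<^bsub>i+1\<^esub>\<close>, \<open>H v\<^sub>i = (n - 2i) v\<^sub>i\<close>.  The square root \<open>s\<close>
  is needed for \<open>q\<close> to the power \<open>H \<otimes> H / 2\<close>.  On this module the sum defining the R-matrix stops
  at \<open>n\<close>.
\<close>

definition jones_E :: "nat \<Rightarrow> nat \<Rightarrow> 'a::field" where
  "jones_E j i = (if i = Suc j then 1 else 0)"

definition jones_F :: "'a::field \<Rightarrow> nat \<Rightarrow> nat \<Rightarrow> nat \<Rightarrow> 'a" where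
  "jones_F q n j i = (if j = Suc i then qint q (int i + 1) * qint q (int n - int i) else 0)"

definition jones_weight :: "nat \<Rightarrow> nat \<Rightarrow> int" where
  "jones_weight n i = int n - 2 * int i"

definition jones_R :: "'a::field \<Rightarrow> nat \<Rightarrow> nat \<times> nat \<Rightarrow> nat \<times> nat \<Rightarrow> 'a" where
  "jones_R s n = (\<lambda>(k, l) (i, j).
     s powi (jones_weight n k * jones_weight n l) *
     (\<Sum>m\<le>n. qbrace (s\<^sup>2) 1 ^ m * (s\<^sup>2) ^ (m * (m - 1) div 2) / qfact (s\<^sup>2) m
             * mat_pow (n + 1) jones_E m k i * mat_pow (n + 1) (jones_F (s\<^sup>2) n) m l j))"

definition jones_data :: "'a::field \<Rightarrow> nat \<Rightarrow> 'a rt_data" where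
  "jones_data s n =
     \<lparr> rt_dim = n + 1,
       Rmat = jones_R s n,
       pivotal = (\<lambda>i. (s\<^sup>2) powi jones_weight n i),
       pivotal_inv = (\<lambda>i. (s\<^sup>2) powi (- jones_weight n i)) \<rparr>"

text \<open>
  Since the scalar at the quantum parameter \<open>q\<close> is \<open>J\<^sub>n(q\<^sup>2)\<close>, the polynomial \<open>J\<^sub>n(q)\<close> is the scalar
  at the parameter \<open>q\<^bsup>1/2\<^esup>\<close>, so that \<open>s = q\<^bsup>1/4\<^esup>\<close>.  It is computed in the field of Laurent series
  in \<open>q\<^bsup>1/4\<^esup>\<close>; thus \<open>q\<close> itself is \<open>fls_X ^ 4\<close>.
\<close>

definition colored_jones :: "nat \<Rightarrow> diagram \<Rightarrow> rat fls" where
  "colored_jones n D = rt_scalar (jones_data fls_X n) D"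

section \<open>ADO polynomials\<close>

text \<open>
  Laurent polynomials in \<open>A = \<zeta>\<^sup>\<alpha>\<close> over the complex numbers, and Laurent polynomials over these in
  the formal symbol \<open>\<zeta>\<close> to the power \<open>\<alpha>\<^sup>2/2\<close>.  They contain the rings over \<open>\<int>[\<zeta>]\<close> for every \<open>r\<close>.
  \<open>ado_mon c b z\<close> is \<open>z\<close> times \<open>\<zeta>\<close> to the power \<open>c \<alpha>\<^sup>2/2\<close> times \<open>A\<close> to the power \<open>b\<close>.
\<close>

type_synonym ado_ring = "int \<Rightarrow>\<^sub>0 (int \<Rightarrow>\<^sub>0 complex)"

definition ado_mon :: "int \<Rightarrow> int \<Rightarrow> complex \<Rightarrow> ado_ring" where
  "ado_mon c b z = Poly_Mapping.single c (Poly_Mapping.single b z)"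

definition zeta :: "nat \<Rightarrow> complex" where
  "zeta r = exp (\<i> * of_real pi / of_nat r)"

text \<open>\<open>alpha_brace r k\<close> is \<open>{\<alpha> + k}\<close>, \<open>alpha_falling r k n\<close> is \<open>{\<alpha> + k; n}\<close>.\<close>

definition alpha_brace :: "nat \<Rightarrow> int \<Rightarrow> ado_ring" where
  "alpha_brace r k = ado_mon 0 1 (zeta r powi k) - ado_mon 0 (- 1) (zeta r powi (- k))"

definition alpha_falling :: "nat \<Rightarrow> int \<Rightarrow> nat \<Rightarrow> ado_ring" where
  "alpha_falling r k n = (\<Prod>i<n. alpha_brace r (k - int i))"

definition ado_E :: "nat \<Rightarrow> nat \<Rightarrow> ado_ring" where
  "ado_E j i = (if i = Suc j then 1 else 0)"

definition ado_F :: "nat \<Rightarrow> nat \<Rightarrow> nat \<Rightarrow> nat \<Rightarrow> ado_ring" where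
  "ado_F r n j i =
     (if j = n + i \<and> n + i < r
      then ado_mon 0 0 (qbinom (zeta r) (n + i) n) * alpha_falling r (- int i) n
      else 0)"

definition ado_HH :: "nat \<Rightarrow> nat \<Rightarrow> nat \<Rightarrow> ado_ring" where
  "ado_HH r i j = ado_mon 1 (- (int i + int j)) (zeta r ^ (2 * i * j))"

definition ado_K_pow :: "nat \<Rightarrow> int \<Rightarrow> nat \<Rightarrow> ado_ring" where
  "ado_K_pow r m i = ado_mon 0 m (zeta r powi (- 2 * int i * m))"

definition ado_R :: "nat \<Rightarrow> nat \<times> nat \<Rightarrow> nat \<times> nat \<Rightarrow> ado_ring" where
  "ado_R r = (\<lambda>(k, l) (i, j).
     ado_HH r k l *
     (\<Sum>n<r. ado_mon 0 0 (zeta r ^ (n * (n - 1) div 2)) * mat_pow r ado_E n k i * ado_F r n l j))"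

definition ado_data :: "nat \<Rightarrow> ado_ring rt_data" where
  "ado_data r =
     \<lparr> rt_dim = r,
       Rmat = ado_R r,
       pivotal = ado_K_pow r (1 - int r),
       pivotal_inv = ado_K_pow r (int r - 1) \<rparr>"

definition ADO :: "nat \<Rightarrow> diagram \<Rightarrow> ado_ring" where
  "ADO r D = rt_scalar (ado_data r) D"

end

theory Submission
  imports Defs
begin

text \<open>
  Let \<open>S\<^sub>d(q, A)\<close> be the state sum of a diagram for the Verma module with highest weight \<open>A = q\<^sup>\<alpha>\<close>,
  from \<open>v\<^sub>0\<close> to \<open>v\<^sub>0\<close> and with all indices truncated to \<open>{..<d}\<close>.  As the writhe is zero, the powers of
  \<open>q\<close> with exponent \<open>\<alpha>\<^sup>2/2\<close> cancel, and \<open>S\<^sub>d\<close> is a Laurent polynomial over the integers.  The operators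
  defining both invariants commute with \<open>E\<close> and \<open>K\<close>, so they are scalars, given by their entry at \<open>v\<^sub>0\<close>.

  For \<open>N < d\<close> the value at \<open>A = q\<^sup>N\<close> is the colored Jones polynomial, because \<open>v\<^sub>0, \<dots>, v\<^sub>N\<close> span a
  submodule and, the closure being a knot, every contributing state stays inside it.  So if two knots
  have the same colored Jones polynomials, the difference of their \<open>S\<^sub>d\<close> is divisible by the product
  of the \<open>A - q\<^sup>N\<close> with \<open>1 \<le> N < d\<close>; at \<open>q = \<zeta>\<close> it vanishes at \<open>A = 1\<close> to an order growing with \<open>d\<close>.

  At \<open>q = \<zeta>\<close>, writing indices as \<open>a + r b\<close> factorizes the Verma state sum:
  \<open>S\<^bsub>r e\<^esub>(\<zeta>, A) = ADO\<^sub>r(A) L\<^sub>e(A\<^sup>r)\<close>.  Terms in which \<open>E\<^sup>n\<close> borrows from \<open>b\<close> lower the total of the \<open>b\<close>'s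
  along the diagram and hence cannot contribute.  The factor \<open>L\<^sub>e\<close> does not depend on \<open>r\<close> (in the limit it
  is the inverse Alexander polynomial), equals \<open>S\<^sub>e(- 1, \<cdot>)\<close>, and is \<open>1\<close> at \<open>1\<close>.  Thus both \<open>S\<close> and \<open>L\<close> are
  determined to arbitrarily high order at \<open>A = 1\<close>, and so is their quotient \<open>ADO\<^sub>r\<close>.
\<close>

text \<open>At a root of unity the points A = q^N take only finitely many values, so values there
  cannot determine a polynomial in A. Divisibility by the distinct factors A - q^N is therefore
  established while q is still transcendental; specializing q afterwards lets the factors with N
  divisible by 2r merge into a power of A - 1. Distinct zeros thus become one multiple zero, at the
  price of a truncation d that grows with 2r times the order wanted.

  The full Verma state sum is infinite. The finite sums \<open>S\<^sub>d\<close> need not be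
  invariants, but they replace a completion: the factorization is exact for every e, and the order
  at A = 1 of the difference of two ADO sums is fixed before e is chosen.

  The crossing identities are proved over arbitrary fields because they are used in Laurent series,
  at q = \<zeta> and at q = -1. A functional at the top of the diagram is pulled down slice by
  slice: induction then removes the bottom slice, and the functional may be arbitrary, which is
  needed to let E act on it.\<close>

section \<open>Pulling functionals back along diagrams\<close>

text \<open>\<open>P a b i j\<close> and \<open>N a b i j\<close> are the coefficients of \<open>v\<^sub>a \<otimes> v\<^sub>b\<close> in the images of \<open>v\<^sub>i \<otimes> v\<^sub>j\<close> under a
  positive and a negative crossing, the flip being included.\<close>

fun wt :: "(nat \<Rightarrow> nat \<Rightarrow> nat \<Rightarrow> nat \<Rightarrow> 'a) \<Rightarrow> (nat \<Rightarrow> nat \<Rightarrow> nat \<Rightarrow> nat \<Rightarrow> 'a) \<Rightarrow> (nat \<Rightarrow> 'a) \<Rightarrow> (nat \<Rightarrow> 'a)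
    \<Rightarrow> piece \<Rightarrow> nat list \<Rightarrow> nat list \<Rightarrow> 'a::comm_ring_1" where
  "wt P N g g' Cross_Pos [a, b] [i, j] = P a b i j"
| "wt P N g g' Cross_Neg [a, b] [i, j] = N a b i j"
| "wt P N g g' Cap_Down_Up [] [i, j] = (if i = j then 1 else 0)"
| "wt P N g g' Cap_Up_Down [] [i, j] = (if i = j then g i else 0)"
| "wt P N g g' Cup_Up_Down [a, b] [] = (if a = b then 1 else 0)"
| "wt P N g g' Cup_Down_Up [a, b] [] = (if a = b then g' a else 0)"
| "wt P N g g' _ _ _ = 0"

definition index_lists :: "nat \<Rightarrow> nat \<Rightarrow> nat list set" where
  "index_lists d m = {zs. length zs = m \<and> set zs \<subseteq> {..<d}}"

text \<open>The transpose of a slice: a functional on the labels above becomes one on the labels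
  below. Only the labels created by the piece are summed, the other strands keep theirs, so later
  arguments are local to one piece.\<close>

fun pull :: "nat \<Rightarrow> (piece \<Rightarrow> nat list \<Rightarrow> nat list \<Rightarrow> 'a::comm_ring_1) \<Rightarrow> slice \<Rightarrow> (nat list \<Rightarrow> 'a)
    \<Rightarrow> nat list \<Rightarrow> 'a" where
  "pull d W (k, e) \<phi> xs =
     (\<Sum>zs\<in>index_lists d (length (tgt e)).
        W e zs (take (length (src e)) (drop k xs)) * \<phi> (take k xs @ zs @ drop (k + length (src e)) xs))"

fun pull_diagram :: "nat \<Rightarrow> (piece \<Rightarrow> nat list \<Rightarrow> nat list \<Rightarrow> 'a::comm_ring_1) \<Rightarrow> diagram \<Rightarrow> (nat list \<Rightarrow> 'a)
    \<Rightarrow> nat list \<Rightarrow> 'a" where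
  "pull_diagram d W [] \<phi> = \<phi>"
| "pull_diagram d W (\<sigma> # D) \<phi> = pull d W \<sigma> (pull_diagram d W D \<phi>)"

lemma finite_index_lists [simp]: "finite (index_lists d m)"
  using finite_lists_length_eq[of "{..<d}" m] by (simp add: index_lists_def conj_commute)

lemma index_lists_0 [simp]: "index_lists d 0 = {[]}"
  by (auto simp: index_lists_def)

lemma index_lists_append:
  "xs \<in> index_lists d m \<Longrightarrow> ys \<in> index_lists d n \<Longrightarrow> xs @ ys \<in> index_lists d (m + n)"
  by (auto simp: index_lists_def)

lemma sum_index_lists_2:
  "(\<Sum>zs\<in>index_lists d (Suc (Suc 0)). f zs) = (\<Sum>a<d. \<Sum>b<d. f [a, b])"
proof -
  have "bij_betw (\<lambda>(a, b). [a, b]) ({..<d} \<times> {..<d}) (index_lists d (Suc (Suc 0)))"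
    by (rule bij_betwI[where g = "\<lambda>zs. (zs ! 0, zs ! 1)"])
       (auto simp: index_lists_def length_Suc_conv)
  from sum.reindex_bij_betw[OF this, of f] show ?thesis
    by (simp add: sum.cartesian_product case_prod_unfold)
qed

lemma pull_split:
  assumes "length us = k" "length x = length (src e)"
  shows "pull d W (k, e) \<phi> (us @ x @ ws) =
    (\<Sum>zs\<in>index_lists d (length (tgt e)). W e zs x * \<phi> (us @ zs @ ws))"
  using assms by simp

lemma attachable_split:
  assumes "attachable (k, e) s"
  obtains s1 s2 where "length s1 = k" "s = s1 @ src e @ s2" "attach (k, e) s = s1 @ tgt e @ s2"
proof
  show "length (take k s) = k" using assms by simp
  have "s = take k s @ take (length (src e)) (drop k s) @ drop (length (src e)) (drop k s)"
    by (simp only: append_take_drop_id)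
  thus "s = take k s @ src e @ drop (k + length (src e)) s" using assms by (simp add: add.commute)
  show "attach (k, e) s = take k s @ tgt e @ drop (k + length (src e)) s" by simp
qed

lemma list_split3:
  assumes "length xs = k + m + n"
  obtains us x ws where "xs = us @ x @ ws" "length us = k" "length x = m" "length ws = n"
proof
  show "xs = take k xs @ take m (drop k xs) @ drop m (drop k xs)" by (simp only: append_take_drop_id)
qed (use assms in auto)

lemma attachable_cases:
  assumes "attachable (k, e) s" "length xs = length s"
  obtains s1 s2 us x ws where "s = s1 @ src e @ s2" "attach (k, e) s = s1 @ tgt e @ s2"
    "xs = us @ x @ ws" "length s1 = k" "length us = k" "length x = length (src e)" "length ws = length s2"
proof -
  obtain s1 s2 where s: "length s1 = k" "s = s1 @ src e @ s2" "attach (k, e) s = s1 @ tgt e @ s2"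
    using attachable_split[OF assms(1)] .
  moreover obtain us x ws where "xs = us @ x @ ws" "length us = k" "length x = length (src e)" "length ws = length s2"
    using list_split3[of xs k "length (src e)" "length s2"] assms(2) s by auto
  ultimately show ?thesis using that by blast
qed

lemma pull_cong:
  assumes "attachable \<sigma> s" "xs \<in> index_lists d (length s)"
    "\<And>e zs x. zs \<in> index_lists d (length (tgt e)) \<Longrightarrow> x \<in> index_lists d (length (src e)) \<Longrightarrow> W e zs x = W' e zs x"
    "\<And>zs. zs \<in> index_lists d (length (attach \<sigma> s)) \<Longrightarrow> \<phi> zs = \<psi> zs"
  shows "pull d W \<sigma> \<phi> xs = pull d W' \<sigma> \<psi> xs"
proof -
  obtain k e where \<sigma>: "\<sigma> = (k, e)" by force
  have "length xs = length s" using assms(2) by (simp add: index_lists_def)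
  then obtain s1 s2 us x ws where s: "s = s1 @ src e @ s2" "attach (k, e) s = s1 @ tgt e @ s2"
    "xs = us @ x @ ws" "length s1 = k" "length us = k" "length x = length (src e)" "length ws = length s2"
    using attachable_cases assms(1) unfolding \<sigma> by metis
  have x: "x \<in> index_lists d (length (src e))" "us \<in> index_lists d k" "ws \<in> index_lists d (length s2)"
    using assms(2) s by (auto simp: index_lists_def)
  show ?thesis unfolding \<sigma> s(3)
    apply (subst (1 2) pull_split)
    using s apply simp_all
    apply (rule sum.cong[OF refl])
    subgoal for zs
      using assms(3)[of zs e x] assms(4)[of "us @ zs @ ws"] x s(2,4) unfolding \<sigma>
      by (simp add: index_lists_append index_lists_def)
    done
qed

lemma pull_diagram_cong:
  assumes "is_tangle s D t" "xs \<in> index_lists d (length s)"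
    "\<And>e zs x. zs \<in> index_lists d (length (tgt e)) \<Longrightarrow> x \<in> index_lists d (length (src e)) \<Longrightarrow> W e zs x = W' e zs x"
    "\<And>zs. zs \<in> index_lists d (length t) \<Longrightarrow> \<phi> zs = \<psi> zs"
  shows "pull_diagram d W D \<phi> xs = pull_diagram d W' D \<psi> xs"
  using assms(1,2)
proof (induction D arbitrary: s xs)
  case Nil
  then show ?case using assms(4) by simp
next
  case (Cons \<sigma> D)
  show ?case unfolding pull_diagram.simps
    by (rule pull_cong[where s = s]) (use Cons assms(3) in auto)
qed

text \<open>A slice has zero entries unless the labels beside the piece agree, so the sum over a
  whole level collapses to the lists \<open>us @ z @ ws\<close> with \<open>z\<close> running over
  the outputs of the piece.\<close>

lemma rt_op_eq_pull_diagram: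
  assumes "is_tangle s D t" "xs \<in> index_lists (rt_dim T) (length s)"
  shows "rt_op T s D ys xs = pull_diagram (rt_dim T) (piece_op T) D (\<lambda>zs. if zs = ys then 1 else 0) xs"
  using assms
proof (induction D arbitrary: s xs)
  case Nil
  then show ?case by (simp add: eq_commute)
next
  case (Cons \<sigma> D)
  define d where "d = rt_dim T"
  define \<phi> where "\<phi> = rt_op T (attach \<sigma> s) D ys"
  obtain k e where \<sigma>: "\<sigma> = (k, e)" by force
  have att: "attachable (k, e) s" and tan: "is_tangle (attach \<sigma> s) D t" using Cons.prems(1) \<sigma> by auto
  have len: "length xs = length s" using Cons.prems by (simp add: index_lists_def)
  obtain s1 s2 us x ws where s: "s = s1 @ src e @ s2" "attach (k, e) s = s1 @ tgt e @ s2"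
    "xs = us @ x @ ws" "length s1 = k" "length us = k" "length x = length (src e)" "length ws = length s2"
    using attachable_cases[OF att len] by metis
  have in_xs: "us \<in> index_lists d k" "x \<in> index_lists d (length (src e))" "ws \<in> index_lists d (length s2)"
    using Cons.prems(2) s by (auto simp: index_lists_def d_def)
  have "rt_op T s (\<sigma> # D) ys xs = (\<Sum>zs\<in>index_lists d (length (s1 @ tgt e @ s2)). \<phi> zs * slice_op T (k, e) zs xs)"
    unfolding rt_op.simps \<phi>_def d_def index_lists_def s(2)[symmetric] \<sigma> ..
  also have "\<dots> = (\<Sum>zs\<in>(\<lambda>z. us @ z @ ws) ` index_lists d (length (tgt e)). \<phi> zs * slice_op T (k, e) zs xs)"
  proof (rule sum.mono_neutral_right)
    show "(\<lambda>z. us @ z @ ws) ` index_lists d (length (tgt e)) \<subseteq> index_lists d (length (s1 @ tgt e @ s2))"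
      using in_xs s(4) by (auto simp: index_lists_def)
    show "\<forall>zs\<in>index_lists d (length (s1 @ tgt e @ s2)) - (\<lambda>z. us @ z @ ws) ` index_lists d (length (tgt e)).
       \<phi> zs * slice_op T (k, e) zs xs = 0"
    proof
      fix zs assume zs: "zs \<in> index_lists d (length (s1 @ tgt e @ s2)) - (\<lambda>z. us @ z @ ws) ` index_lists d (length (tgt e))"
      then obtain u z w where z: "zs = u @ z @ w" "length u = k" "length z = length (tgt e)" "length w = length s2"
        using list_split3[of zs k "length (tgt e)" "length s2"] s by (auto simp: index_lists_def)
      have "z \<in> index_lists d (length (tgt e))" using zs z by (auto simp: index_lists_def)
      hence "\<not> (u = us \<and> w = ws)" using zs z by auto
      thus "\<phi> zs * slice_op T (k, e) zs xs = 0" using z s by auto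
    qed
  qed simp
  also have "\<dots> = (\<Sum>z\<in>index_lists d (length (tgt e)). \<phi> (us @ z @ ws) * piece_op T e z x)"
    by (subst sum.reindex) (auto simp: inj_on_def s index_lists_def intro!: sum.cong)
  also have "\<dots> = pull d (piece_op T) (k, e) \<phi> xs"
    unfolding s(3) by (subst pull_split) (use s in \<open>auto simp: mult.commute\<close>)
  also have "\<dots> = pull d (piece_op T) (k, e) (pull_diagram d (piece_op T) D (\<lambda>zs. if zs = ys then 1 else 0)) xs"
    by (rule pull_cong[where s = s])
       (use att Cons.prems(2) Cons.IH[OF tan] in \<open>auto simp: d_def \<phi>_def \<sigma>\<close>)
  finally show ?case by (simp add: \<sigma> d_def)
qed

text \<open>Downward strands carry the dual module, so their labels count negatively; the two ends
  of a cap or cup cancel and only crossings can change the sum. Weights, counts of labels with a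
  property and totals of quotients are all instances.\<close>

fun signed_sum :: "(nat \<Rightarrow> int) \<Rightarrow> strand list \<Rightarrow> nat list \<Rightarrow> int" where
  "signed_sum f (Up # s) (x # xs) = f x + signed_sum f s xs"
| "signed_sum f (Down # s) (x # xs) = - f x + signed_sum f s xs"
| "signed_sum f _ _ = 0"

lemma signed_sum_append [simp]:
  "length s = length xs \<Longrightarrow> signed_sum f (s @ s') (xs @ xs') = signed_sum f s xs + signed_sum f s' xs'"
proof (induction s xs rule: list_induct2)
  case (Cons x xs y ys) then show ?case by (cases x) auto
qed simp

fun step :: "(piece \<Rightarrow> nat list \<Rightarrow> nat list \<Rightarrow> 'a::comm_ring_1) \<Rightarrow> slice \<Rightarrow> nat list \<Rightarrow> nat list \<Rightarrow> bool" where
  "step W (k, e) xs ys \<longleftrightarrow> (\<exists>us x z ws. xs = us @ x @ ws \<and> ys = us @ z @ ws \<and> length us = k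
      \<and> length x = length (src e) \<and> length z = length (tgt e) \<and> W e z x \<noteq> 0)"

text \<open>A state of the diagram, one list of labels per level, all of whose local weights are
  nonzero. No dimension bound enters, so states of different truncations can be compared.\<close>

fun path :: "(piece \<Rightarrow> nat list \<Rightarrow> nat list \<Rightarrow> 'a::comm_ring_1) \<Rightarrow> diagram \<Rightarrow> nat list list \<Rightarrow> bool" where
  "path W [] [x] \<longleftrightarrow> True"
| "path W (\<sigma> # D) (x # y # zss) \<longleftrightarrow> step W \<sigma> x y \<and> path W D (y # zss)"
| "path W _ _ \<longleftrightarrow> False"

lemma pull_diagram_nonzero:
  assumes "is_tangle s D t" "length xs = length s" "pull_diagram d W D \<phi> xs \<noteq> 0"
  shows "\<exists>zss. path W D (xs # zss) \<and> \<phi> (last (xs # zss)) \<noteq> 0"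
  using assms
proof (induction D arbitrary: s xs)
  case Nil
  then show ?case by (intro exI[of _ "[]"]) auto
next
  case (Cons \<sigma> D)
  obtain k e where \<sigma>: "\<sigma> = (k, e)" by force
  have att: "attachable (k, e) s" and tan: "is_tangle (attach \<sigma> s) D t" using Cons.prems(1) \<sigma> by auto
  obtain s1 s2 us x ws where s: "s = s1 @ src e @ s2" "attach (k, e) s = s1 @ tgt e @ s2"
    "xs = us @ x @ ws" "length s1 = k" "length us = k" "length x = length (src e)" "length ws = length s2"
    using attachable_cases[OF att Cons.prems(2)] by metis
  have "(\<Sum>zs\<in>index_lists d (length (tgt e)). W e zs x * pull_diagram d W D \<phi> (us @ zs @ ws)) \<noteq> 0"
    using Cons.prems(3) unfolding \<sigma> pull_diagram.simps s(3) by (subst (asm) pull_split) (use s in auto)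
  then obtain zs where zs: "zs \<in> index_lists d (length (tgt e))" "W e zs x * pull_diagram d W D \<phi> (us @ zs @ ws) \<noteq> 0"
    by (meson sum.not_neutral_contains_not_neutral)
  hence nz: "W e zs x \<noteq> 0" "pull_diagram d W D \<phi> (us @ zs @ ws) \<noteq> 0" and lz: "length zs = length (tgt e)"
    by (auto simp: index_lists_def)
  have "length (us @ zs @ ws) = length (attach \<sigma> s)" using s lz \<sigma> by simp
  from Cons.IH[OF tan this nz(2)] obtain zss where "path W D ((us @ zs @ ws) # zss)" "\<phi> (last ((us @ zs @ ws) # zss)) \<noteq> 0"
    by auto
  moreover have "step W \<sigma> xs (us @ zs @ ws)" unfolding \<sigma> using s nz(1) lz by auto
  ultimately show ?case by (intro exI[of _ "(us @ zs @ ws) # zss"]) auto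
qed

text \<open>Two truncations can differ only through a contributing state with a label outside the
  smaller range. Either the difference already occurs above a slice whose new labels are small, or a
  term with a large new label is nonzero.\<close>

lemma pull_diagram_truncate:
  assumes "is_tangle s D t" "length xs = length s" "d' \<le> d"
    "pull_diagram d W D \<phi> xs \<noteq> pull_diagram d' W D \<phi> xs"
  shows "\<exists>zss. path W D (xs # zss) \<and> \<phi> (last (xs # zss)) \<noteq> 0 \<and> (\<exists>zs\<in>set zss. \<not> set zs \<subseteq> {..<d'})"
  using assms
proof (induction D arbitrary: s xs)
  case Nil
  then show ?case by auto
next
  case (Cons \<sigma> D)
  obtain k e where \<sigma>: "\<sigma> = (k, e)" by force
  have att: "attachable (k, e) s" and tan: "is_tangle (attach \<sigma> s) D t" using Cons.prems(1) \<sigma> by auto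
  obtain s1 s2 us x ws where s: "s = s1 @ src e @ s2" "attach (k, e) s = s1 @ tgt e @ s2"
    "xs = us @ x @ ws" "length s1 = k" "length us = k" "length x = length (src e)" "length ws = length s2"
    using attachable_cases[OF att Cons.prems(2)] by metis
  let ?m = "length (tgt e)"
  let ?\<phi> = "\<lambda>d zs. pull_diagram d W D \<phi> (us @ zs @ ws)"
  have sub: "index_lists d' ?m \<subseteq> index_lists d ?m" using \<open>d' \<le> d\<close> by (force simp: index_lists_def)
  have "(\<Sum>zs\<in>index_lists d ?m. W e zs x * ?\<phi> d zs) \<noteq> (\<Sum>zs\<in>index_lists d' ?m. W e zs x * ?\<phi> d' zs)"
    using Cons.prems(4) unfolding \<sigma> pull_diagram.simps s(3) by (subst (asm) (1 2) pull_split) (use s in auto)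
  moreover have "(\<Sum>zs\<in>index_lists d ?m. W e zs x * ?\<phi> d zs)
     = (\<Sum>zs\<in>index_lists d' ?m. W e zs x * ?\<phi> d zs) + (\<Sum>zs\<in>index_lists d ?m - index_lists d' ?m. W e zs x * ?\<phi> d zs)"
    using sub by (simp add: sum.subset_diff add.commute)
  ultimately consider "(\<Sum>zs\<in>index_lists d' ?m. W e zs x * ?\<phi> d zs) \<noteq> (\<Sum>zs\<in>index_lists d' ?m. W e zs x * ?\<phi> d' zs)"
    | "(\<Sum>zs\<in>index_lists d ?m - index_lists d' ?m. W e zs x * ?\<phi> d zs) \<noteq> 0"
    by fastforce
  then show ?case
  proof cases
    case 1
    hence "\<not> (\<forall>zs\<in>index_lists d' ?m. W e zs x * ?\<phi> d zs = W e zs x * ?\<phi> d' zs)"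
      by (metis (mono_tags, lifting) sum.cong)
    then obtain zs where zs: "zs \<in> index_lists d' ?m" "W e zs x * ?\<phi> d zs \<noteq> W e zs x * ?\<phi> d' zs"
      by blast
    hence nz: "W e zs x \<noteq> 0" "?\<phi> d zs \<noteq> ?\<phi> d' zs" and lz: "length zs = length (tgt e)"
      by (auto simp: index_lists_def)
    have "length (us @ zs @ ws) = length (attach \<sigma> s)" using s lz \<sigma> by simp
    from Cons.IH[OF tan this \<open>d' \<le> d\<close> nz(2)] obtain zss where "path W D ((us @ zs @ ws) # zss)"
        "\<phi> (last ((us @ zs @ ws) # zss)) \<noteq> 0" "\<exists>zs\<in>set zss. \<not> set zs \<subseteq> {..<d'}"
      by auto
    moreover have "step W \<sigma> xs (us @ zs @ ws)" unfolding \<sigma> using s nz(1) lz by auto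
    ultimately show ?thesis by (intro exI[of _ "(us @ zs @ ws) # zss"]) auto
  next
    case 2
    then obtain zs where zs: "zs \<in> index_lists d ?m - index_lists d' ?m" "W e zs x * ?\<phi> d zs \<noteq> 0"
      by (meson sum.not_neutral_contains_not_neutral)
    hence nz: "W e zs x \<noteq> 0" "?\<phi> d zs \<noteq> 0" and lz: "length zs = length (tgt e)"
      and high: "\<not> set (us @ zs @ ws) \<subseteq> {..<d'}"
      by (auto simp: index_lists_def)
    have "length (us @ zs @ ws) = length (attach \<sigma> s)" using s lz \<sigma> by simp
    from pull_diagram_nonzero[OF tan this nz(2)] obtain zss where "path W D ((us @ zs @ ws) # zss)"
        "\<phi> (last ((us @ zs @ ws) # zss)) \<noteq> 0" by auto
    moreover have "step W \<sigma> xs (us @ zs @ ws)" unfolding \<sigma> using s nz(1) lz by auto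
    ultimately show ?thesis using high by (intro exI[of _ "(us @ zs @ ws) # zss"]) auto
  qed
qed

section \<open>States on a knot diagram\<close>

lemma length_levels [simp]: "length (levels s D) = Suc (length D)"
  by (induction D arbitrary: s) auto

lemma levels_0 [simp]: "levels s D ! 0 = s"
  by (cases D) auto

lemma levels_Suc:
  "is_tangle s D t \<Longrightarrow> h < length D \<Longrightarrow>
     attachable (D ! h) (levels s D ! h) \<and> levels s D ! Suc h = attach (D ! h) (levels s D ! h)"
proof (induction D arbitrary: s h)
  case (Cons \<sigma> D)
  then show ?case by (cases h) auto
qed simp

lemma levels_last: "is_tangle s D t \<Longrightarrow> levels s D ! length D = t"
  by (induction D arbitrary: s) auto

lemma path_length: "path W D zss \<Longrightarrow> length zss = Suc (length D)"
  by (induction W D zss rule: path.induct) auto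

lemma path_step: "path W D zss \<Longrightarrow> h < length D \<Longrightarrow> step W (D ! h) (zss ! h) (zss ! Suc h)"
proof (induction W D zss arbitrary: h rule: path.induct)
  case (2 W \<sigma> D x y zss)
  then show ?case by (cases h) auto
qed auto

lemma step_cases:
  assumes "step W (k, e) xs ys" "attachable (k, e) s" "length xs = length s"
  obtains s1 s2 us x z ws where "s = s1 @ src e @ s2" "attach (k, e) s = s1 @ tgt e @ s2"
    "xs = us @ x @ ws" "ys = us @ z @ ws" "length s1 = k" "length us = k" "length x = length (src e)"
    "length z = length (tgt e)" "length ws = length s2" "W e z x \<noteq> 0"
proof -
  obtain us x z ws where 1: "xs = us @ x @ ws" "ys = us @ z @ ws" "length us = k"
      "length x = length (src e)" "length z = length (tgt e)" "W e z x \<noteq> 0"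
    using assms(1) by auto
  moreover obtain s1 s2 where "length s1 = k" "s = s1 @ src e @ s2" "attach (k, e) s = s1 @ tgt e @ s2"
    using attachable_split[OF assms(2)] .
  moreover from this 1 assms(3) have "length ws = length s2" by simp
  ultimately show ?thesis using that by blast
qed

lemma step_length:
  "step W \<sigma> xs ys \<Longrightarrow> attachable \<sigma> s \<Longrightarrow> length xs = length s \<Longrightarrow> length ys = length (attach \<sigma> s)"
  by (cases \<sigma>) auto

lemma step_signed_sum:
  assumes "step W \<sigma> xs ys" "attachable \<sigma> s" "length xs = length s"
    "\<And>e z x. W e z x \<noteq> 0 \<Longrightarrow> length z = length (tgt e) \<Longrightarrow> length x = length (src e) \<Longrightarrow>
       signed_sum f (tgt e) z \<le> signed_sum f (src e) x"
  shows "signed_sum f (attach \<sigma> s) ys \<le> signed_sum f s xs"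
proof -
  obtain k e where \<sigma>: "\<sigma> = (k, e)" by force
  obtain s1 s2 us x z ws where "s = s1 @ src e @ s2" "attach (k, e) s = s1 @ tgt e @ s2"
    "xs = us @ x @ ws" "ys = us @ z @ ws" "length s1 = k" "length us = k" "length x = length (src e)"
    "length z = length (tgt e)" "length ws = length s2" "W e z x \<noteq> 0"
    using step_cases[OF assms(1-3)[unfolded \<sigma>]] .
  thus ?thesis using assms(4)[of e z x] by (simp add: \<sigma>)
qed

lemma path_level_length:
  assumes "is_tangle s D t" "path W D zss" "length (zss ! 0) = length s" "h \<le> length D"
  shows "length (zss ! h) = length (levels s D ! h)"
  using assms(4)
proof (induction h)
  case (Suc h)
  then show ?case using step_length[OF path_step[OF assms(2)]] levels_Suc[OF assms(1)] by simp
qed (use assms in simp)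

lemma path_signed_sum_antimono:
  assumes "is_tangle s D t" "path W D zss" "length (zss ! 0) = length s"
    "\<And>e z x. W e z x \<noteq> 0 \<Longrightarrow> length z = length (tgt e) \<Longrightarrow> length x = length (src e) \<Longrightarrow>
       signed_sum f (tgt e) z \<le> signed_sum f (src e) x"
    "h' \<le> length D" "h \<le> h'"
  shows "signed_sum f (levels s D ! h') (zss ! h') \<le> signed_sum f (levels s D ! h) (zss ! h)"
  using assms(6,5)
proof (induction h' rule: dec_induct)
  case (step n)
  have "signed_sum f (levels s D ! Suc n) (zss ! Suc n) \<le> signed_sum f (levels s D ! n) (zss ! n)"
    using step_signed_sum[OF path_step[OF assms(2)], of n "levels s D ! n" f] levels_Suc[OF assms(1), of n]
      path_level_length[OF assms(1-3), of n] step(3) assms(4) step.prems by simp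
  then show ?case using step by simp
qed simp

lemma wt_nonzero_cases:
  assumes "wt P N g g' e z x \<noteq> 0"
  obtains (Pos) a b i j where "e = Cross_Pos" "z = [a, b]" "x = [i, j]" "P a b i j \<noteq> 0"
  | (Neg) a b i j where "e = Cross_Neg" "z = [a, b]" "x = [i, j]" "N a b i j \<noteq> 0"
  | (Cap) i where "e \<in> {Cap_Down_Up, Cap_Up_Down}" "z = []" "x = [i, i]"
  | (Cup) i where "e \<in> {Cup_Down_Up, Cup_Up_Down}" "z = [i, i]" "x = []"
  using assms by (cases "(P, N, g, g', e, z, x)" rule: wt.cases) (auto split: if_splits)

text \<open>The signed number of indices satisfying \<open>H\<close> cannot increase from a level to the next one and
  vanishes at both ends, so at every crossing \<open>H\<close> is passed on along both strands.\<close>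

lemma path_preserves:
  assumes D: "is_tangle [Up] D [Up]" "one_component [Up] D"
    and P: "\<And>a b i j. P a b i j \<noteq> 0 \<Longrightarrow> (H a \<longrightarrow> H j) \<and> (H b \<longrightarrow> H i)"
    and N: "\<And>a b i j. N a b i j \<noteq> 0 \<Longrightarrow> (H a \<longrightarrow> H j) \<and> (H b \<longrightarrow> H i)"
    and path: "path (wt P N g g') D zss" "zss ! 0 = [c]" "last zss = [c']" "\<not> H c" "\<not> H c'"
    and zs: "zs \<in> set zss" "x \<in> set zs"
  shows "\<not> H x"
proof -
  define f where "f n = (if H n then 1 else 0 :: int)" for n
  define L where "L = levels [Up] D"
  define val where "val q = zss ! fst q ! snd q" for q :: "nat \<times> nat"
  note lens = path_length[OF path(1)]
  have len0: "length (zss ! 0) = length [Up]" using path by simp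
  have mono: "signed_sum f (tgt e) z \<le> signed_sum f (src e) x" if "wt P N g g' e z x \<noteq> 0" for e z x
    using that by (cases rule: wt_nonzero_cases) (auto simp: f_def dest: P N)
  have anti: "signed_sum f (L ! h') (zss ! h') \<le> signed_sum f (L ! h) (zss ! h)"
    if "h' \<le> length D" "h \<le> h'" for h h'
    unfolding L_def by (rule path_signed_sum_antimono[OF D(1) path(1) len0]) (use mono that in auto)
  have const: "signed_sum f (L ! h) (zss ! h) = 0" if "h \<le> length D" for h
  proof -
    have "signed_sum f (L ! 0) (zss ! 0) = 0" using path by (simp add: L_def f_def)
    moreover have "zss \<noteq> []" using lens by auto
    hence "zss ! length D = [c']" using path(3) lens by (simp add: last_conv_nth)
    hence "signed_sum f (L ! length D) (zss ! length D) = 0"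
      using path lens levels_last[OF D(1)] by (simp add: L_def f_def)
    ultimately show ?thesis using anti[of h 0] anti[of "length D" h] that by simp
  qed
  have arc: "H (val p) = H (val q)" if pq: "(p, q) \<in> diagram_arcs [Up] D" for p q
  proof -
    obtain h where h: "h < length D" "(p, q) \<in> slice_arcs h (length (L ! h)) (D ! h)"
      using pq unfolding diagram_arcs_def L_def by blast
    obtain k e where ke: "D ! h = (k, e)" by force
    have lev: "attachable (k, e) (L ! h)" "L ! Suc h = attach (k, e) (L ! h)"
      using levels_Suc[OF D(1) h(1)] by (auto simp: L_def ke)
    have "length (zss ! h) = length (L ! h)"
      using path_level_length[OF D(1) path(1) len0] h by (simp add: L_def)
    moreover have "step (wt P N g g') (k, e) (zss ! h) (zss ! Suc h)" using path_step[OF path(1) h(1)] ke by simp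
    ultimately obtain s1 s2 us x z ws where st: "L ! h = s1 @ src e @ s2" "attach (k, e) (L ! h) = s1 @ tgt e @ s2"
      "zss ! h = us @ x @ ws" "zss ! Suc h = us @ z @ ws" "length s1 = k" "length us = k" "length x = length (src e)"
      "length z = length (tgt e)" "length ws = length s2" "wt P N g g' e z x \<noteq> 0"
      using step_cases lev(1) by metis
    have eq: "signed_sum f (tgt e) z = signed_sum f (src e) x"
      using const[of h] const[of "Suc h"] h(1) lev(2) st by simp
    have arcs: "(p, q) \<in> {((h, p), (Suc h, p)) | p. p < k} \<union> piece_arcs h k e
       \<union> {((h, k + length (src e) + p), (Suc h, k + length (tgt e) + p)) | p.
          k + length (src e) + p < length (L ! h)}"
      using h(2) ke by simp
    have u: "(us @ r) ! k = r ! 0" "(us @ r) ! Suc k = r ! 1" for r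
      using st(6) by (auto simp: nth_append)
    from arcs consider (left) p' where "p = (h, p')" "q = (Suc h, p')" "p' < k" | (piece) "(p, q) \<in> piece_arcs h k e"
      | (right) p' where "p = (h, k + length (src e) + p')" "q = (Suc h, k + length (tgt e) + p')"
      by blast
    then show ?thesis
    proof cases
      case left
      then show ?thesis using st by (simp add: val_def nth_append)
    next
      case right
      then show ?thesis using st by (simp add: val_def nth_append)
    next
      case piece
      from st(10) show ?thesis
      proof (cases rule: wt_nonzero_cases)
        case (Pos a b i j)
        hence "H a = H j \<and> H b = H i" using eq P[of a b i j] by (auto simp: f_def split: if_splits)
        thus ?thesis using piece Pos st(3,4) by (auto simp: val_def u)
      next
        case (Neg a b i j)
        hence "H a = H j \<and> H b = H i" using eq N[of a b i j] by (auto simp: f_def split: if_splits)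
        thus ?thesis using piece Neg st(3,4) by (auto simp: val_def u)
      next
        case (Cap i)
        thus ?thesis using piece st(3,4) by (auto simp: val_def u)
      next
        case (Cup i)
        thus ?thesis using piece st(3,4) by (auto simp: val_def u)
      qed
    qed
  qed
  \<comment> \<open>A single component joins every point of the diagram to the bottom end, where
    \<open>H\<close> fails.\<close>
  have conn: "H (val p) = H (val q)" if "(p, q) \<in> (diagram_arcs [Up] D \<union> (diagram_arcs [Up] D)\<inverse>)\<^sup>*" for p q
    using that by induction (auto dest: arc)
  obtain h where h: "h < length zss" "zss ! h = zs" using zs by (auto simp: in_set_conv_nth)
  obtain i where i: "i < length zs" "zs ! i = x" using zs by (auto simp: in_set_conv_nth)
  have "(h, i) \<in> diagram_points [Up] D"
    using h i lens path_level_length[OF D(1) path(1) len0, of h] by (auto simp: diagram_points_def)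
  moreover have "(0, 0) \<in> diagram_points [Up] D" by (simp add: diagram_points_def)
  ultimately have "H (val (0, 0)) = H (val (h, i))" using D(2) conn unfolding one_component_def by blast
  thus ?thesis using path h i by (simp add: val_def)
qed

abbreviation entry :: "nat list \<Rightarrow> nat list \<Rightarrow> 'a::comm_ring_1" where
  "entry ys zs \<equiv> (if zs = ys then 1 else 0)"

text \<open>Take \<open>H x\<close> to be \<open>d' \<le> x\<close> in
  \<open>path_preserves\<close>: a contributing state on a knot that starts and ends with 0 keeps
  all its labels below \<open>d'\<close>, so the larger truncation adds nothing.\<close>

lemma pull_diagram_truncate_eq:
  assumes D: "is_tangle [Up] D [Up]" "one_component [Up] D" and d: "0 < d'" "d' \<le> d"
    and P: "\<And>a b i j. P a b i j \<noteq> 0 \<Longrightarrow> (a \<ge> d' \<longrightarrow> j \<ge> d') \<and> (b \<ge> d' \<longrightarrow> i \<ge> d')"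
    and N: "\<And>a b i j. N a b i j \<noteq> 0 \<Longrightarrow> (a \<ge> d' \<longrightarrow> j \<ge> d') \<and> (b \<ge> d' \<longrightarrow> i \<ge> d')"
  shows "pull_diagram d (wt P N g g') D (entry [0]) [0] = pull_diagram d' (wt P N g g') D (entry [0]) [0]"
proof (rule ccontr)
  assume "\<not> ?thesis"
  from pull_diagram_truncate[OF D(1) _ d(2) this] obtain zss where zss: "path (wt P N g g') D ([0] # zss)"
      "(entry [0] (last ([0] # zss)) :: 'a) \<noteq> 0" "\<exists>zs\<in>set zss. \<not> set zs \<subseteq> {..<d'}"
    by auto
  have last: "last ([0] # zss) = [0]" by (rule ccontr) (use zss(2) in \<open>simp del: last.simps\<close>)
  from zss(3) obtain zs x where "zs \<in> set zss" "x \<in> set zs" "x \<ge> d'" by (meson lessThan_iff not_le subsetI)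
  moreover have "\<not> d' \<le> x"
    by (rule path_preserves[where H = "\<lambda>x. d' \<le> x", OF D P N zss(1) _ last _ _ _ \<open>x \<in> set zs\<close>])
       (use \<open>zs \<in> set zss\<close> d in \<open>auto simp: not_le\<close>)
  ultimately show False by simp
qed

lemma pull_diagram_diagonal:
  assumes D: "is_tangle [Up] D [Up]"
    and P: "\<And>a b i j. P a b i j \<noteq> 0 \<Longrightarrow> a + b = i + j"
    and N: "\<And>a b i j. N a b i j \<noteq> 0 \<Longrightarrow> a + b = i + j"
    and "i \<noteq> j"
  shows "pull_diagram d (wt P N g g') D (entry [j]) [i] = 0"
proof (rule ccontr)
  assume "\<not> ?thesis"
  from pull_diagram_nonzero[OF D _ this] obtain zss where zss: "path (wt P N g g') D ([i] # zss)"
      "last ([i] # zss) = [j]" by (auto split: if_splits)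
  have eq: "signed_sum f (tgt e) z = signed_sum f (src e) x" if "wt P N g g' e z x \<noteq> 0" and f: "f = int \<or> f = (\<lambda>x. - int x)" for e z x f
    using that(1) by (cases rule: wt_nonzero_cases) (use f in \<open>auto dest!: P N\<close>)
  have fin: "([i] # zss) ! length D = [j]" using last_conv_nth[of "[i] # zss"] zss(2) path_length[OF zss(1)] by simp
  \<comment> \<open>Monotonicity for \<open>int\<close> and for its negative together give
    conservation of the weight.\<close>
  have "signed_sum f [Up] [j] \<le> signed_sum f [Up] [i]" if f: "f = int \<or> f = (\<lambda>x. - int x)" for f
    using path_signed_sum_antimono[OF D zss(1), of f "length D" 0] eq[OF _ f] fin levels_last[OF D] by simp
  from this[of int] this[of "\<lambda>x. - int x"] \<open>i \<noteq> j\<close> show False by simp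
qed

section \<open>Gaussian binomials and the crossing weights\<close>

text \<open>The Gaussian binomial of n + j over n, in base \<open>w\<close>. Pascal's rule, unlike a
  quotient of factorials, makes sense at roots of unity and in every commutative ring, and the two
  arguments play symmetric roles.\<close>

fun gauss :: "'a::comm_ring_1 \<Rightarrow> nat \<Rightarrow> nat \<Rightarrow> 'a" where
  "gauss w 0 j = 1"
| "gauss w (Suc n) 0 = 1"
| "gauss w (Suc n) (Suc j) = gauss w n (Suc j) + w ^ Suc n * gauss w (Suc n) j"

lemma gauss_0_right [simp]: "gauss w n 0 = 1"
  by (cases n) auto

text \<open>Expanding both summands of one Pascal rule by the other gives four terms that can be
  regrouped either way. The two rules together yield the symmetry and, by elimination, the
  absorption law without division.\<close>

lemma gauss_Suc_Suc':
  "gauss w (Suc n) (Suc j) = gauss w (Suc n) j + w ^ Suc j * gauss w n (Suc j)"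
proof (induction n arbitrary: j)
  case 0
  show ?case by (induction j) (auto simp: algebra_simps)
next
  case (Suc n)
  note IH = Suc
  show ?case
  proof (induction j)
    case 0
    define g where "g = gauss w n (Suc 0)"
    have g: "g + w ^ Suc n = 1 + w * g" using IH[of 0] by (simp add: g_def algebra_simps)
    have a: "gauss w (Suc n) (Suc 0) = 1 + w * g" using g by (simp add: g_def)
    have b: "gauss w (Suc (Suc n)) (Suc 0) = gauss w (Suc n) (Suc 0) + w * w ^ Suc n" by simp
    show ?case unfolding b a using arg_cong[OF g, of "(*) w"] by (simp add: algebra_simps)
  next
    case (Suc j)
    define x where "x = gauss w (Suc n) (Suc j)"
    define y where "y = gauss w n (Suc (Suc j))"
    define z where "z = gauss w (Suc (Suc n)) j"
    have 1: "gauss w (Suc n) (Suc (Suc j)) = x + w ^ Suc (Suc j) * y" using IH by (simp only: x_def y_def)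
    have 2: "gauss w (Suc (Suc n)) (Suc j) = z + w ^ Suc j * x" using Suc by (simp only: x_def z_def)
    have 3: "gauss w (Suc n) (Suc (Suc j)) = y + w ^ Suc n * x" by (simp add: x_def y_def)
    have 4: "gauss w (Suc (Suc n)) (Suc j) = x + w ^ Suc (Suc n) * z" by (simp add: x_def z_def)
    have "gauss w (Suc (Suc n)) (Suc (Suc j)) = gauss w (Suc n) (Suc (Suc j)) + w ^ Suc (Suc n) * gauss w (Suc (Suc n)) (Suc j)"
      by simp
    also have "\<dots> = (x + w ^ Suc (Suc j) * y) + w ^ Suc (Suc n) * (z + w ^ Suc j * x)" unfolding 1 2 ..
    also have "\<dots> = (x + w ^ Suc (Suc n) * z) + w ^ Suc (Suc j) * (y + w ^ Suc n * x)"
      by (simp add: algebra_simps power_add)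
    also have "\<dots> = gauss w (Suc (Suc n)) (Suc j) + w ^ Suc (Suc j) * gauss w (Suc n) (Suc (Suc j))" unfolding 3 4 ..
    finally show ?case .
  qed
qed

lemma gauss_commute: "gauss w n j = gauss w j n"
proof (induction w n j rule: gauss.induct)
  case (3 w n j)
  then show ?case by (simp only: gauss.simps(3)[of w n j] gauss_Suc_Suc'[of w j n])
qed auto

lemma gauss_absorb: "(1 - w ^ Suc n) * gauss w (Suc n) j = (1 - w ^ Suc (n + j)) * gauss w n j"
proof (cases j)
  case (Suc j')
  define x where "x = gauss w (Suc n) j'"
  define y where "y = gauss w n (Suc j')"
  define G where "G = gauss w (Suc n) (Suc j')"
  have 1: "G = y + w ^ Suc n * x" by (simp add: G_def x_def y_def)
  have 2: "G = x + w ^ Suc j' * y" unfolding G_def x_def y_def by (rule gauss_Suc_Suc')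
  have "G - w ^ Suc n * G = (y + w ^ Suc n * x) - w ^ Suc n * (x + w ^ Suc j' * y)" using 1 2 by simp
  thus ?thesis unfolding Suc G_def[symmetric] y_def[symmetric] by (simp add: algebra_simps power_add)
qed simp

definition qpoch :: "'a::comm_ring_1 \<Rightarrow> nat \<Rightarrow> 'a" where
  "qpoch w n = (\<Prod>x<n. 1 - w ^ Suc x)"

lemma gauss_qpoch: "gauss w n j * qpoch w n * qpoch w j = qpoch w (n + j)"
proof (induction n)
  case (Suc n)
  have "gauss w (Suc n) j * qpoch w (Suc n) * qpoch w j
      = ((1 - w ^ Suc n) * gauss w (Suc n) j) * qpoch w n * qpoch w j"
    by (simp add: qpoch_def mult_ac)
  also have "\<dots> = (1 - w ^ Suc (n + j)) * (gauss w n j * qpoch w n * qpoch w j)"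
    unfolding gauss_absorb by (simp add: mult_ac)
  also have "\<dots> = qpoch w (Suc n + j)" unfolding Suc by (simp add: qpoch_def mult_ac)
  finally show ?case .
qed (simp add: qpoch_def)

text \<open>Both sides are the Gaussian trinomial with parts n, m and j; \<open>gauss_qpoch\<close>
  clears denominators, whence the nonvanishing assumptions.\<close>

lemma gauss_mult_gauss:
  fixes w :: "'a::field"
  assumes "qpoch w n \<noteq> 0" "qpoch w m \<noteq> 0" "qpoch w j \<noteq> 0"
  shows "gauss w n j * gauss w m (n + j) = gauss w (n + m) j * gauss w m n"
proof -
  let ?c = "qpoch w n * qpoch w m * qpoch w j"
  have "(gauss w n j * gauss w m (n + j)) * ?c = gauss w m (n + j) * qpoch w m * (gauss w n j * qpoch w n * qpoch w j)"
    by (simp add: mult_ac)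
  also have "\<dots> = qpoch w (m + (n + j))" unfolding gauss_qpoch by (simp add: gauss_qpoch)
  also have "\<dots> = gauss w (n + m) j * qpoch w (m + n) * qpoch w j"
    using gauss_qpoch[of w "n + m" j] by (simp add: add_ac)
  also have "\<dots> = (gauss w (n + m) j * gauss w m n) * ?c"
    unfolding gauss_qpoch[of w m n, symmetric] by (simp add: mult_ac)
  finally show ?thesis using assms by simp
qed

lemma powi_split: "(q::'a::field) \<noteq> 0 \<Longrightarrow> e = a + b \<Longrightarrow> q powi e = q powi a * q powi b"
  by (simp add: power_int_add)

lemma square_power: "((q::'a::field)\<^sup>2) ^ n = q powi (2 * int n)"
  by (metis of_nat_mult of_nat_numeral power_int_of_nat power_mult)

text \<open>This is the q-binomial theorem for the product of the \<open>1 - w ^ k * z\<close> with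
  k < N, where w is \<open>q\<^sup>2\<close> and z is w^(1-N), so that the last factor is zero. The
  partial sum up to \<open>k\<close> has the closed form \<open>u k\<close>, by the second Pascal
  rule.\<close>

lemma alternating_gauss_sum:
  fixes q :: "'a::field"
  assumes "q \<noteq> 0"
  shows "(\<Sum>n\<le>N. (- 1) ^ n * q powi (- (int n * (int n - 1)) - 2 * int n * int (N - n)) * gauss (q\<^sup>2) n (N - n))
    = (if N = 0 then 1 else 0)"
proof (cases N)
  case (Suc M)
  define e where "e n = int n * (int n - 1) - 2 * int n * int M" for n
  define u where "u n = (- 1) ^ n * q powi e n * gauss (q\<^sup>2) n (M - n)" for n
  define T where "T n = (- 1) ^ n * q powi e n * gauss (q\<^sup>2) n (N - n)" for n
  have partial: "sum T {..k} = u k" if "k \<le> M" for k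
    using that
  proof (induction k)
    case 0
    show ?case by (simp add: T_def u_def)
  next
    case (Suc k)
    obtain j where j: "M = Suc k + j" using Suc.prems le_Suc_ex by blast
    have "(q\<^sup>2) ^ Suc j = q powi (2 * int (Suc j))"
      by (rule square_power)
    moreover have "q powi e k = q powi e (Suc k) * q powi (2 * int (Suc j))"
      by (rule powi_split[OF assms]) (simp add: e_def j algebra_simps)
    ultimately have "q powi e (Suc k) * (q\<^sup>2) ^ Suc j = q powi e k" by simp
    hence "T (Suc k) = u (Suc k) - u k"
      unfolding T_def u_def \<open>N = Suc M\<close> j
      by (simp add: gauss_Suc_Suc' Suc_diff_le algebra_simps del: gauss.simps)
    then show ?case using Suc by simp
  qed
  have "e N = e M" by (simp add: e_def Suc algebra_simps)
  hence "T N = - u M" by (simp add: T_def u_def Suc)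
  hence "sum T {..N} = 0" using partial[of M] by (simp add: Suc)
  moreover have "sum T {..N} = (\<Sum>n\<le>N. (- 1) ^ n * q powi (- (int n * (int n - 1)) - 2 * int n * int (N - n)) * gauss (q\<^sup>2) n (N - n))"
    by (rule sum.cong[OF refl]) (auto simp: T_def e_def Suc of_nat_diff algebra_simps)
  ultimately show ?thesis by (simp add: Suc)
qed simp

section \<open>Divided powers of F and the crossings of Verma modules\<close>

lemma powi_mult_eq: "(q::'a::field) \<noteq> 0 \<Longrightarrow> a + b = c + d \<Longrightarrow> q powi a * q powi b = q powi c * q powi d"
  by (metis power_int_add)

lemma powi_mult3_eq: "(q::'a::field) \<noteq> 0 \<Longrightarrow> a + b + c = d \<Longrightarrow> q powi a * q powi b * q powi c = q powi d"
  by (metis power_int_add)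

text \<open>The normalization leaves only even powers of \<open>q\<close> and \<open>A\<close>. At a
  root of unity the entry then involves only the base \<open>q\<^sup>2\<close>, so that indices can
  be reduced modulo its order without stray signs.\<close>

definition th :: "'a::field \<Rightarrow> 'a \<Rightarrow> nat \<Rightarrow> nat \<Rightarrow> 'a" where
  "th q A n j = q powi (- 2 * int n * int j) * gauss (q\<^sup>2) n j * (\<Prod>x<n. 1 - q ^ (2 * (j + x)) * A powi (- 2))"

lemma th_0 [simp]: "th q A 0 j = 1"
  by (simp add: th_def)

lemma th_Suc_0: "th q A (Suc n) 0 = (1 - q ^ (2 * n) * A powi (- 2)) * th q A n 0"
  by (simp add: th_def mult_ac)

text \<open>The commutator of E with F^(n+1) on v_(j+1): E F^(n+1) and F^(n+1) E differ by F^(n)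
  times a combination of K and its inverse. Both Pascal rules enter, so no quantum integer is
  inverted. Together with \<open>th_Suc_0\<close>, the case of v_0, this relation makes the
  crossings commute with E.\<close>

lemma th_Suc_Suc:
  fixes q :: "'a::field"
  assumes q: "q \<noteq> 0"
  shows "th q A (Suc n) (Suc j) =
    th q A (Suc n) j + q powi (- 2 * int (Suc j)) * (1 - q ^ (2 * (2 * Suc j + n)) * A powi (- 2)) * th q A n (Suc j)"
proof -
  define w c where "w = q\<^sup>2" and "c = A powi (- 2)"
  define U where "U = q powi (- 2 * int (Suc n) * int (Suc j))"
  define Pr where "Pr = (\<Prod>x<n. 1 - q ^ (2 * (Suc j + x)) * c)"
  have w: "q ^ (2 * k) = w ^ k" for k by (simp add: w_def power_mult)
  have U1: "q powi (- 2 * int (Suc n) * int j) = U * w ^ Suc n"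
    unfolding w_def square_power U_def by (rule powi_split[OF q]) (simp add: algebra_simps)
  have U2: "U = q powi (- 2 * int (Suc j)) * q powi (- 2 * int n * int (Suc j))"
    unfolding U_def by (rule powi_split[OF q]) (simp add: algebra_simps)
  have e1: "th q A (Suc n) (Suc j) = U * gauss w (Suc n) (Suc j) * (Pr * (1 - w ^ (Suc j + n) * c))"
    unfolding th_def prod.lessThan_Suc U_def Pr_def c_def w_def[symmetric] w by (simp only: mult_ac)
  have "(\<Prod>x<Suc n. 1 - q ^ (2 * (j + x)) * c) = (1 - w ^ j * c) * Pr"
    unfolding prod.lessThan_Suc_shift Pr_def by (simp add: w)
  hence e2: "th q A (Suc n) j = U * w ^ Suc n * gauss w (Suc n) j * ((1 - w ^ j * c) * Pr)"
    unfolding th_def w_def[symmetric] c_def[symmetric] U1 by simp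
  have e3: "q powi (- 2 * int (Suc j)) * th q A n (Suc j) = U * gauss w n (Suc j) * Pr"
    by (simp add: th_def U2 Pr_def c_def w_def[symmetric])
  define G x y where "G = gauss w (Suc n) (Suc j)" and "x = gauss w (Suc n) j" and "y = gauss w n (Suc j)"
  have G1: "G = y + w ^ Suc n * x" unfolding G_def x_def y_def by simp
  have G2: "G = x + w ^ Suc j * y" unfolding G_def x_def y_def by (rule gauss_Suc_Suc')
  have "G * (1 - w ^ (Suc j + n) * c) = G - c * w ^ (Suc j + n) * G" by (simp add: algebra_simps)
  also have "\<dots> = (y + w ^ Suc n * x) - c * w ^ (Suc j + n) * (x + w ^ Suc j * y)" using G1 G2 by simp
  also have "\<dots> = w ^ Suc n * x * (1 - w ^ j * c) + (1 - w ^ (2 * Suc j + n) * c) * y"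
    by (simp add: algebra_simps power_add power_mult power2_eq_square)
  finally have F: "gauss w (Suc n) (Suc j) * (1 - w ^ (Suc j + n) * c) =
     w ^ Suc n * gauss w (Suc n) j * (1 - w ^ j * c) + (1 - w ^ (2 * Suc j + n) * c) * gauss w n (Suc j)"
    unfolding G_def x_def y_def .
  have "th q A (Suc n) (Suc j) = U * Pr * (gauss w (Suc n) (Suc j) * (1 - w ^ (Suc j + n) * c))"
    unfolding e1 by (simp only: mult_ac)
  also have "\<dots> = U * w ^ Suc n * gauss w (Suc n) j * ((1 - w ^ j * c) * Pr)
      + (1 - w ^ (2 * Suc j + n) * c) * (U * gauss w n (Suc j) * Pr)"
    unfolding F distrib_left by (simp only: mult_ac)
  finally show ?thesis unfolding e2[symmetric] e3[symmetric] unfolding c_def w by (simp only: mult_ac)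
qed

text \<open>F^(m) after F^(n) is a Gaussian multiple of F^(n+m); the product over \<open>x\<close>
  splits into the ranges belonging to the two factors.\<close>

lemma th_mult_th:
  fixes q :: "'a::field"
  assumes q: "q \<noteq> 0" and nz: "qpoch (q\<^sup>2) n \<noteq> 0" "qpoch (q\<^sup>2) m \<noteq> 0" "qpoch (q\<^sup>2) j \<noteq> 0"
  shows "th q A n j * th q A m (j + n) = th q A (n + m) j * (q powi (- 2 * int n * int m) * gauss (q\<^sup>2) m n)"
proof -
  have "q powi (- 2 * int n * int j) * q powi (- 2 * int m * int (j + n))
      = q powi (- 2 * int (n + m) * int j) * q powi (- 2 * int n * int m)"
    using q by (simp add: power_int_add[symmetric] algebra_simps)
  moreover have "(\<Prod>x<n + m. 1 - q ^ (2 * (j + x)) * A powi (- 2)) =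
     (\<Prod>x<n. 1 - q ^ (2 * (j + x)) * A powi (- 2)) * (\<Prod>x<m. 1 - q ^ (2 * (j + n + x)) * A powi (- 2))"
    by (induction m) (simp_all add: add_ac mult_ac)
  ultimately show ?thesis
    using gauss_mult_gauss[OF nz] by (simp add: th_def add.commute[of j n] mult_ac)
qed

text \<open>\<open>th q A n j\<close> is \<open>A\<^sup>-\<^sup>n q\<^bsup>n(n-1)/2\<^esup>\<close> times the matrix entry of \<open>F\<^sup>(\<^sup>n\<^sup>)\<close> at \<open>v\<^sub>j\<close>, for \<open>A = q\<^sup>\<alpha>\<close>; see
  \<open>th_eq_falling\<close>.  Up to the factors \<open>q\<close> to the powers \<open>\<alpha>\<^sup>2/2\<close> and \<open>- \<alpha>\<^sup>2/2\<close>, the two crossings of Verma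
  modules are \<open>cpos\<close> and \<open>cneg\<close>.\<close>

definition cpos :: "'a::field \<Rightarrow> 'a \<Rightarrow> nat \<Rightarrow> nat \<Rightarrow> nat \<Rightarrow> nat \<Rightarrow> 'a" where
  "cpos q A a b i j = (if j \<le> a \<and> a + b = i + j
     then A powi (- (int j + int b)) * q powi (2 * int a * int b) * th q A (a - j) j else 0)"

definition cneg :: "'a::field \<Rightarrow> 'a \<Rightarrow> nat \<Rightarrow> nat \<Rightarrow> nat \<Rightarrow> nat \<Rightarrow> 'a" where
  "cneg q A a b i j = (if i \<le> b \<and> a + b = i + j
     then (- 1) ^ (b - i) * A powi (int j + int b)
       * q powi (- 2 * int i * int j - int (b - i) * (int (b - i) - 1)) * th q A (b - i) i else 0)"

text \<open>The coefficient of v_a \<otimes> v_b in the statement that the crossing commutes with 1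
  \<otimes> E + E \<otimes> K. Apart from the boundary case \<open>j = Suc a\<close>, where two of
  the four terms vanish, a common monomial cancels and \<open>th_Suc_Suc\<close>, or
  \<open>th_Suc_0\<close> if \<open>j = 0\<close>, remains.\<close>

lemma cpos_E:
  fixes q :: "'a::field"
  assumes q: "q \<noteq> 0" and A: "A \<noteq> 0"
  shows "(if 0 < j then cpos q A a b i (j - 1) else 0) + A * q powi (- 2 * int j) * (if 0 < i then cpos q A a b (i - 1) j else 0)
    = cpos q A a (Suc b) i j + A * q powi (- 2 * int b) * cpos q A (Suc a) b i j"
proof (cases "Suc (a + b) = i + j \<and> j \<le> Suc a")
  case False
  hence "cpos q A a (Suc b) i j = 0" "cpos q A (Suc a) b i j = 0" "0 < j \<longrightarrow> cpos q A a b i (j - 1) = 0"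
    "0 < i \<longrightarrow> cpos q A a b (i - 1) j = 0"
    by (auto simp: cpos_def)
  thus ?thesis by auto
next
  case True
  show ?thesis
  proof (cases "j = Suc a")
    case True': True
    with True have "i = b" by simp
    have "A powi (- (int a + int b)) = A * A powi (- (int (Suc a) + int b))"
      using A by (subst power_int_add_1'[symmetric]) (simp_all add: algebra_simps)
    moreover have "q powi (2 * int a * int b) = q powi (- 2 * int b) * q powi (2 * int (Suc a) * int b)"
      by (rule powi_split[OF q]) (simp add: algebra_simps)
    ultimately show ?thesis using True' \<open>i = b\<close> by (simp add: cpos_def)
  next
    case False
    then obtain m where m: "a = j + m" using True by (metis le_SucE le_iff_add)
    hence i: "i = Suc (m + b)" using True by simp
    define X where "X = A powi (- (int j + int b))"
    define Y where "Y = q powi (2 * int a * int b)"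
    have X1: "A * A powi (- (int j + int (Suc b))) = X"
      unfolding X_def using A by (subst power_int_add_1'[symmetric]) (simp_all add: algebra_simps)
    have Y1: "q powi (2 * int a * int (Suc b)) = Y * q ^ (2 * a)"
      unfolding Y_def power_int_of_nat[symmetric] by (rule powi_split[OF q]) (simp add: algebra_simps)
    have Y2: "q powi (- 2 * int b) * q powi (2 * int (Suc a) * int b) = Y"
      unfolding Y_def by (rule powi_split[OF q, symmetric]) (simp add: algebra_simps)
    have A2: "X = A * (A * (A powi (- 2) * X))" using A by (simp add: power_int_minus power2_eq_square field_simps)
    have t2: "A * q powi (- 2 * int j) * cpos q A a b (i - 1) j = A * X * Y * (q powi (- 2 * int j) * th q A m j)"
      by (simp add: cpos_def i m X_def Y_def mult_ac)
    have "cpos q A a (Suc b) i j = (A powi (- (int j + int (Suc b)))) * (Y * q ^ (2 * a)) * th q A m j"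
      unfolding Y1[symmetric] by (simp add: cpos_def i m)
    also have "A powi (- (int j + int (Suc b))) = A * (A powi (-2) * X)"
      using A2 X1 A by (metis mult_left_cancel)
    finally have t3: "cpos q A a (Suc b) i j = A * X * Y * (q ^ (2 * a) * A powi (-2) * th q A m j)" by (simp add: mult_ac)
    have "A * q powi (- 2 * int b) * cpos q A (Suc a) b i j =
        A * X * (q powi (- 2 * int b) * q powi (2 * int (Suc a) * int b)) * th q A (Suc m) j"
      by (simp add: cpos_def i m X_def mult_ac Suc_diff_le)
    hence t4: "A * q powi (- 2 * int b) * cpos q A (Suc a) b i j = A * X * Y * th q A (Suc m) j" unfolding Y2 .
    have i0: "0 < i" using i by simp
    show ?thesis
    proof (cases j)
      case 0
      have "th q A m j = q ^ (2 * a) * A powi (-2) * th q A m j + th q A (Suc m) j"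
        unfolding 0 th_Suc_0 m by (simp add: algebra_simps)
      hence "A * X * Y * th q A m j = A * X * Y * (q ^ (2 * a) * A powi (-2) * th q A m j) + A * X * Y * th q A (Suc m) j"
        unfolding distrib_left[symmetric] by (rule arg_cong)
      thus ?thesis unfolding t3 t4 if_P[OF i0] t2 using 0 by simp
    next
      case (Suc j')
      have j0: "0 < j" using Suc by simp
      have "A powi (- (int j' + int b)) = A * X"
        unfolding X_def Suc using A by (subst power_int_add_1'[symmetric]) (simp_all add: algebra_simps)
      hence t1: "cpos q A a b i (j - 1) = A * X * Y * th q A (Suc m) j'"
        by (simp add: cpos_def i m Suc Y_def Suc_diff_le)
      have eq: "th q A (Suc m) j = th q A (Suc m) j' + q powi (- 2 * int j) * (1 - q ^ (2 * (2 * j + m)) * A powi (- 2)) * th q A m j"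
        using th_Suc_Suc[OF q, of A m j'] Suc by simp
      have "q powi (- 2 * int j) * q ^ (2 * (2 * j + m)) = q ^ (2 * a)"
        unfolding power_int_of_nat[symmetric] by (rule powi_split[OF q, symmetric]) (simp add: m algebra_simps)
      hence "th q A (Suc m) j' + q powi (- 2 * int j) * th q A m j = q ^ (2 * a) * A powi (-2) * th q A m j + th q A (Suc m) j"
        unfolding eq by (simp add: algebra_simps)
      hence "A * X * Y * (th q A (Suc m) j' + q powi (- 2 * int j) * th q A m j) =
         A * X * Y * (q ^ (2 * a) * A powi (-2) * th q A m j + th q A (Suc m) j)" by simp
      thus ?thesis unfolding t3 t4 if_P[OF i0] if_P[OF j0] t1 t2 distrib_left .
    qed
  qed
qed

text \<open>Checked entrywise like \<open>cpos_E\<close> rather than by inverting the positive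
  crossing: in this form it holds for all nonzero \<open>q\<close> and \<open>A\<close>, in
  particular at roots of unity, and without truncation.\<close>

lemma cneg_E:
  fixes q :: "'a::field"
  assumes q: "q \<noteq> 0" and A: "A \<noteq> 0"
  shows "(if 0 < j then cneg q A a b i (j - 1) else 0) + A * q powi (- 2 * int j) * (if 0 < i then cneg q A a b (i - 1) j else 0)
    = cneg q A a (Suc b) i j + A * q powi (- 2 * int b) * cneg q A (Suc a) b i j"
proof (cases "Suc (a + b) = i + j \<and> i \<le> Suc b")
  case False
  hence "cneg q A a (Suc b) i j = 0" "cneg q A (Suc a) b i j = 0" "0 < j \<longrightarrow> cneg q A a b i (j - 1) = 0"
    "0 < i \<longrightarrow> cneg q A a b (i - 1) j = 0"
    by (auto simp: cneg_def)
  thus ?thesis by auto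
next
  case True
  show ?thesis
  proof (cases "i = Suc b")
    case True': True
    with True have "j = a" by simp
    have "A powi (int j + int (Suc b)) = A * A powi (int j + int b)"
      using A by (subst power_int_add_1'[symmetric]) (simp_all add: algebra_simps)
    moreover have "q powi (- 2 * int j) * q powi (- 2 * int b * int j) = q powi (- 2 * int i * int j)"
      unfolding True' by (rule powi_split[OF q, symmetric]) (simp add: algebra_simps)
    ultimately show ?thesis using True' \<open>j = a\<close> by (simp add: cneg_def)
  next
    case False
    then obtain m where m: "b = i + m" using True by (metis le_SucE le_iff_add)
    hence j: "j = Suc (m + a)" using True by simp
    define X where "X = A powi (int j + int (Suc b))"
    define Y where "Y = q powi (- 2 * int i * int j - int (Suc m) * int m)"
    have X1: "A powi (int j + int b) * A = X"
      unfolding X_def using A by (subst power_int_add_1[symmetric]) (simp_all add: algebra_simps)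
    have X0: "A powi (int (m + a) + int b) = A powi (-2) * X"
      unfolding X_def by (rule powi_split[OF A]) (simp add: j algebra_simps)
    have s: "(- 1) ^ Suc m = - ((- 1) ^ m :: 'a)" by simp
    have t1: "cneg q A a b i (j - 1) = - ((-1) ^ Suc m * X * Y * (q powi (2 * (int b)) * A powi (-2) * th q A m i))"
    proof -
      have "q powi (- 2 * int i * int (m + a) - int m * (int m - 1)) = Y * q powi (2 * int b)"
        unfolding Y_def by (rule powi_split[OF q]) (simp add: j m algebra_simps)
      thus ?thesis using X0 by (simp add: cneg_def m j mult_ac)
    qed
    have t3: "cneg q A a (Suc b) i j = (-1) ^ Suc m * X * Y * th q A (Suc m) i"
      unfolding X_def Y_def by (simp add: cneg_def j m Suc_diff_le)
    have t4: "A * q powi (- 2 * int b) * cneg q A (Suc a) b i j = - ((-1) ^ Suc m * X * Y * (q powi (- 2 * int i) * th q A m i))"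
    proof -
      have "q powi (- 2 * int b) * q powi (- 2 * int i * int j - int m * (int m - 1)) = Y * q powi (- 2 * int i)"
        unfolding Y_def by (rule powi_mult_eq[OF q]) (simp add: m algebra_simps)
      moreover have "cneg q A (Suc a) b i j = (-1) ^ m * A powi (int j + int b) * q powi (- 2 * int i * int j - int m * (int m - 1)) * th q A m i"
        by (simp add: cneg_def j m)
      hence "A * q powi (- 2 * int b) * cneg q A (Suc a) b i j = (-1) ^ m * (A powi (int j + int b) * A) *
         (q powi (- 2 * int b) * q powi (- 2 * int i * int j - int m * (int m - 1))) * th q A m i"
        by (simp add: mult_ac)
      ultimately show ?thesis unfolding X1 by simp
    qed
    have j0: "0 < j" using j by simp
    show ?thesis
    proof (cases i)
      case 0
      have "th q A (Suc m) i = th q A m i - q powi (2 * int b) * A powi (-2) * th q A m i"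
        unfolding 0 th_Suc_0 m power_int_of_nat[symmetric] by (simp add: algebra_simps)
      hence "- (q powi (2 * (int b)) * A powi (-2) * th q A m i) = th q A (Suc m) i - q powi (- 2 * int i) * th q A m i"
        using 0 by simp
      hence "(-1) ^ Suc m * X * Y * - (q powi (2 * (int b)) * A powi (-2) * th q A m i)
         = (-1) ^ Suc m * X * Y * (th q A (Suc m) i - q powi (- 2 * int i) * th q A m i)" by (rule arg_cong)
      thus ?thesis unfolding t3 t4 if_P[OF j0] t1 right_diff_distrib using 0 by simp
    next
      case (Suc i')
      have i0: "0 < i" using Suc by simp
      have t2: "A * q powi (- 2 * int j) * cneg q A a b (i - 1) j = (-1) ^ Suc m * X * Y * th q A (Suc m) i'"
      proof -
        have "q powi (- 2 * int j) * q powi (- 2 * int i' * int j - int (Suc m) * int m) = Y"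
          unfolding Y_def Suc by (rule powi_split[OF q, symmetric]) (simp add: algebra_simps)
        moreover have "cneg q A a b (i - 1) j = (-1) ^ Suc m * A powi (int j + int b) * q powi (- 2 * int i' * int j - int (Suc m) * int m) * th q A (Suc m) i'"
          by (simp add: cneg_def j m Suc Suc_diff_le)
        hence "A * q powi (- 2 * int j) * cneg q A a b (i - 1) j = (-1) ^ Suc m * (A powi (int j + int b) * A) *
           (q powi (- 2 * int j) * q powi (- 2 * int i' * int j - int (Suc m) * int m)) * th q A (Suc m) i'"
          by (simp only: mult_ac)
        ultimately show ?thesis unfolding X1 by simp
      qed
      have eq: "th q A (Suc m) i = th q A (Suc m) i' + q powi (- 2 * int i) * (1 - q ^ (2 * (2 * i + m)) * A powi (- 2)) * th q A m i"
        using th_Suc_Suc[OF q, of A m i'] Suc by simp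
      have "q powi (- 2 * int i) * q ^ (2 * (2 * i + m)) = q powi (2 * int b)"
        unfolding power_int_of_nat[symmetric] by (rule powi_split[OF q, symmetric]) (simp add: m algebra_simps)
      hence eq': "th q A (Suc m) i = th q A (Suc m) i' + q powi (- 2 * int i) * th q A m i - q powi (2 * int b) * A powi (-2) * th q A m i"
        unfolding eq by (simp add: algebra_simps)
      show ?thesis unfolding t3 t4 if_P[OF j0] if_P[OF i0] t1 t2 eq' by (simp only: algebra_simps) simp
    qed
  qed
qed

lemma qpoch_nonzero: "(\<And>x. 0 < x \<Longrightarrow> x \<le> n \<Longrightarrow> q ^ (2 * x) \<noteq> 1) \<Longrightarrow> qpoch ((q::'a::field)\<^sup>2) n \<noteq> 0"
  unfolding qpoch_def power_mult[symmetric] prod_zero_iff[OF finite_lessThan] right_minus_eq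
  by (metis Suc_leI lessThan_iff zero_less_Suc)

lemma sum_pairs_antidiagonal:
  fixes f :: "nat \<Rightarrow> nat \<Rightarrow> 'a::comm_monoid_add"
  assumes "\<And>c e. f c e \<noteq> 0 \<Longrightarrow> i \<le> e \<and> e \<le> i + N \<and> c + e = i + j" "N \<le> j" "i + N < d" "j < d"
  shows "(\<Sum>c<d. \<Sum>e<d. f c e) = (\<Sum>n\<le>N. f (j - n) (i + n))"
proof -
  have "(\<Sum>c<d. \<Sum>e<d. f c e) = (\<Sum>(c, e)\<in>{..<d} \<times> {..<d}. f c e)" by (simp add: sum.cartesian_product)
  also have "\<dots> = (\<Sum>(c, e)\<in>(\<lambda>n. (j - n, i + n)) ` {..N}. f c e)"
  proof (rule sum.mono_neutral_right)
    show "(\<lambda>n. (j - n, i + n)) ` {..N} \<subseteq> {..<d} \<times> {..<d}" using assms(2-4) by auto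
    show "\<forall>x\<in>{..<d} \<times> {..<d} - (\<lambda>n. (j - n, i + n)) ` {..N}. (case x of (c, e) \<Rightarrow> f c e) = 0"
    proof
      fix x assume x: "x \<in> {..<d} \<times> {..<d} - (\<lambda>n. (j - n, i + n)) ` {..N}"
      obtain c e where ce: "x = (c, e)" by force
      show "(case x of (c, e) \<Rightarrow> f c e) = 0"
      proof (rule ccontr)
        assume "\<not> ?thesis"
        hence "i \<le> e \<and> e \<le> i + N \<and> c + e = i + j" using assms(1) ce by simp
        hence "x = (j - (e - i), i + (e - i)) \<and> e - i \<in> {..N}" using ce by auto
        thus False using x by blast
      qed
    qed
  qed simp
  also have "\<dots> = (\<Sum>n\<le>N. f (j - n) (i + n))" by (subst sum.reindex) (auto simp: inj_on_def)
  finally show ?thesis .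
qed

text \<open>The intermediate states lie on an antidiagonal between labels below \<open>d\<close>, so
  truncation loses none of them. There F^(m) F^(n) with n + m = N is a Gaussian multiple of F^(N),
  and what remains is the alternating sum, which is nonzero only for N = 0.\<close>

lemma cpos_cneg_inverse:
  fixes q :: "'a::field"
  assumes q: "q \<noteq> 0" and A: "A \<noteq> 0" and gen: "\<And>x. 0 < x \<Longrightarrow> x < d \<Longrightarrow> q ^ (2 * x) \<noteq> 1"
    and lt: "a < d" "b < d" "i < d" "j < d"
  shows "(\<Sum>c<d. \<Sum>e<d. cpos q A a b c e * cneg q A c e i j) = (if a = i \<and> b = j then 1 else 0)"
proof (cases "i \<le> a \<and> a + b = i + j")
  case False
  hence "cpos q A a b c e * cneg q A c e i j = 0" for c e by (auto simp: cpos_def cneg_def)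
  hence "(\<Sum>c<d. \<Sum>e<d. cpos q A a b c e * cneg q A c e i j) = 0" by (simp only: sum.neutral_const)
  thus ?thesis using False by auto
next
  case True
  then obtain N where N: "a = i + N" using le_Suc_ex by blast
  hence j: "j = b + N" using True by simp
  have "(\<Sum>c<d. \<Sum>e<d. cpos q A a b c e * cneg q A c e i j) = (\<Sum>n\<le>N. cpos q A a b (j - n) (i + n) * cneg q A (j - n) (i + n) i j)"
    by (rule sum_pairs_antidiagonal) (use lt N j in \<open>auto simp: cpos_def cneg_def split: if_splits\<close>)
  also have "\<dots> = (\<Sum>n\<le>N. A powi (int j - int b) * q powi (2 * int a * int b - 2 * int i * int j) * th q A N i *
     ((- 1) ^ n * q powi (- (int n * (int n - 1)) - 2 * int n * int (N - n)) * gauss (q\<^sup>2) n (N - n)))"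
  proof (rule sum.cong[OF refl])
    fix n assume "n \<in> {..N}"
    then obtain m where m: "N = n + m" using le_Suc_ex by auto
    have "qpoch (q\<^sup>2) n \<noteq> 0" "qpoch (q\<^sup>2) m \<noteq> 0" "qpoch (q\<^sup>2) i \<noteq> 0"
      by (rule qpoch_nonzero; use gen lt N m in simp)+
    from th_mult_th[OF q this] have th: "th q A n i * th q A m (i + n) = th q A N i * (q powi (- 2 * int n * int m) * gauss (q\<^sup>2) n m)"
      by (simp add: m gauss_commute)
    have AA: "A powi (- (int (i + n) + int b)) * A powi (int j + int (i + n)) = A powi (int j - int b)"
      using A by (simp add: power_int_add[symmetric])
    have qq: "q powi (2 * int a * int b) * (q powi (- 2 * int i * int j - int n * (int n - 1)) * q powi (- 2 * int n * int m))
       = q powi (2 * int a * int b - 2 * int i * int j) * q powi (- (int n * (int n - 1)) - 2 * int n * int m)"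
      unfolding powi_split[OF q refl, symmetric] by (simp add: algebra_simps)
    have "cpos q A a b (j - n) (i + n) * cneg q A (j - n) (i + n) i j =
       (A powi (- (int (i + n) + int b)) * q powi (2 * int a * int b) * th q A m (i + n)) *
       ((- 1) ^ n * A powi (int j + int (i + n)) * q powi (- 2 * int i * int j - int n * (int n - 1)) * th q A n i)"
      by (simp add: cpos_def cneg_def N j m)
    also have "\<dots> = (- 1) ^ n * (A powi (- (int (i + n) + int b)) * A powi (int j + int (i + n))) *
       (q powi (2 * int a * int b) * q powi (- 2 * int i * int j - int n * (int n - 1))) * (th q A n i * th q A m (i + n))"
      by (simp only: mult_ac)
    also have "\<dots> = (- 1) ^ n * A powi (int j - int b) * th q A N i * gauss (q\<^sup>2) n m *
       (q powi (2 * int a * int b) * (q powi (- 2 * int i * int j - int n * (int n - 1)) * q powi (- 2 * int n * int m)))"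
      unfolding AA th by (simp only: mult_ac)
    finally show "cpos q A a b (j - n) (i + n) * cneg q A (j - n) (i + n) i j =
       A powi (int j - int b) * q powi (2 * int a * int b - 2 * int i * int j) * th q A N i *
     ((- 1) ^ n * q powi (- (int n * (int n - 1)) - 2 * int n * int (N - n)) * gauss (q\<^sup>2) n (N - n))"
      unfolding qq by (simp add: m mult_ac)
  qed
  also have "\<dots> = A powi (int j - int b) * q powi (2 * int a * int b - 2 * int i * int j) * th q A N i * (if N = 0 then 1 else 0)"
    unfolding sum_distrib_left[symmetric] alternating_gauss_sum[OF q] ..
  also have "\<dots> = (if a = i \<and> b = j then 1 else 0)" by (auto simp: N j)
  finally show ?thesis .
qed

lemma cneg_cpos_inverse:
  fixes q :: "'a::field"
  assumes q: "q \<noteq> 0" and A: "A \<noteq> 0" and gen: "\<And>x. 0 < x \<Longrightarrow> x < d \<Longrightarrow> q ^ (2 * x) \<noteq> 1"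
    and lt: "a < d" "b < d" "i < d" "j < d"
  shows "(\<Sum>c<d. \<Sum>e<d. cneg q A a b c e * cpos q A c e i j) = (if a = i \<and> b = j then 1 else 0)"
proof (cases "j \<le> b \<and> a + b = i + j")
  case False
  hence "cneg q A a b c e * cpos q A c e i j = 0" for c e by (auto simp: cpos_def cneg_def)
  hence "(\<Sum>c<d. \<Sum>e<d. cneg q A a b c e * cpos q A c e i j) = 0" by (simp only: sum.neutral_const)
  thus ?thesis using False by auto
next
  case True
  then obtain N where N: "b = j + N" using le_Suc_ex by blast
  hence i: "i = a + N" using True by simp
  have "(\<Sum>c<d. \<Sum>e<d. cneg q A a b c e * cpos q A c e i j) = (\<Sum>e<d. \<Sum>c<d. cneg q A a b c e * cpos q A c e i j)"
    by (rule sum.swap)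
  also have "\<dots> = (\<Sum>m\<le>N. cneg q A a b (j + m) (i - m) * cpos q A (j + m) (i - m) i j)"
    by (rule sum_pairs_antidiagonal) (use lt N i in \<open>auto simp: cpos_def cneg_def split: if_splits\<close>)
  \<comment> \<open>The order is reversed so that the index becomes the power of F in the negative
    crossing, which carries the sign.\<close>
  also have "\<dots> = (\<Sum>m\<le>N. cneg q A a b (j + (N - m)) (i - (N - m)) * cpos q A (j + (N - m)) (i - (N - m)) i j)"
    by (rule sum.reindex_bij_witness[where i = "\<lambda>m. N - m" and j = "\<lambda>m. N - m"]) auto
  also have "\<dots> = (\<Sum>n\<le>N. A powi (int b - int j) * th q A N j *
     ((- 1) ^ n * q powi (- (int n * (int n - 1)) - 2 * int n * int (N - n)) * gauss (q\<^sup>2) n (N - n)))"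
  proof (rule sum.cong[OF refl])
    fix n assume "n \<in> {..N}"
    then obtain m where m: "N = n + m" using le_Suc_ex by auto
    have "qpoch (q\<^sup>2) n \<noteq> 0" "qpoch (q\<^sup>2) m \<noteq> 0" "qpoch (q\<^sup>2) j \<noteq> 0"
      by (rule qpoch_nonzero; use gen lt N m in simp)+
    from th_mult_th[OF q this(2,1,3)] have th: "th q A m j * th q A n (j + m) = th q A N j * (q powi (- 2 * int n * int m) * gauss (q\<^sup>2) n m)"
      by (simp add: m add.commute mult_ac)
    define c where "c = j + m"
    define e where "e = a + n"
    have eq: "j + (N - n) = c" "i - (N - n) = e" "b = c + n" "i + j = c + e" by (auto simp: c_def e_def m N i)
    have AA: "A powi (int e + int b) * A powi (- (int j + int e)) = A powi (int b - int j)"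
      using A by (simp add: power_int_add[symmetric])
    have qq: "q powi (- 2 * int c * int e - int n * (int n - 1)) * q powi (2 * int c * int e) * q powi (- 2 * int n * int m)
       = q powi (- (int n * (int n - 1)) - 2 * int n * int m)"
      by (rule powi_mult3_eq[OF q]) simp
    have "cneg q A a b c e * cpos q A c e i j =
       ((- 1) ^ n * A powi (int e + int b) * q powi (- 2 * int c * int e - int n * (int n - 1)) * th q A n c) *
       (A powi (- (int j + int e)) * q powi (2 * int c * int e) * th q A m j)"
      using eq by (simp add: cpos_def cneg_def) (simp add: c_def e_def)
    also have "\<dots> = (- 1) ^ n * (A powi (int e + int b) * A powi (- (int j + int e))) *
       (q powi (- 2 * int c * int e - int n * (int n - 1)) * q powi (2 * int c * int e)) * (th q A m j * th q A n (j + m))"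
      unfolding c_def by (simp only: mult_ac)
    also have "\<dots> = (- 1) ^ n * A powi (int b - int j) * th q A N j * gauss (q\<^sup>2) n m *
       (q powi (- 2 * int c * int e - int n * (int n - 1)) * q powi (2 * int c * int e) * q powi (- 2 * int n * int m))"
      unfolding AA th by (simp only: mult_ac)
    finally show "cneg q A a b (j + (N - n)) (i - (N - n)) * cpos q A (j + (N - n)) (i - (N - n)) i j =
       A powi (int b - int j) * th q A N j *
     ((- 1) ^ n * q powi (- (int n * (int n - 1)) - 2 * int n * int (N - n)) * gauss (q\<^sup>2) n (N - n))"
      unfolding qq eq by (simp add: m mult_ac)
  qed
  also have "\<dots> = A powi (int b - int j) * th q A N j * (if N = 0 then 1 else 0)"
    unfolding sum_distrib_left[symmetric] alternating_gauss_sum[OF q] ..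
  also have "\<dots> = (if a = i \<and> b = j then 1 else 0)" by (auto simp: N i)
  finally show ?thesis .
qed

section \<open>The action of E\<close>

fun Kact :: "(nat \<Rightarrow> 'a::field) \<Rightarrow> strand list \<Rightarrow> nat list \<Rightarrow> 'a" where
  "Kact \<kappa> (Up # s) (x # xs) = \<kappa> x * Kact \<kappa> s xs"
| "Kact \<kappa> (Down # s) (x # xs) = inverse (\<kappa> x) * Kact \<kappa> s xs"
| "Kact \<kappa> _ _ = 1"

text \<open>The transpose of the action of \<open>E\<close> for the coproduct \<open>1 \<otimes> E + E \<otimes> K\<close> and the antipode
  \<open>- E K\<inverse>\<close>.\<close>

fun Eact :: "nat \<Rightarrow> (nat \<Rightarrow> 'a::field) \<Rightarrow> strand list \<Rightarrow> nat list \<Rightarrow> (nat list \<Rightarrow> 'a) \<Rightarrow> 'a" where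
  "Eact d \<kappa> (Up # s) (x # xs) \<phi> = Eact d \<kappa> s xs (\<lambda>ws. \<phi> (x # ws))
     + Kact \<kappa> s xs * (if 0 < x then \<phi> ((x - 1) # xs) else 0)"
| "Eact d \<kappa> (Down # s) (x # xs) \<phi> = Eact d \<kappa> s xs (\<lambda>ws. \<phi> (x # ws))
     + Kact \<kappa> s xs * (if Suc x < d then - inverse (\<kappa> (Suc x)) * \<phi> (Suc x # xs) else 0)"
| "Eact d \<kappa> _ _ \<phi> = 0"

lemma Kact_append: "length s = length xs \<Longrightarrow> Kact \<kappa> (s @ s') (xs @ xs') = Kact \<kappa> s xs * Kact \<kappa> s' xs'"
proof (induction s xs rule: list_induct2)
  case (Cons x xs y ys) then show ?case by (cases x) (auto simp: mult_ac)
qed simp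

lemma Eact_append: "length s = length xs \<Longrightarrow> Eact d \<kappa> (s @ s') (xs @ xs') \<phi> =
    Eact d \<kappa> s' xs' (\<lambda>w. \<phi> (xs @ w)) + Kact \<kappa> s' xs' * Eact d \<kappa> s xs (\<lambda>u. \<phi> (u @ xs'))"
proof (induction s xs arbitrary: \<phi> rule: list_induct2)
  case (Cons x xs y ys) then show ?case by (cases x) (auto simp: Kact_append algebra_simps)
qed simp

lemma Eact_cong: "(\<And>zs. length zs = length xs \<Longrightarrow> \<phi> zs = \<psi> zs) \<Longrightarrow> Eact d \<kappa> s xs \<phi> = Eact d \<kappa> s xs \<psi>"
proof (induction d \<kappa> s xs \<phi> arbitrary: \<psi> rule: Eact.induct)
  case (1 d \<kappa> s x xs \<phi>)
  show ?case using "1.IH"[of "\<lambda>ws. \<psi> (x # ws)"] "1.prems" by simp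
next
  case (2 d \<kappa> s x xs \<phi>)
  show ?case using "2.IH"[of "\<lambda>ws. \<psi> (x # ws)"] "2.prems" by simp
qed auto

lemma Eact_sum: "Eact d \<kappa> s xs (\<lambda>z. \<Sum>i\<in>I. c i * f i z) = (\<Sum>i\<in>I. c i * Eact d \<kappa> s xs (f i))"
proof (induction d \<kappa> s xs "\<lambda>z. \<Sum>i\<in>I. c i * f i z" arbitrary: f rule: Eact.induct)
  case (1 d \<kappa> s x xs f)
  show ?case using "1"[of "\<lambda>i ws. f i (x # ws)"]
    by (simp add: sum.distrib sum_distrib_left algebra_simps)
next
  case (2 d \<kappa> s x xs f)
  show ?case using "2"[of "\<lambda>i ws. f i (x # ws)"]
    by (simp add: sum.distrib sum_distrib_left algebra_simps sum_subtractf sum_negf)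
qed auto

text \<open>\<open>Eact_append\<close> reduces commutation with E to the piece itself. On the
  strands left of the piece, E comes with K acting on everything to its right, hence the piece must
  preserve \<open>Kact\<close> as well.\<close>

lemma pull_Eact:
  assumes "attachable \<sigma> s" "xs \<in> index_lists d (length s)"
    and K: "\<And>e z x. W e z x \<noteq> 0 \<Longrightarrow> Kact \<kappa> (tgt e) z = Kact \<kappa> (src e) x"
    and E: "\<And>e x \<psi>. x \<in> index_lists d (length (src e)) \<Longrightarrow>
      Eact d \<kappa> (src e) x (\<lambda>x'. \<Sum>z\<in>index_lists d (length (tgt e)). W e z x' * \<psi> z)
      = (\<Sum>z\<in>index_lists d (length (tgt e)). W e z x * Eact d \<kappa> (tgt e) z \<psi>)"
  shows "Eact d \<kappa> s xs (pull d W \<sigma> \<phi>) = pull d W \<sigma> (\<lambda>zs. Eact d \<kappa> (attach \<sigma> s) zs \<phi>) xs"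
proof -
  obtain k e where \<sigma>: "\<sigma> = (k, e)" by force
  have "length xs = length s" using assms(2) by (simp add: index_lists_def)
  then obtain s1 s2 us x ws where s: "s = s1 @ src e @ s2" "attach (k, e) s = s1 @ tgt e @ s2"
    "xs = us @ x @ ws" "length s1 = k" "length us = k" "length x = length (src e)" "length ws = length s2"
    using attachable_cases assms(1) unfolding \<sigma> by metis
  have x: "x \<in> index_lists d (length (src e))"
    using assms(2) s by (auto simp: index_lists_def)
  let ?I = "index_lists d (length (tgt e))"
  have 1: "Eact d \<kappa> s2 ws (\<lambda>w. pull d W \<sigma> \<phi> (us @ x @ w)) = (\<Sum>z\<in>?I. W e z x * Eact d \<kappa> s2 ws (\<lambda>w. \<phi> (us @ z @ w)))"
    unfolding \<sigma> by (subst Eact_sum[symmetric]) (rule Eact_cong, rule pull_split, use s in auto)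
  have "Eact d \<kappa> (src e) x (\<lambda>x'. pull d W \<sigma> \<phi> (us @ x' @ ws)) =
      Eact d \<kappa> (src e) x (\<lambda>x'. \<Sum>z\<in>?I. W e z x' * \<phi> (us @ z @ ws))"
    unfolding \<sigma> by (rule Eact_cong, rule pull_split) (use s in auto)
  hence 2: "Eact d \<kappa> (src e) x (\<lambda>x'. pull d W \<sigma> \<phi> (us @ x' @ ws)) =
      (\<Sum>z\<in>?I. W e z x * Eact d \<kappa> (tgt e) z (\<lambda>z. \<phi> (us @ z @ ws)))"
    using E[OF x, of "\<lambda>z. \<phi> (us @ z @ ws)"] by simp
  have 3: "Eact d \<kappa> s1 us (\<lambda>u. pull d W \<sigma> \<phi> (u @ x @ ws)) = (\<Sum>z\<in>?I. W e z x * Eact d \<kappa> s1 us (\<lambda>u. \<phi> (u @ z @ ws)))"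
    unfolding \<sigma> by (subst Eact_sum[symmetric]) (rule Eact_cong, rule pull_split, use s in auto)
  have 4: "W e z x * (Kact \<kappa> (src e) x * y) = W e z x * (Kact \<kappa> (tgt e) z * y)" for y z
    using K[of e z x] by auto
  have "Eact d \<kappa> s xs (pull d W \<sigma> \<phi>) = (\<Sum>z\<in>?I. W e z x * Eact d \<kappa> s2 ws (\<lambda>w. \<phi> (us @ z @ w)))
    + Kact \<kappa> s2 ws * (\<Sum>z\<in>?I. W e z x * Eact d \<kappa> (tgt e) z (\<lambda>z. \<phi> (us @ z @ ws)))
    + Kact \<kappa> s2 ws * (\<Sum>z\<in>?I. W e z x * (Kact \<kappa> (src e) x * Eact d \<kappa> s1 us (\<lambda>u. \<phi> (u @ z @ ws))))"
    unfolding s(1,3) using s(4-7) 1 2 3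
    by (simp add: Eact_append Kact_append algebra_simps sum_distrib_left del: pull.simps)
  also have "\<dots> = (\<Sum>z\<in>?I. W e z x * (Eact d \<kappa> s2 ws (\<lambda>w. \<phi> (us @ z @ w))
     + Kact \<kappa> s2 ws * (Eact d \<kappa> (tgt e) z (\<lambda>z. \<phi> (us @ z @ ws)) + Kact \<kappa> (tgt e) z * Eact d \<kappa> s1 us (\<lambda>u. \<phi> (u @ z @ ws)))))"
    unfolding 4 by (simp add: algebra_simps sum_distrib_left sum.distrib)
  also have "\<dots> = (\<Sum>z\<in>?I. W e z x * Eact d \<kappa> (s1 @ tgt e @ s2) (us @ z @ ws) \<phi>)"
    by (rule sum.cong[OF refl]) (use s(4-7) in \<open>simp add: Eact_append Kact_append index_lists_def algebra_simps\<close>)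
  also have "\<dots> = pull d W \<sigma> (\<lambda>zs. Eact d \<kappa> (attach \<sigma> s) zs \<phi>) xs"
    unfolding s(3) \<sigma> s(2) by (subst pull_split) (use s in auto)
  finally show ?thesis .
qed

lemma pull_diagram_Eact:
  assumes "is_tangle s D t" "xs \<in> index_lists d (length s)"
    and K: "\<And>e z x. W e z x \<noteq> 0 \<Longrightarrow> Kact \<kappa> (tgt e) z = Kact \<kappa> (src e) x"
    and E: "\<And>e x \<psi>. x \<in> index_lists d (length (src e)) \<Longrightarrow>
      Eact d \<kappa> (src e) x (\<lambda>x'. \<Sum>z\<in>index_lists d (length (tgt e)). W e z x' * \<psi> z)
      = (\<Sum>z\<in>index_lists d (length (tgt e)). W e z x * Eact d \<kappa> (tgt e) z \<psi>)"
  shows "Eact d \<kappa> s xs (pull_diagram d W D \<phi>) = pull_diagram d W D (\<lambda>zs. Eact d \<kappa> t zs \<phi>) xs"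
  using assms(1,2)
proof (induction D arbitrary: s xs)
  case (Cons \<sigma> D)
  have "Eact d \<kappa> s xs (pull_diagram d W (\<sigma> # D) \<phi>) = pull d W \<sigma> (\<lambda>zs. Eact d \<kappa> (attach \<sigma> s) zs (pull_diagram d W D \<phi>)) xs"
    unfolding pull_diagram.simps by (rule pull_Eact) (use Cons.prems K E in auto)
  also have "\<dots> = pull d W \<sigma> (pull_diagram d W D (\<lambda>zs. Eact d \<kappa> t zs \<phi>)) xs"
    by (rule pull_cong[where s = s]) (use Cons in auto)
  finally show ?case by simp
qed simp

lemma sum_shift_truncated:
  fixes C :: "nat \<Rightarrow> 'a::field"
  assumes "C d = 0"
  shows "(\<Sum>b<d. C b * (if 0 < b then f (b - 1) else 0)) = (\<Sum>b<d. C (Suc b) * f b)"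
proof (cases d)
  case (Suc d')
  show ?thesis unfolding Suc sum.lessThan_Suc_shift[of "\<lambda>b. C b * (if 0 < b then f (b - 1) else 0)"]
    using assms by (simp add: Suc)
qed simp

text \<open>Shifting the summation indices produces boundary terms with output label
  \<open>d\<close>; assumption \<open>0\<close> says that the crossing does not reach this
  label.\<close>

lemma crossing_Eact:
  fixes C :: "nat \<Rightarrow> nat \<Rightarrow> nat \<Rightarrow> nat \<Rightarrow> 'a::field"
  assumes C: "\<And>a b. (if 0 < j then C a b i (j - 1) else 0) + \<kappa> j * (if 0 < i then C a b (i - 1) j else 0)
      = C a (Suc b) i j + \<kappa> b * C (Suc a) b i j"
    and 0: "\<And>a. a < d \<Longrightarrow> C a d i j = 0" "\<And>b. b < d \<Longrightarrow> C d b i j = 0"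
  shows "(if 0 < j then \<Sum>a<d. \<Sum>b<d. C a b i (j - 1) * \<psi> [a, b] else 0)
       + \<kappa> j * (if 0 < i then \<Sum>a<d. \<Sum>b<d. C a b (i - 1) j * \<psi> [a, b] else 0)
    = (\<Sum>a<d. \<Sum>b<d. C a b i j * ((if 0 < b then \<psi> [a, b - 1] else 0) + \<kappa> b * (if 0 < a then \<psi> [a - 1, b] else 0)))"
proof -
  have "(if 0 < j then \<Sum>a<d. \<Sum>b<d. C a b i (j - 1) * \<psi> [a, b] else 0)
       + \<kappa> j * (if 0 < i then \<Sum>a<d. \<Sum>b<d. C a b (i - 1) j * \<psi> [a, b] else 0)
    = (\<Sum>a<d. \<Sum>b<d. ((if 0 < j then C a b i (j - 1) else 0) + \<kappa> j * (if 0 < i then C a b (i - 1) j else 0)) * \<psi> [a, b])"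
    by (simp add: sum.distrib sum_distrib_left algebra_simps)
  also have "\<dots> = (\<Sum>a<d. \<Sum>b<d. C a (Suc b) i j * \<psi> [a, b]) + (\<Sum>b<d. \<Sum>a<d. C (Suc a) b i j * (\<kappa> b * \<psi> [a, b]))"
    unfolding C by (subst (3) sum.swap) (simp add: sum.distrib algebra_simps)
  also have "(\<Sum>a<d. \<Sum>b<d. C a (Suc b) i j * \<psi> [a, b]) = (\<Sum>a<d. \<Sum>b<d. C a b i j * (if 0 < b then \<psi> [a, b - 1] else 0))"
    by (rule sum.cong[OF refl], rule sum_shift_truncated[symmetric]) (use 0 in auto)
  also have "(\<Sum>b<d. \<Sum>a<d. C (Suc a) b i j * (\<kappa> b * \<psi> [a, b])) = (\<Sum>b<d. \<Sum>a<d. C a b i j * (if 0 < a then \<kappa> b * \<psi> [a - 1, b] else 0))"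
    by (rule sum.cong[OF refl], rule sum_shift_truncated[symmetric]) (use 0 in auto)
  also have "\<dots> = (\<Sum>a<d. \<Sum>b<d. C a b i j * (if 0 < a then \<kappa> b * \<psi> [a - 1, b] else 0))"
    by (rule sum.swap)
  moreover have "C a b i j * ((if 0 < b then \<psi> [a, b - 1] else 0) + \<kappa> b * (if 0 < a then \<psi> [a - 1, b] else 0))
     = C a b i j * (if 0 < b then \<psi> [a, b - 1] else 0) + C a b i j * (if 0 < a then \<kappa> b * \<psi> [a - 1, b] else 0)" for a b
    by (auto simp: algebra_simps)
  ultimately show ?thesis by (simp only: sum.distrib)
qed

abbreviation weights :: "'a::field \<Rightarrow> 'a \<Rightarrow> 'a \<Rightarrow> piece \<Rightarrow> nat list \<Rightarrow> nat list \<Rightarrow> 'a" where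
  "weights q A p \<equiv> wt (cpos q A) (cneg q A) (\<lambda>i. p * (A * q powi (- 2 * int i))) (\<lambda>i. inverse (p * (A * q powi (- 2 * int i))))"

text \<open>Caps and cups are compatible with the antipode for a pivot that is any nonzero multiple
  \<open>p\<close> of K, because \<open>p\<close> cancels; this covers K as well as K^(1-r) at a
  root of unity. For the crossings, the entries reaching label \<open>d\<close> have to
  vanish.\<close>

lemma weights_Eact:
  fixes q A p :: "'a::field"
  assumes nz: "q \<noteq> 0" "A \<noteq> 0" "p \<noteq> 0"
    and th: "\<And>n j. n < d \<Longrightarrow> j < d \<Longrightarrow> n + j = d \<Longrightarrow> th q A n j = 0"
    and x: "x \<in> index_lists d (length (src e))"
  defines "\<kappa> \<equiv> \<lambda>i. A * q powi (- 2 * int i)"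
  shows "Eact d \<kappa> (src e) x (\<lambda>x'. \<Sum>z\<in>index_lists d (length (tgt e)). weights q A p e z x' * \<psi> z)
      = (\<Sum>z\<in>index_lists d (length (tgt e)). weights q A p e z x * Eact d \<kappa> (tgt e) z \<psi>)"
proof -
  have \<kappa>: "\<kappa> i \<noteq> 0" for i using nz by (simp add: \<kappa>_def)
  have cap: "(if 0 < j \<and> i = j - 1 then f i else 0) = (if 0 < j \<and> j = Suc i then f i else 0)" for i j and f :: "nat \<Rightarrow> 'a"
    by auto
  \<comment> \<open>The entry of F^(d) at v_0 may be nonzero, which is why \<open>th\<close> is
    assumed to vanish for \<open>n < d\<close> only; the condition \<open>a + b = i + j\<close>
    keeps that entry from occurring with labels below \<open>d\<close>.\<close>
  have pos0: "cpos q A a d i j = 0" "cpos q A d b i j = 0" "cneg q A a d i j = 0" "cneg q A d b i j = 0"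
    if "a < d" "b < d" "i < d" "j < d" for a b i j
    using that th[of "d - j" j] th[of "d - i" i] by (auto simp: cpos_def cneg_def)
  have W: "weights q A p = wt (cpos q A) (cneg q A) (\<lambda>i. p * \<kappa> i) (\<lambda>i. inverse (p * \<kappa> i))"
    by (simp add: \<kappa>_def)
  show ?thesis
  proof (cases e)
    case Cross_Pos
    then obtain i j where ij: "x = [i, j]" "i < d" "j < d"
      using x by (auto simp: index_lists_def length_Suc_conv)
    have "(if 0 < j then \<Sum>a<d. \<Sum>b<d. cpos q A a b i (j - 1) * \<psi> [a, b] else 0)
       + \<kappa> j * (if 0 < i then \<Sum>a<d. \<Sum>b<d. cpos q A a b (i - 1) j * \<psi> [a, b] else 0)
    = (\<Sum>a<d. \<Sum>b<d. cpos q A a b i j * ((if 0 < b then \<psi> [a, b - 1] else 0) + \<kappa> b * (if 0 < a then \<psi> [a - 1, b] else 0)))"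
      by (rule crossing_Eact)
         (unfold \<kappa>_def, rule cpos_E[OF nz(1,2)], use pos0 ij(2,3) in auto)
    thus ?thesis unfolding W Cross_Pos ij(1)
      by (cases "0 < i"; cases "0 < j") (simp_all add: sum_index_lists_2)
  next
    case Cross_Neg
    then obtain i j where ij: "x = [i, j]" "i < d" "j < d"
      using x by (auto simp: index_lists_def length_Suc_conv)
    have "(if 0 < j then \<Sum>a<d. \<Sum>b<d. cneg q A a b i (j - 1) * \<psi> [a, b] else 0)
       + \<kappa> j * (if 0 < i then \<Sum>a<d. \<Sum>b<d. cneg q A a b (i - 1) j * \<psi> [a, b] else 0)
    = (\<Sum>a<d. \<Sum>b<d. cneg q A a b i j * ((if 0 < b then \<psi> [a, b - 1] else 0) + \<kappa> b * (if 0 < a then \<psi> [a - 1, b] else 0)))"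
      by (rule crossing_Eact)
         (unfold \<kappa>_def, rule cneg_E[OF nz(1,2)], use pos0 ij(2,3) in auto)
    thus ?thesis unfolding W Cross_Neg ij(1)
      by (cases "0 < i"; cases "0 < j") (simp_all add: sum_index_lists_2)
  next
    case Cap_Down_Up
    then obtain i j where ij: "x = [i, j]" "i < d" "j < d"
      using x by (auto simp: index_lists_def length_Suc_conv)
    show ?thesis unfolding W Cap_Down_Up ij(1) using ij(2,3) \<kappa> by auto
  next
    case Cap_Up_Down
    then obtain i j where ij: "x = [i, j]" "i < d" "j < d"
      using x by (auto simp: index_lists_def length_Suc_conv)
    show ?thesis unfolding W Cap_Up_Down ij(1) using ij(2,3) \<kappa> by auto
  next
    case Cup_Up_Down
    have x: "x = []" using x Cup_Up_Down by simp
    have "(\<Sum>a<d. \<Sum>b<d. (if a = b then 1 else 0) * Eact d \<kappa> [Up, Down] [a, b] \<psi>)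
       = (\<Sum>a<d. (if Suc a < d then - inverse (\<kappa> (Suc a)) * \<psi> [a, Suc a] else 0) + inverse (\<kappa> a) * (if 0 < a then \<psi> [a - 1, a] else 0))"
      by (simp add: if_distrib[where f = "\<lambda>c. c * _"] cong: if_cong)
    also have "(\<Sum>a<d. (if Suc a < d then - inverse (\<kappa> (Suc a)) * \<psi> [a, Suc a] else 0) + inverse (\<kappa> a) * (if 0 < a then \<psi> [a - 1, a] else 0)) = 0"
    proof (cases d)
      case (Suc d')
      have 1: "(\<Sum>a<Suc d'. if Suc a < Suc d' then - inverse (\<kappa> (Suc a)) * \<psi> [a, Suc a] else 0) = (\<Sum>a<d'. - inverse (\<kappa> (Suc a)) * \<psi> [a, Suc a])"
        by simp
      show ?thesis unfolding Suc sum.distrib 1 sum.lessThan_Suc_shift[of "\<lambda>a. inverse (\<kappa> a) * (if 0 < a then \<psi> [a - 1, a] else 0)"]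
        by (simp add: sum_negf)
    qed simp
    finally show ?thesis unfolding W Cup_Up_Down x by (simp add: sum_index_lists_2)
  next
    case Cup_Down_Up
    have x: "x = []" using x Cup_Down_Up by simp
    have "(\<Sum>a<d. \<Sum>b<d. (if a = b then inverse (p * \<kappa> a) else 0) * Eact d \<kappa> [Down, Up] [a, b] \<psi>)
       = (\<Sum>a<d. (if Suc a < d then - (inverse p * inverse (\<kappa> (Suc a)) * \<psi> [Suc a, a]) else 0) + inverse p * inverse (\<kappa> a) * (if 0 < a then \<psi> [a, a - 1] else 0))"
    proof (rule sum.cong[OF refl])
      fix a assume "a \<in> {..<d}"
      hence "(\<Sum>b<d. (if a = b then inverse (p * \<kappa> a) else 0) * Eact d \<kappa> [Down, Up] [a, b] \<psi>)
        = inverse (p * \<kappa> a) * Eact d \<kappa> [Down, Up] [a, a] \<psi>"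
        by (simp add: if_distrib[where f = "\<lambda>c. c * _"] cong: if_cong)
      also have "\<dots> = (if Suc a < d then - (inverse p * inverse (\<kappa> (Suc a)) * \<psi> [Suc a, a]) else 0) + inverse p * inverse (\<kappa> a) * (if 0 < a then \<psi> [a, a - 1] else 0)"
        using nz(3) \<kappa> by (simp add: field_simps)
      finally show "(\<Sum>b<d. (if a = b then inverse (p * \<kappa> a) else 0) * Eact d \<kappa> [Down, Up] [a, b] \<psi>) = \<dots>" .
    qed
    also have "\<dots> = 0"
    proof (cases d)
      case (Suc d')
      have 1: "(\<Sum>a<Suc d'. if Suc a < Suc d' then - (inverse p * inverse (\<kappa> (Suc a)) * \<psi> [Suc a, a]) else 0) = (\<Sum>a<d'. - (inverse p * inverse (\<kappa> (Suc a)) * \<psi> [Suc a, a]))"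
        by simp
      show ?thesis unfolding Suc sum.distrib 1 sum.lessThan_Suc_shift[of "\<lambda>a. inverse p * inverse (\<kappa> a) * (if 0 < a then \<psi> [a, a - 1] else 0)"]
        by (simp add: sum_negf)
    qed simp
    finally show ?thesis unfolding W Cup_Down_Up x by (simp add: sum_index_lists_2 del: inverse_mult_distrib)
  qed
qed

lemma weights_Kact:
  assumes nz: "q \<noteq> 0" "A \<noteq> 0" and "weights q A p e z x \<noteq> 0"
  defines "\<kappa> \<equiv> \<lambda>i. A * q powi (- 2 * int i)"
  shows "Kact \<kappa> (tgt e) z = Kact \<kappa> (src e) x"
proof -
  have \<kappa>: "\<kappa> i \<noteq> 0" for i using nz by (simp add: \<kappa>_def)
  have \<kappa>\<kappa>: "\<kappa> a * \<kappa> b = \<kappa> i * \<kappa> j" if "a + b = i + j" for a b i j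
  proof -
    have "int a + int b = int i + int j" using that by linarith
    hence "q powi (- 2 * int a) * q powi (- 2 * int b) = q powi (- 2 * int i) * q powi (- 2 * int j)"
      by (intro powi_mult_eq[OF nz(1)]) simp
    thus ?thesis by (simp add: \<kappa>_def)
  qed
  show ?thesis using assms(3)
  proof (cases rule: wt_nonzero_cases)
    case (Pos a b i j)
    thus ?thesis using \<kappa>\<kappa>[of a b i j] by (simp add: cpos_def split: if_splits)
  next
    case (Neg a b i j)
    thus ?thesis using \<kappa>\<kappa>[of a b i j] by (simp add: cneg_def split: if_splits)
  qed (use \<kappa> in auto)
qed

lemma pull_diagram_scalar:
  fixes q A p :: "'a::field"
  assumes D: "is_tangle [Up] D [Up]" and nz: "q \<noteq> 0" "A \<noteq> 0" "p \<noteq> 0"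
    and th: "\<And>n j. n < d \<Longrightarrow> j < d \<Longrightarrow> n + j = d \<Longrightarrow> th q A n j = 0"
    and lt: "i < d" "j < d"
  shows "pull_diagram d (weights q A p) D (entry [j]) [i] =
    (if j = i then pull_diagram d (weights q A p) D (entry [0]) [0] else 0)"
proof (cases "j = i")
  case False
  show ?thesis
    by (subst pull_diagram_diagonal[OF D]) (use False in \<open>auto simp: cpos_def cneg_def split: if_splits\<close>)
next
  case True
  define \<kappa> where "\<kappa> = (\<lambda>i. A * q powi (- 2 * int i))"
  define F where "F j i = pull_diagram d (weights q A p) D (entry [j]) [i]" for j i
  \<comment> \<open>Since E v_(j+1) = v_j, letting E act below the diagram yields entry
    \<open>j\<close>, and letting it act above yields entry \<open>Suc j\<close>.\<close>
  have Suc: "F (Suc j) (Suc j) = F j j" if "Suc j < d" for j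
  proof -
    have "F j j = Eact d \<kappa> [Up] [Suc j] (pull_diagram d (weights q A p) D (entry [j]))"
      by (simp add: F_def)
    also have "\<dots> = pull_diagram d (weights q A p) D (\<lambda>zs. Eact d \<kappa> [Up] zs (entry [j])) [Suc j]"
      unfolding \<kappa>_def by (rule pull_diagram_Eact[OF D])
        (use that weights_Kact[OF nz(1,2)] weights_Eact[OF nz th] in \<open>auto simp: index_lists_def\<close>)
    also have "\<dots> = F (Suc j) (Suc j)"
      unfolding F_def by (rule pull_diagram_cong[OF D])
        (use that in \<open>auto simp: index_lists_def length_Suc_conv split: if_splits\<close>)
    finally show ?thesis ..
  qed
  have "F i i = F 0 0" using lt(1) by (induction i) (auto simp: Suc)
  thus ?thesis using True by (simp add: F_def)
qed

text \<open>The scalar \<open>t\<close> plays the role of q to the power \<alpha>^2/2, or of s^(n^2)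
  on the Jones side: a crossing and its inverse carry it to opposite powers, and writhe zero removes
  it.\<close>

lemma pull_diagram_writhe:
  fixes t :: "'a::field"
  assumes t: "t \<noteq> 0"
  shows "pull_diagram d (wt (\<lambda>a b i j. t * P a b i j) (\<lambda>a b i j. inverse t * N a b i j) g g') D \<phi>
    = (\<lambda>xs. t powi writhe D * pull_diagram d (wt P N g g') D \<phi> xs)"
proof (induction D)
  case Nil
  show ?case by (simp add: writhe_def)
next
  case (Cons \<sigma> D)
  obtain k e where \<sigma>: "\<sigma> = (k, e)" by force
  define c where "c = (if e = Cross_Pos then t else if e = Cross_Neg then inverse t else 1)"
  have c: "wt (\<lambda>a b i j. t * P a b i j) (\<lambda>a b i j. inverse t * N a b i j) g g' e z x = c * wt P N g g' e z x" for z x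
    by (cases "(P, N, g, g', e, z, x)" rule: wt.cases) (auto simp: c_def)
  have w: "t powi writhe (\<sigma> # D) = c * t powi writhe D"
  proof (cases "e = Cross_Pos \<or> e = Cross_Neg")
    case True
    have "t powi (writhe D + 1) = t * t powi writhe D" using t by (simp add: power_int_add)
    moreover have "t powi (writhe D - 1) = inverse t * t powi writhe D" using t by (simp add: power_int_diff field_simps)
    ultimately show ?thesis using True by (auto simp: writhe_def \<sigma> c_def algebra_simps)
  qed (simp add: writhe_def \<sigma> c_def)
  show ?case
    unfolding pull_diagram.simps Cons w by (rule ext) (simp add: \<sigma> c sum_distrib_left mult_ac)
qed

lemma pull_diagram_dim_1:
  assumes "is_tangle s D t" "P 0 0 0 0 = 1" "N 0 0 0 0 = 1" "g 0 = 1" "g' 0 = 1" "\<phi> (replicate (length t) 0) = 1"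
  shows "pull_diagram 1 (wt P N g g') D \<phi> (replicate (length s) 0) = 1"
  using assms(1)
proof (induction D arbitrary: s)
  case Nil
  then show ?case using assms(6) by simp
next
  case (Cons \<sigma> D)
  obtain k e where \<sigma>: "\<sigma> = (k, e)" by force
  have att: "attachable (k, e) s" and tan: "is_tangle (attach \<sigma> s) D t" using Cons.prems \<sigma> by auto
  obtain s1 s2 where s: "length s1 = k" "s = s1 @ src e @ s2" "attach (k, e) s = s1 @ tgt e @ s2"
    using attachable_split[OF att] .
  have r: "replicate (length s) (0::nat) = replicate k 0 @ replicate (length (src e)) 0 @ replicate (length s2) 0"
    by (simp add: s replicate_add)
  have "index_lists 1 m = {replicate m 0}" for m
    by (auto simp: index_lists_def intro!: replicate_eqI)
  moreover have "wt P N g g' e (replicate (length (tgt e)) 0) (replicate (length (src e)) 0) = 1"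
    using assms(2-5) by (cases e) (auto simp: numeral_2_eq_2)
  moreover have "pull_diagram 1 (wt P N g g') D \<phi> (replicate k 0 @ replicate (length (tgt e)) 0 @ replicate (length s2) 0) = 1"
    using Cons.IH[OF tan] s \<sigma> by (simp add: replicate_add)
  ultimately show ?case
    unfolding pull_diagram.simps \<sigma> r by (subst pull_split) auto
qed

section \<open>Crossing weights at a root of unity\<close>

lemma prod_lessThan_add:
  fixes f :: "nat \<Rightarrow> 'a::comm_monoid_mult"
  shows "(\<Prod>x<m + n. f x) = (\<Prod>x<m. f x) * (\<Prod>x<n. f (m + x))"
  by (induction n) (simp_all add: mult_ac)

context
  fixes w :: "'a::field" and r :: nat
  assumes r: "0 < r" and w_r: "w ^ r = 1" and prim: "\<And>x. 0 < x \<Longrightarrow> x < r \<Longrightarrow> w ^ x \<noteq> 1"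
begin

lemma root_power_mod: "w ^ n = w ^ (n mod r)"
proof -
  have "w ^ n = w ^ (r * (n div r) + n mod r)" by simp
  also have "\<dots> = w ^ (n mod r)" unfolding power_add power_mult w_r by simp
  finally show ?thesis .
qed

lemma gauss_root_eq_0:
  assumes "0 < m" "m < r" "m + a = r"
  shows "gauss w m a = 0"
proof -
  obtain n where n: "m = Suc n" using assms by (cases m) auto
  have "w ^ Suc (n + a) = 1" using assms(3) w_r n by simp
  hence "(1 - w ^ m) * gauss w m a = 0"
    using gauss_absorb[of w n a] unfolding n by simp
  thus ?thesis using prim assms by simp
qed

text \<open>The q-Lucas theorem for the binomial of n + j over n; a carry of the residues makes it
  zero. Induction along Pascal's rule meets a genuine cancellation only when the incremented
  residues add up to exactly r, which is \<open>gauss_root_eq_0\<close>.\<close>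

lemma gauss_lucas:
  "gauss w n j = (if n mod r + j mod r < r
     then gauss w (n mod r) (j mod r) * of_nat ((n div r + j div r) choose (n div r)) else 0)"
proof (induction n arbitrary: j)
  case 0
  show ?case using r by simp
next
  case (Suc n)
  note IHn = Suc
  show ?case
  proof (induction j)
    case 0
    show ?case using r by simp
  next
    case (Suc j)
    define a b k l where "a = n mod r" and "b = j mod r" and "k = n div r" and "l = j div r"
    have ab: "a < r" "b < r" using r by (simp_all add: a_def b_def)
    have IH1: "gauss w n (Suc j) = (if a + Suc j mod r < r
       then gauss w a (Suc j mod r) * of_nat ((k + Suc j div r) choose k) else 0)"
      using IHn[of "Suc j"] by (simp only: a_def k_def)
    have IH2: "gauss w (Suc n) j = (if Suc n mod r + b < r
       then gauss w (Suc n mod r) b * of_nat ((Suc n div r + l) choose (Suc n div r)) else 0)"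
      using Suc by (simp only: b_def l_def)
    have rec: "gauss w (Suc n) (Suc j) = gauss w n (Suc j) + w ^ (Suc n mod r) * gauss w (Suc n) j"
      using root_power_mod[of "Suc n"] by simp
    have n: "Suc n mod r = (if Suc a = r then 0 else Suc a)" "Suc n div r = (if Suc a = r then Suc k else k)"
      by (auto simp: a_def k_def mod_Suc div_Suc)
    have j: "Suc j mod r = (if Suc b = r then 0 else Suc b)" "Suc j div r = (if Suc b = r then Suc l else l)"
      by (auto simp: b_def l_def mod_Suc div_Suc)
    consider "Suc a = r" "Suc b = r" | "Suc a = r" "Suc b < r" | "Suc a < r" "Suc b = r"
      | "Suc a < r" "Suc b < r" using ab by linarith
    then show ?case
    proof cases
      case 1
      then show ?thesis unfolding rec IH1 IH2 n j using ab by simp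
    next
      case 2
      then show ?thesis unfolding rec IH1 IH2 n j using ab by simp
    next
      case 3
      then show ?thesis unfolding rec IH1 IH2 n j using ab by simp
    next
      case 4
      consider "Suc a + Suc b < r" | "Suc a + Suc b = r" | "Suc a + Suc b > r" by linarith
      then show ?thesis
      proof cases
        case 1
        then show ?thesis unfolding rec IH1 IH2 n j using 4 ab by (simp add: algebra_simps)
      next
        case 2
        have "gauss w a (Suc b) + w ^ Suc a * gauss w (Suc a) b = 0"
          using gauss_root_eq_0[of "Suc a" "Suc b"] 2 4 by simp
        hence "(gauss w a (Suc b) + w ^ Suc a * gauss w (Suc a) b) * of_nat ((k + l) choose k) = 0" by simp
        then show ?thesis unfolding rec IH1 IH2 n j using 2 4 ab by (simp add: algebra_simps)
      next
        case 3
        then show ?thesis unfolding rec IH1 IH2 n j using 4 ab by simp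
      qed
    qed
  qed
qed

text \<open>As polynomials in \<open>X\<close> of degree at most r, both sides take the same values
  at r + 1 points: they vanish at the r distinct powers of \<open>w\<close> and equal 1 at
  0.\<close>

lemma prod_root_block: "(\<Prod>x<r. 1 - w ^ x * X) = 1 - X ^ r"
proof -
  define P where "P = (\<Prod>x<r. [:1, - (w ^ x):])"
  define Q where "Q = [:1:] - monom (1::'a) r"
  define S where "S = (\<lambda>x. w ^ (r - x)) ` {..<r}"
  have w0: "w \<noteq> 0" using w_r r by (metis power_0_left not_gr_zero zero_neq_one)
  have inj: "inj_on (\<lambda>x. w ^ (r - x)) {..<r}"
  proof (rule linorder_inj_onI)
    fix x y assume xy: "x < y" "x \<in> {..<r}" "y \<in> {..<r}"
    have "w ^ (r - x) = w ^ (r - y) * w ^ (y - x)" using xy by (simp flip: power_add)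
    thus "w ^ (r - x) \<noteq> w ^ (r - y)" using prim[of "y - x"] xy w0 by auto
  qed auto
  have "0 \<notin> S" using w0 by (auto simp: S_def)
  hence card: "card (insert 0 S) = Suc r" using inj by (simp add: S_def card_image)
  have "P = Q"
  proof (rule poly_eqI_degree[of "insert 0 S"])
    fix x assume "x \<in> insert 0 S"
    then consider "x = 0" | y where "y < r" "x = w ^ (r - y)" by (auto simp: S_def)
    thus "poly P x = poly Q x"
    proof cases
      case 1
      thus ?thesis using r by (simp add: P_def Q_def poly_prod poly_monom zero_power)
    next
      case 2
      have "x ^ r = 1" unfolding 2 power_mult[symmetric] mult.commute[of _ r] by (simp add: power_mult w_r)
      moreover have "1 + x * - (w ^ y) = 0" using 2 w_r by (simp flip: power_add)
      ultimately show ?thesis using 2(1) by (auto simp: P_def Q_def poly_prod poly_monom)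
    qed
  next
    have "degree P \<le> sum (degree \<circ> (\<lambda>x. [:1, - (w ^ x):])) {..<r}" unfolding P_def by (rule degree_prod_sum_le) simp
    also have "\<dots> \<le> (\<Sum>x<r. 1)" by (rule sum_mono) simp
    finally show "card (insert 0 S) > degree P" unfolding card by simp
    have "degree Q \<le> r" unfolding Q_def by (rule degree_diff_le) (auto simp: degree_monom_le)
    thus "card (insert 0 S) > degree Q" unfolding card by simp
  qed
  from arg_cong[OF this, of "\<lambda>p. poly p X"] show ?thesis
    by (simp add: P_def Q_def poly_prod poly_monom mult.commute)
qed

lemma prod_root_blocks: "(\<Prod>x<m + r * k. 1 - w ^ (j + x) * c) = (\<Prod>x<m. 1 - w ^ (j + x) * c) * (1 - c ^ r) ^ k"
proof (induction k)
  case (Suc k)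
  have "(\<Prod>x<m + r * Suc k. 1 - w ^ (j + x) * c) = (\<Prod>x<(m + r * k) + r. 1 - w ^ (j + x) * c)"
    by (simp add: algebra_simps)
  also have "\<dots> = (\<Prod>x<m + r * k. 1 - w ^ (j + x) * c) * (\<Prod>x<r. 1 - w ^ (j + (m + r * k + x)) * c)"
    by (rule prod_lessThan_add)
  also have "(\<Prod>x<r. 1 - w ^ (j + (m + r * k + x)) * c) = (\<Prod>x<r. 1 - w ^ x * (w ^ (j + m) * c))"
  proof -
    have "w ^ (r * k) = 1" by (simp add: power_mult w_r)
    thus ?thesis by (intro prod.cong[OF refl]) (simp add: power_add mult_ac)
  qed
  also have "\<dots> = 1 - c ^ r"
    unfolding prod_root_block power_mult_distrib power_mult[symmetric] mult.commute[of _ r]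
    by (simp add: power_mult w_r)
  finally show ?case unfolding Suc by (simp add: mult_ac)
qed simp

end

text \<open>The factors that the crossing weights at a root of unity leave on the quotients of the indices
  by \<open>r\<close>, with \<open>B = A\<^sup>r\<close>.\<close>

definition lcpos :: "'a::field \<Rightarrow> nat \<Rightarrow> nat \<Rightarrow> nat \<Rightarrow> nat \<Rightarrow> 'a" where
  "lcpos B a b i j = (if j \<le> a \<and> a + b = i + j
     then B powi (- (int j + int b)) * of_nat (a choose j) * (1 - B powi (- 2)) ^ (a - j) else 0)"

definition lcneg :: "'a::field \<Rightarrow> nat \<Rightarrow> nat \<Rightarrow> nat \<Rightarrow> nat \<Rightarrow> 'a" where
  "lcneg B a b i j = (if i \<le> b \<and> a + b = i + j
     then (- 1) ^ (b - i) * B powi (int j + int b) * of_nat (b choose i) * (1 - B powi (- 2)) ^ (b - i) else 0)"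

lemma minus_one_powi: "(- 1 :: 'a::field) powi n = (if even n then 1 else - 1)"
  by (cases "n \<ge> 0") (auto simp: power_int_def even_nat_iff)

context
  fixes q A :: "'a::field" and r :: nat
  assumes r: "0 < r" and q_r: "q ^ r = - 1" and prim: "\<And>x. 0 < x \<Longrightarrow> x < r \<Longrightarrow> q ^ (2 * x) \<noteq> 1"
    and A: "A \<noteq> 0"
begin

lemma root_nonzero: "q \<noteq> 0"
  using q_r r by (intro notI) (simp add: zero_power)

lemma root_powi_add: "q powi (e + int r * k) = q powi e * (- 1) powi k"
  using root_nonzero by (simp add: power_int_add flip: power_int_power q_r)

lemma root_powi_even: "q powi (e + 2 * int r * k) = q powi e"
  using root_powi_add[of e "2 * k"] by (simp add: minus_one_powi mult_ac)

lemma int_div_mod: "int n = int (n mod r) + int r * int (n div r)"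
  by (metis mod_mult_div_eq of_nat_add of_nat_mult)

lemma root_powi_mult: "q powi (2 * int n * int j) = q powi (2 * int (n mod r) * int (j mod r))"
    "q powi (- 2 * int n * int j) = q powi (- 2 * int (n mod r) * int (j mod r))"
proof -
  define K where "K = int (n mod r) * int (j div r) + int (n div r) * int (j mod r) + int r * int (n div r) * int (j div r)"
  have 1: "2 * int n * int j = 2 * int (n mod r) * int (j mod r) + 2 * int r * K"
    unfolding K_def by (subst (1) int_div_mod[of n], subst (1) int_div_mod[of j]) (simp add: algebra_simps)
  show "q powi (2 * int n * int j) = q powi (2 * int (n mod r) * int (j mod r))"
    unfolding 1 by (rule root_powi_even)
  have 2: "- 2 * int n * int j = - 2 * int (n mod r) * int (j mod r) + 2 * int r * (- K)"
    using 1 by (simp add: algebra_simps)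
  show "q powi (- 2 * int n * int j) = q powi (- 2 * int (n mod r) * int (j mod r))"
    unfolding 2 by (rule root_powi_even)
qed

text \<open>Lucas splits the Gaussian binomial, every complete block of r factors of the product
  gives 1 - A^(-2r), and the power of \<open>q\<close> sees only residues. What splits off is the
  same entry at q = -1, with A^r in place of A, taken at the quotients.\<close>

lemma th_root: "th q A n j = (if n mod r + j mod r < r then th q A (n mod r) (j mod r)
    * of_nat ((n div r + j div r) choose (n div r)) * (1 - (A ^ r) powi (- 2)) ^ (n div r) else 0)"
proof -
  have w: "(q\<^sup>2) ^ r = 1" "\<And>x. 0 < x \<Longrightarrow> x < r \<Longrightarrow> (q\<^sup>2) ^ x \<noteq> 1"
  proof -
    have "(q\<^sup>2) ^ r = (q ^ r)\<^sup>2" by (simp only: power_mult[symmetric] mult.commute)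
    thus "(q\<^sup>2) ^ r = 1" by (simp add: q_r)
    show "(q\<^sup>2) ^ x \<noteq> 1" if "0 < x" "x < r" for x using prim[OF that] by (simp add: power_mult)
  qed
  have q2: "q ^ (2 * x) = (q\<^sup>2) ^ x" for x by (rule power_mult)
  have c: "(A powi (- 2)) ^ r = (A ^ r) powi (- 2)"
    by (simp add: power_int_power power_int_power' mult.commute)
  have jm: "(q\<^sup>2) ^ (j + x) = (q\<^sup>2) ^ (j mod r + x)" for x
    using root_power_mod[OF r w(1), of j] w(2) by (simp add: power_add)
  have "(\<Prod>x<n. 1 - (q\<^sup>2) ^ (j + x) * A powi (- 2)) =
     (\<Prod>x<n mod r. 1 - (q\<^sup>2) ^ (j + x) * A powi (- 2)) * (1 - (A powi (- 2)) ^ r) ^ (n div r)"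
    using prod_root_blocks[OF r w, of j "A powi (- 2)" "n mod r" "n div r"] by simp
  hence P: "(\<Prod>x<n. 1 - q ^ (2 * (j + x)) * A powi (- 2)) =
     (\<Prod>x<n mod r. 1 - q ^ (2 * (j mod r + x)) * A powi (- 2)) * (1 - (A ^ r) powi (- 2)) ^ (n div r)"
    unfolding q2 jm c .
  have G: "gauss (q\<^sup>2) n j = (if n mod r + j mod r < r
     then gauss (q\<^sup>2) (n mod r) (j mod r) * of_nat ((n div r + j div r) choose (n div r)) else 0)"
    by (rule gauss_lucas[OF r w])
  show ?thesis unfolding th_def P root_powi_mult(2)[of n j]
    by (subst G) (simp add: mult_ac)
qed

lemma root_powi_A: "A powi (- (int j + int b)) = A powi (- (int (j mod r) + int (b mod r))) * (A ^ r) powi (- (int (j div r) + int (b div r)))"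
    "A powi (int j + int b) = A powi (int (j mod r) + int (b mod r)) * (A ^ r) powi (int (j div r) + int (b div r))"
  unfolding power_int_power
  by (rule powi_split[OF A], subst (1) int_div_mod[of j], subst (1) int_div_mod[of b], simp add: algebra_simps)+

lemma add_div_mod_cases:
  fixes n j :: nat
  obtains "n mod r + j mod r < r" "(n + j) mod r = n mod r + j mod r" "(n + j) div r = n div r + j div r"
  | "n mod r + j mod r \<ge> r" "(n + j) mod r + r = n mod r + j mod r" "(n + j) div r = Suc (n div r + j div r)"
proof (cases "n mod r + j mod r < r")
  case True
  have "(n + j) div r = n div r + j div r" unfolding div_add1_eq[of n j r] using True by simp
  moreover have "(n + j) mod r = n mod r + j mod r" using mod_add_eq[of n r j] True by simp
  ultimately show ?thesis using that(1) True by simp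
next
  case False
  define s where "s = n mod r + j mod r - r"
  have s: "n mod r + j mod r = r + s" using False by (simp add: s_def)
  have "s < r" using s r by (metis add_less_cancel_left add_less_mono mod_less_divisor)
  have "(n + j) mod r = (r + s) mod r" unfolding s[symmetric] by (simp add: mod_simps)
  moreover have "(n + j) div r = n div r + j div r + (r + s) div r" unfolding s[symmetric] by (rule div_add1_eq)
  ultimately show ?thesis using that(2) False s \<open>s < r\<close> r by simp
qed

text \<open>Labels outside the support of a crossing stay outside it for the residues or for the
  quotients, so the product formulas persist where the weight is zero by definition.\<close>

lemma crossing_support_div_mod:
  fixes a b i j :: nat
  assumes "\<not> (j \<le> a \<and> a + b = i + j)" "a div r + b div r = i div r + j div r"
  shows "\<not> (j mod r \<le> a mod r \<and> a mod r + b mod r = i mod r + j mod r) \<or> \<not> j div r \<le> a div r"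
proof (cases "a + b = i + j")
  case True
  hence "a < j" using assms(1) by simp
  show ?thesis
  proof (cases "a div r < j div r")
    case False
    hence "a div r = j div r" using \<open>a < j\<close> by (meson div_le_mono le_neq_implies_less less_imp_le)
    hence "a mod r < j mod r" using \<open>a < j\<close> by (metis div_mult_mod_eq nat_add_left_cancel_less)
    thus ?thesis by simp
  qed simp
next
  case False
  have "r * (a div r) + r * (b div r) = r * (i div r) + r * (j div r)"
    unfolding distrib_left[symmetric] assms(2) ..
  hence "a mod r + b mod r \<noteq> i mod r + j mod r" using False
    mult_div_mod_eq[of r a] mult_div_mod_eq[of r b] mult_div_mod_eq[of r i] mult_div_mod_eq[of r j]
    by linarith
  thus ?thesis by simp
qed

text \<open>With a = n + j and i = n + b, a carry in n + j is killed by \<open>th_root\<close>, and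
  a carry in n + b would lower the total quotient, contrary to \<open>le\<close>. Without carries
  all factors split. So a nonzero weight never raises the total, and it factorizes when the total is
  conserved.\<close>

lemma cpos_root:
  assumes le: "i div r + j div r \<le> a div r + b div r"
  shows "cpos q A a b i j = (if a div r + b div r = i div r + j div r
    then cpos q A (a mod r) (b mod r) (i mod r) (j mod r) * lcpos (A ^ r) (a div r) (b div r) (i div r) (j div r) else 0)"
proof (cases "j \<le> a \<and> a + b = i + j")
  case True
  then obtain n where n: "a = n + j" by (metis add.commute le_iff_add)
  hence i: "i = n + b" using True by simp
  show ?thesis
  proof (cases rule: add_div_mod_cases[of n j])
    case 1
    note n_j = this
    show ?thesis
    proof (cases rule: add_div_mod_cases[of n b])
      case 1
      have "cpos q A a b i j = A powi (- (int j + int b)) * q powi (2 * int a * int b) * th q A n j"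
        by (simp add: cpos_def n i)
      also have "\<dots> = cpos q A (a mod r) (b mod r) (i mod r) (j mod r) * lcpos (A ^ r) (a div r) (b div r) (i div r) (j div r)"
        unfolding root_powi_A(1)[of j b] root_powi_mult(1)[of a b] th_root[of n j] using n_j 1
        by (simp add: cpos_def lcpos_def n i binomial_symmetric[of "n div r" "n div r + j div r"])
      finally show ?thesis using n_j 1 by (simp add: n i)
    next
      case 2
      with n_j le show ?thesis by (simp add: n i)
    qed
  next
    case 2
    have "j mod r < r" "n mod r < r" using r by simp_all
    \<comment> \<open>After the carry the residue of \<open>a\<close> lies below that of
      \<open>j\<close>, so the reduced weight vanishes too.\<close>
    hence "a mod r < j mod r" using 2 unfolding n by linarith
    hence "cpos q A (a mod r) (b mod r) (i mod r) (j mod r) = 0" by (simp add: cpos_def)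
    moreover have "th q A n j = 0" using 2 th_root[of n j] by simp
    hence "cpos q A a b i j = 0" by (simp add: cpos_def n)
    ultimately show ?thesis by simp
  qed
next
  case False
  have "cpos q A (a mod r) (b mod r) (i mod r) (j mod r) = 0 \<or> lcpos (A ^ r) (a div r) (b div r) (i div r) (j div r) = 0"
    if eq: "a div r + b div r = i div r + j div r"
    using crossing_support_div_mod[of j a b i] False eq by (auto simp: cpos_def lcpos_def)
  moreover have "cpos q A a b i j = 0" unfolding cpos_def by (rule if_not_P[OF False])
  ultimately show ?thesis by auto
qed

lemma cneg_root:
  assumes le: "i div r + j div r \<le> a div r + b div r"
  shows "cneg q A a b i j = (if a div r + b div r = i div r + j div r
    then cneg q A (a mod r) (b mod r) (i mod r) (j mod r) * lcneg (A ^ r) (a div r) (b div r) (i div r) (j div r) else 0)"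
proof (cases "i \<le> b \<and> a + b = i + j")
  case True
  then obtain n where n: "b = n + i" by (metis add.commute le_iff_add)
  hence j: "j = n + a" using True by simp
  show ?thesis
  proof (cases rule: add_div_mod_cases[of n i])
    case 1
    note n_i = this
    show ?thesis
    proof (cases rule: add_div_mod_cases[of n a])
      case 1
      define m k where "m = n mod r" and "k = n div r"
      \<comment> \<open>\<open>q ^ r = - 1\<close> turns part of the exponent n(n-1) into the sign
        (-1)^K. Together with (-1)^n this leaves (-1)^(m+k), since r k (k-1) is even.\<close>
      define K where "K = - (int k * (2 * int m + int r * int k - 1))"
      have "(- 1) ^ n * q powi (- 2 * int i * int j - int n * (int n - 1))
        = (- 1) ^ m * (- 1) ^ k * q powi (- 2 * int (i mod r) * int (j mod r) - int m * (int m - 1))"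
      proof -
        have "int n = int m + int r * int k" unfolding m_def k_def by (rule int_div_mod)
        hence "- (int n * (int n - 1)) = - (int m * (int m - 1)) + int r * K"
          unfolding K_def by (simp add: algebra_simps)
        hence "q powi (- (int n * (int n - 1))) = q powi (- (int m * (int m - 1))) * (- 1) powi K"
          using root_powi_add by metis
        moreover have "(- 1 :: 'a) ^ n * (- 1) powi K = (- 1) ^ m * (- 1) ^ k"
        proof -
          have "n = m + r * k" unfolding m_def k_def by simp
          hence "(- 1 :: 'a) ^ n * (- 1) powi K = (- 1) powi (int m + int r * int k + K)"
            by (simp add: power_int_add flip: power_int_of_nat)
          also have "\<dots> = (- 1) powi (int m + int k)"
            unfolding minus_one_powi K_def by (auto simp: algebra_simps)
          finally show ?thesis by (simp add: power_int_add)
        qed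
        ultimately have "(- 1) ^ n * q powi (- (int n * (int n - 1))) = (- 1) ^ m * (- 1) ^ k * q powi (- (int m * (int m - 1)))"
          by (simp add: mult_ac)
        hence "(- 1) ^ n * q powi (- (int n * (int n - 1))) * q powi (- 2 * int i * int j) =
          (- 1) ^ m * (- 1) ^ k * q powi (- (int m * (int m - 1))) * q powi (- 2 * int (i mod r) * int (j mod r))"
          unfolding root_powi_mult(2)[of i j] by simp
        moreover have "q powi (x - y) = q powi (- y) * q powi x" for x y
          by (rule powi_split[OF root_nonzero]) simp
        ultimately show ?thesis by (simp only: mult.assoc)
      qed
      note sign = this
      have "cneg q A a b i j = ((- 1) ^ n * q powi (- 2 * int i * int j - int n * (int n - 1))) * A powi (int j + int b) * th q A n i"
        by (simp add: cneg_def n j)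
      also have "\<dots> = cneg q A (a mod r) (b mod r) (i mod r) (j mod r) * lcneg (A ^ r) (a div r) (b div r) (i div r) (j div r)"
        unfolding root_powi_A(2)[of j b] sign th_root[of n i] using n_i 1
        by (simp add: cneg_def lcneg_def n j binomial_symmetric[of "n div r" "n div r + i div r"] m_def k_def)
      finally show ?thesis using n_i 1 by (simp add: n j)
    next
      case 2
      with n_i le show ?thesis by (simp add: n j)
    qed
  next
    case 2
    have "i mod r < r" "n mod r < r" using r by simp_all
    hence "b mod r < i mod r" using 2 unfolding n by linarith
    hence "cneg q A (a mod r) (b mod r) (i mod r) (j mod r) = 0" by (simp add: cneg_def)
    moreover have "th q A n i = 0" using 2 th_root[of n i] by simp
    hence "cneg q A a b i j = 0" by (simp add: cneg_def n)
    ultimately show ?thesis by simp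
  qed
next
  case False
  have "cneg q A (a mod r) (b mod r) (i mod r) (j mod r) = 0 \<or> lcneg (A ^ r) (a div r) (b div r) (i div r) (j div r) = 0"
    if eq: "a div r + b div r = i div r + j div r"
    using crossing_support_div_mod[of i b a j] False eq by (auto simp: cneg_def lcneg_def add.commute)
  moreover have "cneg q A a b i j = 0" unfolding cneg_def by (rule if_not_P[OF False])
  ultimately show ?thesis by auto
qed

end

text \<open>Division with remainder is a bijection from labels below r e to pairs of a residue below
  r and a quotient below e; hence a truncation at a multiple of r splits exactly.\<close>

lemma sum_index_lists_mult:
  assumes "0 < (r::nat)"
  shows "(\<Sum>z\<in>index_lists (r * e) m. F (map (\<lambda>x. x mod r) z) * G (map (\<lambda>x. x div r) z))
    = (\<Sum>u\<in>index_lists r m. F u) * (\<Sum>v\<in>index_lists e m. G v :: 'a::comm_ring_1)"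
proof -
  have *: "x mod r + r * (x div r) = x" for x by simp
  have lt: "x + r * y < r * e" if "x < r" "y < e" for x y
  proof -
    have "x + r * y < r * Suc y" using that by simp
    also have "\<dots> \<le> r * e" using that by (intro mult_le_mono2) simp
    finally show ?thesis .
  qed
  have "bij_betw (\<lambda>z. (map (\<lambda>x. x mod r) z, map (\<lambda>x. x div r) z)) (index_lists (r * e) m) (index_lists r m \<times> index_lists e m)"
  proof (rule bij_betwI[where g = "\<lambda>(u, v). map2 (\<lambda>x y. x + r * y) u v"])
    have "x div r < e" if "x < r * e" for x
      by (rule less_mult_imp_div_less) (use that in \<open>simp add: mult.commute\<close>)
    thus "(\<lambda>z. (map (\<lambda>x. x mod r) z, map (\<lambda>x. x div r) z)) \<in> index_lists (r * e) m \<rightarrow> index_lists r m \<times> index_lists e m"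
      using assms unfolding index_lists_def by fastforce
    show "(\<lambda>(u, v). map2 (\<lambda>x y. x + r * y) u v) \<in> index_lists r m \<times> index_lists e m \<rightarrow> index_lists (r * e) m"
    proof
      fix uv assume "uv \<in> index_lists r m \<times> index_lists e m"
      then obtain u v where uv: "uv = (u, v)" "length u = m" "length v = m" "set u \<subseteq> {..<r}" "set v \<subseteq> {..<e}"
        by (auto simp: index_lists_def)
      have "x + r * y < r * e" if "(x, y) \<in> set (zip u v)" for x y
        by (rule lt) (use set_zip_leftD[OF that] set_zip_rightD[OF that] uv in auto)
      thus "(case uv of (u, v) \<Rightarrow> map2 (\<lambda>x y. x + r * y) u v) \<in> index_lists (r * e) m"
        using uv by (auto simp: index_lists_def)
    qed
    show "(case (map (\<lambda>x. x mod r) z, map (\<lambda>x. x div r) z) of (u, v) \<Rightarrow> map2 (\<lambda>x y. x + r * y) u v) = z" for z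
      by (simp add: map2_map_map *)
    fix uv assume "uv \<in> index_lists r m \<times> index_lists e m"
    then obtain u v where uv: "uv = (u, v)" "length u = m" "length v = m" "set u \<subseteq> {..<r}"
      by (auto simp: index_lists_def)
    have "u ! i < r" if "i < m" for i using subsetD[OF uv(4) nth_mem[of i u]] that uv by simp
    hence "map ((\<lambda>x. x mod r) \<circ> (\<lambda>(x, y). x + r * y)) (zip u v) = u"
      "map ((\<lambda>x. x div r) \<circ> (\<lambda>(x, y). x + r * y)) (zip u v) = v"
      using assms by (auto intro!: nth_equalityI simp: uv div_mult_self2)
    thus "(map (\<lambda>x. x mod r) (case uv of (u, v) \<Rightarrow> map2 (\<lambda>x y. x + r * y) u v),
        map (\<lambda>x. x div r) (case uv of (u, v) \<Rightarrow> map2 (\<lambda>x y. x + r * y) u v)) = uv"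
      by (simp add: uv)
  qed
  from sum.reindex_bij_betw[OF this, of "\<lambda>(u, v). F u * G v"] show ?thesis
    by (simp add: sum_product sum.cartesian_product)
qed

section \<open>Factorization of the state sum\<close>

abbreviation "mods r \<equiv> map (\<lambda>x::nat. x mod r)"
abbreviation "divs r \<equiv> map (\<lambda>x::nat. x div r)"
abbreviation "div_sum r \<equiv> signed_sum (\<lambda>i. int (i div r))"

text \<open>The functional is traced from the top down with two claims: it factorizes on labels of
  total quotient \<beta> and vanishes on smaller totals. The second claim disposes of slices that
  lower the total, where \<open>W\<close> itself need not factorize; nothing is claimed for larger
  totals, from which such slices could start.\<close>

lemma pull_diagram_factor:
  fixes W W1 W2 :: "piece \<Rightarrow> nat list \<Rightarrow> nat list \<Rightarrow> 'a::field"
  assumes r: "0 < r"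
    and F1: "\<And>e z x. length z = length (tgt e) \<Longrightarrow> length x = length (src e) \<Longrightarrow> W e z x \<noteq> 0 \<Longrightarrow>
       div_sum r (tgt e) z \<le> div_sum r (src e) x"
    and F2: "\<And>e z x. length z = length (tgt e) \<Longrightarrow> length x = length (src e) \<Longrightarrow>
       div_sum r (tgt e) z = div_sum r (src e) x \<Longrightarrow>
       W e z x = W2 e (mods r z) (mods r x) * W1 e (divs r z) (divs r x)"
    and F3: "\<And>e z x. length z = length (tgt e) \<Longrightarrow> length x = length (src e) \<Longrightarrow>
       W1 e (divs r z) (divs r x) \<noteq> 0 \<Longrightarrow>
       div_sum r (tgt e) z = div_sum r (src e) x"
    and \<phi>: "\<And>zs. length zs = length t \<Longrightarrow> div_sum r t zs = \<beta> \<Longrightarrow>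
       \<phi> zs = \<psi>2 (mods r zs) * \<psi>1 (divs r zs)"
      "\<And>zs. length zs = length t \<Longrightarrow> div_sum r t zs < \<beta> \<Longrightarrow> \<phi> zs = 0"
    and "is_tangle s D t" "length xs = length s"
  shows "(div_sum r s xs = \<beta> \<longrightarrow> pull_diagram (r * e) W D \<phi> xs =
      pull_diagram r W2 D \<psi>2 (mods r xs) * pull_diagram e W1 D \<psi>1 (divs r xs))
    \<and> (div_sum r s xs < \<beta> \<longrightarrow> pull_diagram (r * e) W D \<phi> xs = 0)"
  using assms(7,8)
proof (induction D arbitrary: s xs)
  case Nil
  then show ?case using \<phi> by simp
next
  case (Cons \<sigma> D)
  obtain k p where \<sigma>: "\<sigma> = (k, p)" by force
  have att: "attachable (k, p) s" and tan: "is_tangle (attach (k, p) s) D t" using Cons.prems(1) \<sigma> by auto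
  obtain s1 s2 us x ws where s: "s = s1 @ src p @ s2" "attach (k, p) s = s1 @ tgt p @ s2"
    "xs = us @ x @ ws" "length s1 = k" "length us = k" "length x = length (src p)" "length ws = length s2"
    using attachable_cases[OF att Cons.prems(2)] by metis
  define c where "c = div_sum r s1 us + div_sum r s2 ws"
  have c_xs: "div_sum r s xs = c + div_sum r (src p) x"
    using s by (simp add: c_def)
  have c_zs: "div_sum r (attach (k, p) s) (us @ z @ ws) = c + div_sum r (tgt p) z"
    if "length z = length (tgt p)" for z
    using s that by (simp add: c_def)
  have pull: "pull_diagram (r * e) W (\<sigma> # D) \<phi> xs =
     (\<Sum>z\<in>index_lists (r * e) (length (tgt p)). W p z x * pull_diagram (r * e) W D \<phi> (us @ z @ ws))"
    unfolding \<sigma> pull_diagram.simps s(3) by (rule pull_split) (use s in auto)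
  have IH: "(div_sum r (attach (k, p) s) (us @ z @ ws) = \<beta> \<longrightarrow>
       pull_diagram (r * e) W D \<phi> (us @ z @ ws) =
        pull_diagram r W2 D \<psi>2 (mods r (us @ z @ ws)) * pull_diagram e W1 D \<psi>1 (divs r (us @ z @ ws)))
      \<and> (div_sum r (attach (k, p) s) (us @ z @ ws) < \<beta> \<longrightarrow> pull_diagram (r * e) W D \<phi> (us @ z @ ws) = 0)"
    if "length z = length (tgt p)" for z
    by (rule Cons.IH[OF tan]) (use s that in simp)
  show ?case
  proof (intro conjI impI)
    assume lt: "div_sum r s xs < \<beta>"
    have "W p z x * pull_diagram (r * e) W D \<phi> (us @ z @ ws) = 0" if "z \<in> index_lists (r * e) (length (tgt p))" for z
    proof (cases "W p z x = 0")
      case False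
      have z: "length z = length (tgt p)" using that by (simp add: index_lists_def)
      from F1[OF z s(6) False] have "div_sum r (attach (k, p) s) (us @ z @ ws) < \<beta>"
        using lt unfolding c_xs c_zs[OF z] by linarith
      thus ?thesis using IH[OF z] by simp
    qed simp
    thus "pull_diagram (r * e) W (\<sigma> # D) \<phi> xs = 0" unfolding pull by (intro sum.neutral ballI)
  next
    assume eq: "div_sum r s xs = \<beta>"
    define G2 where "G2 z = W2 p z (mods r x) *
      pull_diagram r W2 D \<psi>2 (mods r us @ z @ mods r ws)" for z
    define G1 where "G1 z = W1 p z (divs r x) *
      pull_diagram e W1 D \<psi>1 (divs r us @ z @ divs r ws)" for z
    have "W p z x * pull_diagram (r * e) W D \<phi> (us @ z @ ws) = G2 (mods r z) * G1 (divs r z)"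
      if "z \<in> index_lists (r * e) (length (tgt p))" for z
    proof -
      have z: "length z = length (tgt p)" using that by (simp add: index_lists_def)
      consider "div_sum r (tgt p) z = div_sum r (src p) x"
        | "div_sum r (tgt p) z < div_sum r (src p) x"
        | "div_sum r (tgt p) z > div_sum r (src p) x" by linarith
      then show ?thesis
      proof cases
        case 1
        hence "div_sum r (attach (k, p) s) (us @ z @ ws) = \<beta>" using eq unfolding c_xs c_zs[OF z] by linarith
        thus ?thesis using IH[OF z] F2[OF z s(6) 1] by (simp add: G1_def G2_def mult_ac)
      next
        case 2
        hence "div_sum r (attach (k, p) s) (us @ z @ ws) < \<beta>" using eq unfolding c_xs c_zs[OF z] by linarith
        moreover have "W1 p (divs r z) (divs r x) = 0" using F3[OF z s(6)] 2 by fastforce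
        ultimately show ?thesis using IH[OF z] by (simp add: G1_def)
      next
        case 3
        have "W1 p (divs r z) (divs r x) = 0" using F3[OF z s(6)] 3 by fastforce
        moreover have "W p z x = 0" using F1[OF z s(6)] 3 by fastforce
        ultimately show ?thesis by (simp add: G1_def)
      qed
    qed
    hence "pull_diagram (r * e) W (\<sigma> # D) \<phi> xs = (\<Sum>z\<in>index_lists (r * e) (length (tgt p)).
       G2 (mods r z) * G1 (divs r z))"
      unfolding pull by (rule sum.cong[OF refl])
    also have "\<dots> = (\<Sum>z\<in>index_lists r (length (tgt p)). G2 z) * (\<Sum>z\<in>index_lists e (length (tgt p)). G1 z)"
      by (rule sum_index_lists_mult[OF r])
    also have "\<dots> = pull_diagram r W2 (\<sigma> # D) \<psi>2 (mods r xs) * pull_diagram e W1 (\<sigma> # D) \<psi>1 (divs r xs)"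
      unfolding \<sigma> pull_diagram.simps s(3) map_append G1_def G2_def
      by (subst (1 2) pull_split) (use s in auto)
    finally show "pull_diagram (r * e) W (\<sigma> # D) \<phi> xs =
      pull_diagram r W2 (\<sigma> # D) \<psi>2 (mods r xs) * pull_diagram e W1 (\<sigma> # D) \<psi>1 (divs r xs)" .
  qed
qed

section \<open>State sums and their values at special points\<close>

lemma pull_diagram_dim_1_entry:
  assumes "is_tangle [Up] D [Up]" "P 0 0 0 0 = 1" "N 0 0 0 0 = 1" "g 0 = 1" "g' 0 = 1"
  shows "pull_diagram 1 (wt P N g g') D (entry [0]) [0] = 1"
  using pull_diagram_dim_1[where P = P and N = N and g = g and g' = g', OF assms, of "entry [0]"] by simp

text \<open>The pivot is A^k K: \<open>k = 0\<close> for Verma modules and Jones polynomials, and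
  \<open>k = - int r\<close> for ADO, because K^(-r) is the scalar A^(-r) when q^(2r) = 1.\<close>

definition state_sum :: "nat \<Rightarrow> int \<Rightarrow> diagram \<Rightarrow> 'a::field \<Rightarrow> 'a \<Rightarrow> 'a" where
  "state_sum d k D q A = pull_diagram d (weights q A (A powi k)) D (entry [0]) [0]"

abbreviation lweights :: "'a::field \<Rightarrow> piece \<Rightarrow> nat list \<Rightarrow> nat list \<Rightarrow> 'a" where
  "lweights B \<equiv> wt (lcpos B) (lcneg B) (\<lambda>_. B) (\<lambda>_. inverse B)"

definition lstate_sum :: "nat \<Rightarrow> diagram \<Rightarrow> 'a::field \<Rightarrow> 'a" where
  "lstate_sum e D B = pull_diagram e (lweights B) D (entry [0]) [0]"

lemma state_sum_root:
  fixes q A :: "'a::field"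
  assumes D: "is_tangle [Up] D [Up]"
    and root: "0 < r" "q ^ r = - 1" "\<And>x. 0 < x \<Longrightarrow> x < r \<Longrightarrow> q ^ (2 * x) \<noteq> 1" "A \<noteq> 0"
  shows "state_sum (r * e) 0 D q A = state_sum r (- int r) D q A * lstate_sum e D (A ^ r)"
proof -
  have q: "q \<noteq> 0" using root_nonzero[OF root] .
  note [simp] = less_imp_neq[OF root(1), symmetric]
  define W where "W = weights q A (A powi 0)"
  define W2 where "W2 = weights q A (A powi (- int r))"
  define W1 where "W1 = lweights (A ^ r)"
  \<comment> \<open>K is split between the factors: A^(-r) K depends only on the residue and is the
    ADO pivot, and the remaining A^r is the pivot of \<open>lweights\<close>.\<close>
  have piv: "A powi 0 * (A * q powi (- 2 * int i)) = A powi (- int r) * (A * q powi (- 2 * int (i mod r))) * A ^ r" for i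
  proof -
    have "q powi (- 2 * int i) = q powi (- 2 * int (i mod r))"
    proof -
      have "- 2 * int i = - 2 * int (i mod r) + 2 * int r * (- int (i div r))"
        using int_div_mod[OF root, of i] by (simp add: algebra_simps)
      thus ?thesis using root_powi_even[OF root] by metis
    qed
    thus ?thesis using root(4) by (simp add: power_int_minus)
  qed
  have pos: "cpos q A a b i j = 0" if "int (a div r) + int (b div r) > int (i div r) + int (j div r)" for a b i j
    by (subst cpos_root[OF root]) (use that in linarith, use that in auto)
  have neg: "cneg q A a b i j = 0" if "int (a div r) + int (b div r) > int (i div r) + int (j div r)" for a b i j
    by (subst cneg_root[OF root]) (use that in linarith, use that in auto)
  have pos': "cpos q A a b i j = cpos q A (a mod r) (b mod r) (i mod r) (j mod r) * lcpos (A ^ r) (a div r) (b div r) (i div r) (j div r)"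
     if "int (a div r) + int (b div r) = int (i div r) + int (j div r)" for a b i j
    by (subst cpos_root[OF root]) (use that in linarith, use that in auto)
  have neg': "cneg q A a b i j = cneg q A (a mod r) (b mod r) (i mod r) (j mod r) * lcneg (A ^ r) (a div r) (b div r) (i div r) (j div r)"
     if "int (a div r) + int (b div r) = int (i div r) + int (j div r)" for a b i j
    by (subst cneg_root[OF root]) (use that in linarith, use that in auto)
  have div_mod: "(i div r = j div r \<and> i mod r = j mod r) = (i = j)" for i j by (metis div_mult_mod_eq)
  have "(div_sum r [Up] [0] = 0 \<longrightarrow> pull_diagram (r * e) W D (entry [0]) [0] =
      pull_diagram r W2 D (entry [0]) (mods r [0]) * pull_diagram e W1 D (entry [0]) (divs r [0]))
    \<and> (div_sum r [Up] [0] < 0 \<longrightarrow> pull_diagram (r * e) W D (entry [0]) [0] = 0)"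
  proof (rule pull_diagram_factor[where t = "[Up]"])
    fix e :: piece and z x :: "nat list" assume len: "length z = length (tgt e)" "length x = length (src e)"
    show "div_sum r (tgt e) z \<le> div_sum r (src e) x" if "W e z x \<noteq> 0"
      using that unfolding W_def by (cases rule: wt_nonzero_cases) (use pos neg in \<open>auto simp: not_less[symmetric]\<close>)
    show "div_sum r (tgt e) z = div_sum r (src e) x"
      if "W1 e (divs r z) (divs r x) \<noteq> 0"
      using that unfolding W1_def
      by (cases rule: wt_nonzero_cases) (auto simp: lcpos_def lcneg_def split: if_splits)
    assume eq: "div_sum r (tgt e) z = div_sum r (src e) x"
    show "W e z x = W2 e (mods r z) (mods r x) * W1 e (divs r z) (divs r x)"
    proof (cases e)
      case Cross_Pos
      then obtain a b i j where "z = [a, b]" "x = [i, j]" using len by (auto simp: length_Suc_conv)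
      thus ?thesis using eq pos'[of a b i j] by (simp add: Cross_Pos W_def W1_def W2_def)
    next
      case Cross_Neg
      then obtain a b i j where "z = [a, b]" "x = [i, j]" using len by (auto simp: length_Suc_conv)
      thus ?thesis using eq neg'[of a b i j] by (simp add: Cross_Neg W_def W1_def W2_def)
    next
      case Cap_Down_Up
      then obtain i j where "z = []" "x = [i, j]" using len by (auto simp: length_Suc_conv)
      thus ?thesis using eq div_mod[of i j] by (auto simp: Cap_Down_Up W_def W1_def W2_def)
    next
      case Cap_Up_Down
      then obtain i j where zx: "z = []" "x = [i, j]" using len by (auto simp: length_Suc_conv)
      show ?thesis using div_mod[of i j] unfolding zx Cap_Up_Down W_def W1_def W2_def
        by (simp only: wt.simps list.map piv[of i]) auto
    next
      case Cup_Up_Down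
      then obtain i j where "x = []" "z = [i, j]" using len by (auto simp: length_Suc_conv)
      thus ?thesis using eq div_mod[of i j] by (auto simp: Cup_Up_Down W_def W1_def W2_def)
    next
      case Cup_Down_Up
      then obtain i j where "x = []" "z = [i, j]" using len by (auto simp: length_Suc_conv)
      thus ?thesis using eq div_mod[of i j] arg_cong[OF piv[of i], of inverse] unfolding Cup_Down_Up W_def W1_def W2_def
        by (simp del: inverse_mult_distrib add: inverse_mult_distrib[of _ "A ^ r"]) auto
    qed
  next
    fix zs assume "length zs = length [Up]" "div_sum r [Up] zs = 0"
    then obtain x where "zs = [x]" "x div r = 0" by (auto simp: length_Suc_conv)
    thus "(entry [0] zs :: 'a) = entry [0] (mods r zs) * entry [0] (divs r zs)"
      using div_mod[of x 0] by auto
  next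
    fix zs assume "length zs = length [Up]" "div_sum r [Up] zs < 0"
    thus "(entry [0] zs :: 'a) = 0" by (auto simp: length_Suc_conv)
  qed (use root D in auto)
  thus ?thesis by (simp add: state_sum_def lstate_sum_def W_def W1_def W2_def)
qed

text \<open>The factorization for r = 1: all residues are 0, so the first factor is a
  one-dimensional state sum, which is 1.\<close>

lemma state_sum_minus_one:
  fixes B :: "'a::field"
  assumes D: "is_tangle [Up] D [Up]" and B: "B \<noteq> 0"
  shows "state_sum e 0 D (- 1) B = lstate_sum e D B"
proof -
  have "state_sum 1 (- 1) D (- 1) B = 1"
    unfolding state_sum_def using B
    by (intro pull_diagram_dim_1_entry[OF D]) (simp_all add: cpos_def cneg_def power_int_minus)
  thus ?thesis using state_sum_root[OF D, of 1 "-1" B e] B by simp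
qed

text \<open>At B = 1 the powers of 1 - B^(-2) kill every term but \<open>a = j\<close>,
  \<open>b = i\<close>: crossings only permute labels. On a knot all labels then equal the 0 at the
  ends.\<close>

lemma lstate_sum_1:
  assumes D: "is_tangle [Up] D [Up]" "one_component [Up] D" and e: "0 < e"
  shows "lstate_sum e D (1 :: 'a::field) = 1"
proof -
  have "lstate_sum e D (1 :: 'a) = pull_diagram 1 (lweights 1) D (entry [0]) [0]"
    unfolding lstate_sum_def
    by (rule pull_diagram_truncate_eq[OF D]) (use e in \<open>auto simp: lcpos_def lcneg_def split: if_splits\<close>)
  also have "\<dots> = 1"
    by (intro pull_diagram_dim_1_entry[OF D(1)]) (simp_all add: lcpos_def lcneg_def)
  finally show ?thesis .
qed

text \<open>The factor with \<open>x = N - j\<close> is zero: no F^(n) leads past v_N when A =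
  q^N.\<close>

lemma th_power_eq_0:
  assumes q: "q \<noteq> 0" and "j \<le> N" "N < n + j"
  shows "th q (q ^ N) n j = 0"
proof -
  have "q ^ (2 * N) * (q ^ N) powi (- 2) = 1"
    using q by (simp add: power_int_minus power_mult[symmetric] mult.commute)
  moreover have "j + (N - j) = N" using assms(2) by simp
  ultimately have "1 - q ^ (2 * (j + (N - j))) * (q ^ N) powi (- 2) = 0" by (simp only: diff_self)
  hence "(\<Prod>x<n. 1 - q ^ (2 * (j + x)) * (q ^ N) powi (- 2)) = 0"
    using assms(2,3) by (intro prod_zero bexI[where x = "N - j"]) auto
  thus ?thesis by (simp add: th_def)
qed

text \<open>With d' = N + 1: by \<open>th_power_eq_0\<close> a crossing gives a label above N only
  to a strand that already had one.\<close>

lemma state_sum_truncate: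
  fixes q :: "'a::field"
  assumes D: "is_tangle [Up] D [Up]" "one_component [Up] D" and q: "q \<noteq> 0" and "N < d"
  shows "state_sum d 0 D q (q ^ N) = state_sum (Suc N) 0 D q (q ^ N)"
  unfolding state_sum_def
proof (rule pull_diagram_truncate_eq[OF D])
  fix a b i j assume "cpos q (q ^ N) a b i j \<noteq> 0"
  thus "(Suc N \<le> a \<longrightarrow> Suc N \<le> j) \<and> (Suc N \<le> b \<longrightarrow> Suc N \<le> i)"
    using th_power_eq_0[OF q, of j N "a - j"] by (cases "j \<le> N"; cases "N < a") (auto simp: cpos_def not_less_eq_eq split: if_splits)
next
  fix a b i j assume "cneg q (q ^ N) a b i j \<noteq> 0"
  thus "(Suc N \<le> a \<longrightarrow> Suc N \<le> j) \<and> (Suc N \<le> b \<longrightarrow> Suc N \<le> i)"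
    using th_power_eq_0[OF q, of i N "b - i"] by (cases "i \<le> N"; cases "N < b") (auto simp: cneg_def not_less_eq_eq split: if_splits)
qed (use assms in auto)

section \<open>Laurent polynomials\<close>

context
  fixes h :: "'a::comm_ring_1 \<Rightarrow> 'b::comm_ring_1"
  assumes h_0: "h 0 = 0" and h_1: "h 1 = 1" and h_add: "\<And>x y. h (x + y) = h x + h y"
    and h_mult: "\<And>x y. h (x * y) = h x * h y"
begin

lemma map_poly_hom_add: "map_poly h (p + q) = map_poly h p + map_poly h q"
  by (simp add: poly_eq_iff coeff_map_poly h_0 h_add)

lemma map_poly_hom_smult: "map_poly h (smult c p) = smult (h c) (map_poly h p)"
  by (simp add: poly_eq_iff coeff_map_poly h_0 h_mult)

lemma map_poly_hom_mult: "map_poly h (p * q) = map_poly h p * map_poly h q"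
proof (induction p)
  case (pCons a p)
  have "map_poly h (pCons a p * q) = smult (h a) (map_poly h q) + pCons 0 (map_poly h p * map_poly h q)"
    using pCons by (simp add: map_poly_hom_add map_poly_hom_smult map_poly_pCons h_0)
  also have "\<dots> = map_poly h (pCons a p) * map_poly h q"
    by (simp add: map_poly_pCons h_0)
  finally show ?case .
qed simp

lemma map_poly_hom_1: "map_poly h 1 = 1"
  by (simp add: map_poly_1' h_1)

lemma poly_map_poly_hom: "poly (map_poly h p) (h x) = h (poly p x)"
  by (induction p) (simp_all add: map_poly_pCons h_0 h_add h_mult)

end

definition int_eval :: "'a::comm_ring_1 \<Rightarrow> int poly \<Rightarrow> 'a" where
  "int_eval q c = poly (map_poly of_int c) q"

lemma int_eval_hom:
  "int_eval q 0 = 0" "int_eval q 1 = 1" "int_eval q (c + c') = int_eval q c + int_eval q c'"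
  "int_eval q (c * c') = int_eval q c * int_eval q c'"
  by (simp_all add: int_eval_def map_poly_hom_1 map_poly_hom_add map_poly_hom_mult)

text \<open>\<open>A\<close> is the outer variable, since divisibility by A - q^N will be taken
  among polynomials in A over Z[q].\<close>

definition int_eval2 :: "'a::comm_ring_1 \<Rightarrow> 'a \<Rightarrow> int poly poly \<Rightarrow> 'a" where
  "int_eval2 q A P = poly (map_poly (int_eval q) P) A"

lemma int_eval2_hom:
  "int_eval2 q A 0 = 0" "int_eval2 q A 1 = 1" "int_eval2 q A (P + P') = int_eval2 q A P + int_eval2 q A P'"
  "int_eval2 q A (P * P') = int_eval2 q A P * int_eval2 q A P'"
  by (simp_all add: int_eval2_def map_poly_hom_1 map_poly_hom_add map_poly_hom_mult int_eval_hom)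

lemma int_eval2_power: "int_eval2 q A (P ^ n) = int_eval2 q A P ^ n"
  by (induction n) (simp_all add: int_eval2_hom)

lemma int_eval2_prod: "int_eval2 q A (\<Prod>i\<in>I. P i) = (\<Prod>i\<in>I. int_eval2 q A (P i))"
  by (induction I rule: infinite_finite_induct) (simp_all add: int_eval2_hom)

lemma int_eval2_q: "int_eval2 q A [:[:0, 1:]:] = q"
  by (simp add: int_eval2_def int_eval_def map_poly_pCons)

lemma int_eval2_A: "int_eval2 q A [:0, 1:] = A"
  by (simp add: int_eval2_def int_eval_hom map_poly_pCons)

lemma int_eval2_minus_1: "int_eval2 q A (- 1) = - 1"
proof -
  have "int_eval2 q A (- 1) + int_eval2 q A 1 = 0"
    by (simp flip: int_eval2_hom(3) add: int_eval2_hom(1))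
  thus ?thesis by (simp add: int_eval2_hom eq_neg_iff_add_eq_0)
qed

text \<open>Laurent polynomials over the integers as functions on two fields, to carry identities at the
  transcendental \<open>q = fls_X\<^sup>2\<close> over to complex roots of unity.\<close>

definition laurent_pair :: "('a::field \<Rightarrow> 'a \<Rightarrow> 'a) \<Rightarrow> ('b::field \<Rightarrow> 'b \<Rightarrow> 'b) \<Rightarrow> bool" where
  "laurent_pair f g \<longleftrightarrow> (\<exists>P M. (\<forall>q A. q \<noteq> 0 \<longrightarrow> A \<noteq> 0 \<longrightarrow> (q * A) ^ M * f q A = int_eval2 q A P)
     \<and> (\<forall>q A. q \<noteq> 0 \<longrightarrow> A \<noteq> 0 \<longrightarrow> (q * A) ^ M * g q A = int_eval2 q A P))"

lemma laurent_pairI: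
  assumes "\<And>q A. q \<noteq> 0 \<Longrightarrow> A \<noteq> 0 \<Longrightarrow> (q * A) ^ M * f q A = int_eval2 q A P"
    "\<And>q A. q \<noteq> 0 \<Longrightarrow> A \<noteq> 0 \<Longrightarrow> (q * A) ^ M * g q A = int_eval2 q A P"
  shows "laurent_pair f g"
  using assms unfolding laurent_pair_def by blast

lemma laurent_pair_0: "laurent_pair (\<lambda>q A. 0) (\<lambda>q A. 0)"
  by (rule laurent_pairI[where M = 0 and P = 0]) (simp_all add: int_eval2_hom)

lemma laurent_pair_1: "laurent_pair (\<lambda>q A. 1) (\<lambda>q A. 1)"
  by (rule laurent_pairI[where M = 0 and P = 1]) (simp_all add: int_eval2_hom)

lemma laurent_pair_minus_1: "laurent_pair (\<lambda>q A. - 1) (\<lambda>q A. - 1)"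
  by (rule laurent_pairI[where M = 0 and P = "- 1"]) (simp_all add: int_eval2_minus_1)

lemma laurent_pair_q: "laurent_pair (\<lambda>q A. q) (\<lambda>q A. q)"
  by (rule laurent_pairI[where M = 0 and P = "[:[:0, 1:]:]"]) (simp_all add: int_eval2_q)

lemma laurent_pair_A: "laurent_pair (\<lambda>q A. A) (\<lambda>q A. A)"
  by (rule laurent_pairI[where M = 0 and P = "[:0, 1:]"]) (simp_all add: int_eval2_A)

lemma laurent_pair_inverse_q: "laurent_pair (\<lambda>q A. inverse q) (\<lambda>q A. inverse q)"
  by (rule laurent_pairI[where M = 1 and P = "[:0, 1:]"]) (simp_all add: int_eval2_A)

lemma laurent_pair_inverse_A: "laurent_pair (\<lambda>q A. inverse A) (\<lambda>q A. inverse A)"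
  by (rule laurent_pairI[where M = 1 and P = "[:[:0, 1:]:]"]) (simp_all add: int_eval2_q)

lemma laurent_pair_mult:
  assumes "laurent_pair f g" "laurent_pair f' g'"
  shows "laurent_pair (\<lambda>q A. f q A * f' q A) (\<lambda>q A. g q A * g' q A)"
proof -
  obtain P M where fg:
    "\<And>q A. q \<noteq> 0 \<Longrightarrow> A \<noteq> 0 \<Longrightarrow> (q * A) ^ M * f q A = int_eval2 q A P"
    "\<And>q A. q \<noteq> 0 \<Longrightarrow> A \<noteq> 0 \<Longrightarrow> (q * A) ^ M * g q A = int_eval2 q A P"
    using assms(1) unfolding laurent_pair_def by blast
  obtain P' M' where fg':
    "\<And>q A. q \<noteq> 0 \<Longrightarrow> A \<noteq> 0 \<Longrightarrow> (q * A) ^ M' * f' q A = int_eval2 q A P'"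
    "\<And>q A. q \<noteq> 0 \<Longrightarrow> A \<noteq> 0 \<Longrightarrow> (q * A) ^ M' * g' q A = int_eval2 q A P'"
    using assms(2) unfolding laurent_pair_def by blast
  note * = fg[symmetric] fg'[symmetric]
  show ?thesis
    by (rule laurent_pairI[where M = "M + M'" and P = "P * P'"])
       (simp_all add: int_eval2_hom * power_add mult_ac)
qed

lemma laurent_pair_add:
  assumes "laurent_pair f g" "laurent_pair f' g'"
  shows "laurent_pair (\<lambda>q A. f q A + f' q A) (\<lambda>q A. g q A + g' q A)"
proof -
  obtain P M where fg:
    "\<And>q A. q \<noteq> 0 \<Longrightarrow> A \<noteq> 0 \<Longrightarrow> (q * A) ^ M * f q A = int_eval2 q A P"
    "\<And>q A. q \<noteq> 0 \<Longrightarrow> A \<noteq> 0 \<Longrightarrow> (q * A) ^ M * g q A = int_eval2 q A P"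
    using assms(1) unfolding laurent_pair_def by blast
  obtain P' M' where fg':
    "\<And>q A. q \<noteq> 0 \<Longrightarrow> A \<noteq> 0 \<Longrightarrow> (q * A) ^ M' * f' q A = int_eval2 q A P'"
    "\<And>q A. q \<noteq> 0 \<Longrightarrow> A \<noteq> 0 \<Longrightarrow> (q * A) ^ M' * g' q A = int_eval2 q A P'"
    using assms(2) unfolding laurent_pair_def by blast
  note * = fg[symmetric] fg'[symmetric]
  define Q :: "int poly poly" where "Q = [:[:0, 1:]:] * [:0, 1:]"
  have Q: "int_eval2 q A Q = q * A" "int_eval2 q' A' Q = q' * A'" for q A :: 'a and q' A' :: 'b
    by (simp_all only: Q_def int_eval2_hom int_eval2_q int_eval2_A)
  show ?thesis
    by (rule laurent_pairI[where M = "M + M'" and P = "P * Q ^ M' + P' * Q ^ M"])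
       (simp_all add: int_eval2_hom int_eval2_power Q * power_add distrib_left mult_ac)
qed

lemma laurent_pair_diff:
  assumes "laurent_pair f g" "laurent_pair f' g'"
  shows "laurent_pair (\<lambda>q A. f q A - f' q A) (\<lambda>q A. g q A - g' q A)"
  using laurent_pair_add[OF assms(1) laurent_pair_mult[OF laurent_pair_minus_1 assms(2)]] by simp

lemma laurent_pair_sum:
  "(\<And>i. i \<in> I \<Longrightarrow> laurent_pair (f i) (g i)) \<Longrightarrow> laurent_pair (\<lambda>q A. \<Sum>i\<in>I. f i q A) (\<lambda>q A. \<Sum>i\<in>I. g i q A)"
  by (induction I rule: infinite_finite_induct) (auto intro: laurent_pair_0 laurent_pair_add)

lemma laurent_pair_prod:
  "(\<And>i. i \<in> I \<Longrightarrow> laurent_pair (f i) (g i)) \<Longrightarrow> laurent_pair (\<lambda>q A. \<Prod>i\<in>I. f i q A) (\<lambda>q A. \<Prod>i\<in>I. g i q A)"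
  by (induction I rule: infinite_finite_induct) (auto intro: laurent_pair_1 laurent_pair_mult)

lemma laurent_pair_power:
  "laurent_pair f g \<Longrightarrow> laurent_pair (\<lambda>q A. f q A ^ n) (\<lambda>q A. g q A ^ n)"
  by (induction n) (auto intro: laurent_pair_1 laurent_pair_mult)

lemma laurent_pair_powi:
  "laurent_pair (\<lambda>q A. q powi k) (\<lambda>q A. q powi k)" "laurent_pair (\<lambda>q A. A powi k) (\<lambda>q A. A powi k)"
  by (cases "k \<ge> 0"; simp add: power_int_def laurent_pair_power laurent_pair_q laurent_pair_A
      laurent_pair_inverse_q laurent_pair_inverse_A)+

lemma laurent_pair_gauss:
  "laurent_pair (\<lambda>q A. gauss (q\<^sup>2) n j) (\<lambda>q A. gauss (q\<^sup>2) n j)"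
\<comment> \<open>The ring argument of \<open>gauss.induct\<close> is a placeholder; only the
  recursion on \<open>n\<close> and \<open>j\<close> matters.\<close>
proof (induction "0 :: int" n j rule: gauss.induct)
  case (3 n j)
  show ?case unfolding gauss.simps
    by (intro laurent_pair_add laurent_pair_mult laurent_pair_power laurent_pair_q 3)
qed (simp_all add: laurent_pair_1)

lemma laurent_pair_th: "laurent_pair (\<lambda>q A. th q A n j) (\<lambda>q A. th q A n j)"
  unfolding th_def
  by (intro laurent_pair_mult laurent_pair_powi laurent_pair_gauss laurent_pair_prod laurent_pair_diff
      laurent_pair_1 laurent_pair_power laurent_pair_q)

lemma laurent_pair_if:
  "(b \<Longrightarrow> laurent_pair f g) \<Longrightarrow> laurent_pair (\<lambda>q A. if b then f q A else 0) (\<lambda>q A. if b then g q A else 0)"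
  by (cases b) (simp_all add: laurent_pair_0)

lemma laurent_pair_cpos: "laurent_pair (\<lambda>q A. cpos q A a b i j) (\<lambda>q A. cpos q A a b i j)"
  unfolding cpos_def by (intro laurent_pair_if laurent_pair_mult laurent_pair_powi laurent_pair_th)

lemma laurent_pair_cneg: "laurent_pair (\<lambda>q A. cneg q A a b i j) (\<lambda>q A. cneg q A a b i j)"
  unfolding cneg_def
  by (intro laurent_pair_if laurent_pair_mult laurent_pair_powi laurent_pair_th laurent_pair_power laurent_pair_minus_1)

lemma laurent_pair_pivot:
  "laurent_pair (\<lambda>q A. A powi k * (A * q powi l)) (\<lambda>q A. A powi k * (A * q powi l))"
  "laurent_pair (\<lambda>q A. inverse (A powi k * (A * q powi l))) (\<lambda>q A. inverse (A powi k * (A * q powi l)))"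
proof -
  show "laurent_pair (\<lambda>q A. A powi k * (A * q powi l)) (\<lambda>q A. A powi k * (A * q powi l))"
    by (intro laurent_pair_mult laurent_pair_powi laurent_pair_A)
  have "laurent_pair (\<lambda>q A. A powi (- k) * (inverse A * q powi (- l))) (\<lambda>q A. A powi (- k) * (inverse A * q powi (- l)))"
    by (intro laurent_pair_mult laurent_pair_powi laurent_pair_inverse_A)
  thus "laurent_pair (\<lambda>q A. inverse (A powi k * (A * q powi l))) (\<lambda>q A. inverse (A powi k * (A * q powi l)))"
    by (simp add: power_int_minus)
qed

lemma wt_length: "\<not> (length z = length (tgt e) \<and> length x = length (src e)) \<Longrightarrow> wt P N g g' e z x = 0"
  by (cases "(P, N, g, g', e, z, x)" rule: wt.cases) auto

lemma laurent_pair_weights: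
  "laurent_pair (\<lambda>q A. weights q A (A powi k) e z x) (\<lambda>q A. weights q A (A powi k) e z x)"
proof (cases "length z = length (tgt e) \<and> length x = length (src e)")
  case True
  then show ?thesis
    by (cases e) (auto simp: length_Suc_conv intro!: laurent_pair_cpos laurent_pair_cneg laurent_pair_if
      laurent_pair_0 laurent_pair_1 laurent_pair_pivot simp del: inverse_mult_distrib)
qed (simp add: wt_length laurent_pair_0)

lemma laurent_pair_pull_diagram:
  "laurent_pair (\<lambda>q A. pull_diagram d (weights q A (A powi k)) D (entry ys) xs)
     (\<lambda>q A. pull_diagram d (weights q A (A powi k)) D (entry ys) xs)"
proof (induction D arbitrary: xs)
  case Nil
  show ?case by (simp add: laurent_pair_0 laurent_pair_1)
next
  case (Cons \<sigma> D)
  obtain l e where \<sigma>: "\<sigma> = (l, e)" by force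
  show ?case unfolding pull_diagram.simps \<sigma> pull.simps
    by (intro laurent_pair_sum laurent_pair_mult laurent_pair_weights Cons)
qed

lemma laurent_pair_state_sum: "laurent_pair (state_sum d k D) (state_sum d k D)"
  unfolding state_sum_def[abs_def] by (rule laurent_pair_pull_diagram)

section \<open>Divisibility in Z[q][A] and the order at A = 1\<close>

lemma prod_linear_factors_dvd:
  fixes p :: "'a::idom poly"
  assumes "finite S" "inj_on f S" "\<And>x. x \<in> S \<Longrightarrow> poly p (f x) = 0"
  shows "(\<Prod>x\<in>S. [:- f x, 1:]) dvd p"
  using assms
proof (induction S arbitrary: p rule: finite_induct)
  case (insert y S)
  have "[:- f y, 1:] dvd p" using insert.prems(2) by (simp add: poly_eq_0_iff_dvd)
  then obtain g where g: "p = [:- f y, 1:] * g" by (elim dvdE)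
  have "poly g (f x) = 0" if "x \<in> S" for x
  proof -
    have "f x \<noteq> f y" using insert.prems(1) insert.hyps that by (metis inj_on_insert image_eqI insert_Diff_single Diff_insert_absorb inj_on_def insertCI)
    moreover have "poly p (f x) = 0" using insert.prems(2) that by simp
    ultimately show ?thesis by (simp add: g)
  qed
  hence "(\<Prod>x\<in>S. [:- f x, 1:]) dvd g" using insert by simp
  thus ?case unfolding prod.insert[OF insert.hyps] g by (rule mult_dvd_mono[OF dvd_refl])
qed simp

text \<open>The square of \<open>fls_X\<close> is transcendental: the coefficient of degree 2n
  recovers the n-th coefficient of \<open>c\<close>.\<close>

lemma int_eval_fls_X_square_eq_0:
  assumes "int_eval ((fls_X :: rat fls)\<^sup>2) c = 0"
  shows "c = 0"
proof (rule poly_eqI)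
  fix n
  let ?c = "map_poly of_int c :: rat fls poly"
  have "int_eval ((fls_X :: rat fls)\<^sup>2) c = (\<Sum>i\<le>degree ?c. of_int (coeff c i) * fls_X ^ (2 * i))"
    by (simp add: int_eval_def poly_altdef coeff_map_poly power_mult)
  hence "fls_nth (int_eval ((fls_X :: rat fls)\<^sup>2) c) (int (2 * n)) = (\<Sum>i\<le>degree ?c. if i = n then of_int (coeff c i) else 0)"
    by (simp add: fls_nth_sum if_distrib cong: if_cong)
  also have "\<dots> = of_int (coeff c n)"
  proof (cases "n \<le> degree ?c")
    case False
    hence "coeff ?c n = 0" by (simp add: coeff_eq_0)
    thus ?thesis using False by (simp add: coeff_map_poly)
  qed simp
  finally show "coeff c n = coeff 0 n" using assms by simp
qed

lemma int_eval_monom: "int_eval q (monom 1 n) = q ^ n"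
  by (simp add: int_eval_def map_poly_monom poly_monom)

text \<open>At the transcendental value each zero A = q^N is a root of the polynomial in Z[q][A],
  and these roots are distinct, so the product of the linear factors divides it. The quotient can
  then be evaluated at any nonzero \<open>q\<close> of the second field, even where several q^N
  coincide and the zeros merge.\<close>

lemma laurent_pair_vanishing:
  fixes f :: "rat fls \<Rightarrow> rat fls \<Rightarrow> rat fls" and g :: "'b::field \<Rightarrow> 'b \<Rightarrow> 'b"
  assumes "laurent_pair f g" and f: "\<And>N. N \<in> I \<Longrightarrow> f (fls_X\<^sup>2) ((fls_X\<^sup>2) ^ N) = 0" and I: "finite I"
  shows "\<exists>M G. \<forall>q A. q \<noteq> 0 \<longrightarrow> A \<noteq> 0 \<longrightarrow> (q * A) ^ M * g q A = (\<Prod>N\<in>I. A - q ^ N) * int_eval2 q A G"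
proof -
  obtain P M where P: "\<And>q A. q \<noteq> 0 \<Longrightarrow> A \<noteq> 0 \<Longrightarrow> (q * A) ^ M * f q A = int_eval2 q A P"
    "\<And>q A. q \<noteq> 0 \<Longrightarrow> A \<noteq> 0 \<Longrightarrow> (q * A) ^ M * g q A = int_eval2 q A P"
    using assms(1) unfolding laurent_pair_def by blast
  let ?X = "(fls_X :: rat fls)\<^sup>2"
  have "poly P (monom 1 N) = 0" if "N \<in> I" for N
  proof (rule int_eval_fls_X_square_eq_0)
    have "int_eval ?X (poly P (monom 1 N)) = int_eval2 ?X (int_eval ?X (monom 1 N)) P"
      unfolding int_eval2_def by (rule poly_map_poly_hom[symmetric]) (simp_all add: int_eval_hom)
    also have "\<dots> = 0" unfolding int_eval_monom using P(1)[of ?X "?X ^ N"] f[OF that] by simp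
    finally show "int_eval ?X (poly P (monom 1 N)) = 0" .
  qed
  hence "(\<Prod>N\<in>I. [:- monom 1 N, 1:]) dvd P"
    by (intro prod_linear_factors_dvd I) (auto simp: inj_on_def monom_eq_iff')
  then obtain G where G: "P = (\<Prod>N\<in>I. [:- monom 1 N, 1:]) * G" by (elim dvdE)
  have lin: "int_eval2 q A [:- monom 1 N, 1:] = A - q ^ N" for q A :: 'b and N
  proof -
    have "int_eval q (- monom 1 N) + int_eval q (monom 1 N) = 0"
      by (simp flip: int_eval_hom(3) add: int_eval_hom(1))
    hence "int_eval q (- monom 1 N) = - (q ^ N)" by (simp add: int_eval_monom eq_neg_iff_add_eq_0)
    thus ?thesis by (simp add: int_eval2_def map_poly_pCons int_eval_hom)
  qed
  have "int_eval2 q A (\<Prod>N\<in>I. [:- monom 1 N, 1:]) = (\<Prod>N\<in>I. A - q ^ N)" for q A :: 'b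
    by (simp only: int_eval2_prod lin)
  hence "(q * A) ^ M * g q A = (\<Prod>N\<in>I. A - q ^ N) * int_eval2 q A G" if "q \<noteq> 0" "A \<noteq> 0" for q A
    using P(2)[OF that] by (simp only: G int_eval2_hom(4))
  thus ?thesis by blast
qed

lemma state_sum_agree_order:
  fixes q :: complex
  assumes J: "\<And>N. 1 \<le> N \<Longrightarrow>
      state_sum (Suc N) 0 D (fls_X\<^sup>2) ((fls_X\<^sup>2) ^ N) = (state_sum (Suc N) 0 D' (fls_X\<^sup>2) ((fls_X\<^sup>2) ^ N) :: rat fls)"
    and D: "is_tangle [Up] D [Up]" "one_component [Up] D" "is_tangle [Up] D' [Up]" "one_component [Up] D'"
    and q: "q ^ (2 * r) = 1" and r: "0 < r" and d: "2 * r * K < d"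
  shows "\<exists>M Q. \<forall>A. A \<noteq> 0 \<longrightarrow> A ^ M * (state_sum d 0 D q A - state_sum d 0 D' q A) = poly ([:- 1, 1:] ^ K * Q) A"
proof -
  have q0: "q \<noteq> 0" using q r by (intro notI) (simp add: zero_power)
  \<comment> \<open>By \<open>q ^ (2 * r) = 1\<close> every multiple N of 2r has q^N = 1 and so
    contributes one factor A - 1. The multiples start at 2r because color 0 is not in the family;
    the K-th one, 2rK, is still below \<open>d\<close>.\<close>
  define I where "I = (\<lambda>i. 2 * r * Suc i) ` {..<K}"
  have I: "I \<subseteq> {1..<d}"
  proof
    fix N assume "N \<in> I"
    then obtain i where "N = 2 * r * Suc i" "i \<in> {..<K}" unfolding I_def by blast
    hence i: "N = 2 * r * Suc i" "Suc i \<le> K" by simp_all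
    have "2 * r * Suc i \<le> 2 * r * K" using i by (intro mult_le_mono2)
    moreover have "1 \<le> 2 * r * Suc i" using r by simp
    ultimately show "N \<in> {1..<d}" using i(1) d by simp
  qed
  have pair: "laurent_pair (\<lambda>q A. state_sum d 0 D q A - state_sum d 0 D' q A :: rat fls)
     (\<lambda>q A. state_sum d 0 D q A - state_sum d 0 D' q A :: complex)"
    by (intro laurent_pair_diff laurent_pair_state_sum)
  have zero: "state_sum d 0 D (fls_X\<^sup>2) ((fls_X\<^sup>2) ^ N) - state_sum d 0 D' (fls_X\<^sup>2) ((fls_X\<^sup>2) ^ N) = (0 :: rat fls)"
    if "N \<in> I" for N
  proof -
    have N: "1 \<le> N" "N < d" using subsetD[OF I that] by auto
    show ?thesis
      unfolding state_sum_truncate[OF D(1,2) _ N(2), of "fls_X\<^sup>2 :: rat fls", simplified]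
        state_sum_truncate[OF D(3,4) _ N(2), of "fls_X\<^sup>2 :: rat fls", simplified]
      using J[OF N(1)] by simp
  qed
  have "finite I" by (simp add: I_def)
  from laurent_pair_vanishing[OF pair zero this] obtain M G where "\<forall>q A. q \<noteq> 0 \<longrightarrow> A \<noteq> 0 \<longrightarrow>
      (q * A) ^ M * (state_sum d 0 D q A - state_sum d 0 D' q A :: complex) = (\<Prod>N\<in>I. A - q ^ N) * int_eval2 q A G"
    by auto
  hence MG: "(q * A) ^ M * (state_sum d 0 D q A - state_sum d 0 D' q A) = (\<Prod>N\<in>I. A - q ^ N) * int_eval2 q A G"
    if "A \<noteq> 0" for A using that q0 by simp
  have "inj_on (\<lambda>i. 2 * r * Suc i) {..<K}" using r by (auto simp: inj_on_def)
  hence "(\<Prod>N\<in>I. A - q ^ N) = (\<Prod>i<K. A - q ^ (2 * r * Suc i))" for A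
    unfolding I_def by (rule prod.reindex[unfolded o_def])
  also have "\<dots> A = (A - 1) ^ K" for A
    unfolding power_mult[of q "2 * r"] q by simp
  finally have prod: "(\<Prod>N\<in>I. A - q ^ N) = (A - 1) ^ K" for A .
  define G' where "G' = smult (inverse (q ^ M)) (map_poly (int_eval q) G)"
  have "A ^ M * (state_sum d 0 D q A - state_sum d 0 D' q A) = poly ([:- 1, 1:] ^ K * G') A" if "A \<noteq> 0" for A
  proof -
    have "q ^ M * (A ^ M * (state_sum d 0 D q A - state_sum d 0 D' q A)) = (A - 1) ^ K * int_eval2 q A G"
      using MG[OF that] prod[of A] by (simp add: power_mult_distrib mult.assoc)
    thus ?thesis using q0 by (simp add: G'_def int_eval2_def field_simps)
  qed
  thus ?thesis by blast
qed

lemma ado_state_sum_eq: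
  fixes q A :: complex
  assumes J: "\<And>N. 1 \<le> N \<Longrightarrow>
      state_sum (Suc N) 0 D (fls_X\<^sup>2) ((fls_X\<^sup>2) ^ N) = (state_sum (Suc N) 0 D' (fls_X\<^sup>2) ((fls_X\<^sup>2) ^ N) :: rat fls)"
    and D: "is_tangle [Up] D [Up]" "one_component [Up] D" "is_tangle [Up] D' [Up]" "one_component [Up] D'"
    and root: "0 < r" "q ^ r = - 1" "\<And>x. 0 < x \<Longrightarrow> x < r \<Longrightarrow> q ^ (2 * x) \<noteq> 1" and A: "A \<noteq> 0"
  shows "state_sum r (- int r) D q A = state_sum r (- int r) D' q A"
proof -
  let ?X = "\<lambda>D A. state_sum r (- int r) D q A"
  have q0: "q \<noteq> 0" using root_nonzero[OF root] A by simp
  have laurent: "\<exists>M p. \<forall>A. A \<noteq> 0 \<longrightarrow> A ^ M * state_sum d k D q A = poly p A"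
    if "q \<noteq> 0" for d k D and q :: complex
  proof -
    obtain P M where "\<forall>q A. q \<noteq> 0 \<longrightarrow> A \<noteq> 0 \<longrightarrow> (q * A) ^ M * state_sum d k D q A = int_eval2 q (A :: complex) P"
      using laurent_pair_state_sum[of d k D, where ?'a = complex and ?'b = complex] unfolding laurent_pair_def by auto
    hence P: "(q * A) ^ M * state_sum d k D q A = int_eval2 q A P" if "A \<noteq> 0" for A
      using \<open>q \<noteq> 0\<close> that by simp
    have "A ^ M * state_sum d k D q A = poly (smult (inverse (q ^ M)) (map_poly (int_eval q) P)) A" if "A \<noteq> 0" for A
      using P[OF that] \<open>q \<noteq> 0\<close> by (simp add: int_eval2_def power_mult_distrib field_simps)
    thus ?thesis by blast
  qed
  obtain m p where p: "\<And>A. A \<noteq> 0 \<Longrightarrow> A ^ m * ?X D A = poly p A" using laurent[OF q0] by blast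
  obtain m' p' where p': "\<And>A. A \<noteq> 0 \<Longrightarrow> A ^ m' * ?X D' A = poly p' A" using laurent[OF q0] by blast
  \<comment> \<open>The difference of the two ADO state sums, with the powers of A in both
    denominators cleared.\<close>
  define \<delta> where "\<delta> = monom 1 m' * p - monom 1 m * p'"
  have \<delta>: "poly \<delta> A = A ^ (m + m') * (?X D A - ?X D' A)" if "A \<noteq> 0" for A
    by (simp add: \<delta>_def poly_monom p[OF that, symmetric] p'[OF that, symmetric] power_add algebra_simps)
  have "\<delta> = 0"
  proof (rule ccontr)
    assume "\<delta> \<noteq> 0"
    \<comment> \<open>\<open>K\<close> exceeds the order of \<delta> at 1, which does not depend on
      the truncation; \<open>e\<close> is then just large enough for 2rK < re and, at q = -1, for 2K
      < e.\<close>
    define K where "K = Suc (order 1 \<delta>)"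
    define e where "e = 2 * K + 1"
    define L where "L D B = state_sum e 0 D (- 1 :: complex) B" for D B
    have "q ^ (2 * r) = 1" by (simp add: mult.commute[of 2] power_mult root(2))
    moreover have "2 * r * K < r * e" using root(1) by (simp add: e_def algebra_simps)
    ultimately have "\<exists>M Q. \<forall>A. A \<noteq> 0 \<longrightarrow>
        A ^ M * (state_sum (r * e) 0 D q A - state_sum (r * e) 0 D' q A) = poly ([:- 1, 1:] ^ K * Q) A"
      by (intro state_sum_agree_order[OF J D _ root(1)])
    then obtain M1 Q1 where "\<forall>A. A \<noteq> 0 \<longrightarrow>
        A ^ M1 * (state_sum (r * e) 0 D q A - state_sum (r * e) 0 D' q A) = poly ([:- 1, 1:] ^ K * Q1) A"
      by (elim exE)
    hence 1: "A ^ M1 * (state_sum (r * e) 0 D q A - state_sum (r * e) 0 D' q A) = poly ([:- 1, 1:] ^ K * Q1) A"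
      if "A \<noteq> 0" for A using that by (elim allE[of _ A]) (rule mp)
    have "\<exists>M Q. \<forall>A. A \<noteq> 0 \<longrightarrow> A ^ M * (L D A - L D' A) = poly ([:- 1, 1:] ^ K * Q) A"
      unfolding L_def by (rule state_sum_agree_order[OF J D, of _ 1]) (simp_all add: e_def)
    then obtain M2 Q2 where "\<forall>A. A \<noteq> 0 \<longrightarrow> A ^ M2 * (L D A - L D' A) = poly ([:- 1, 1:] ^ K * Q2) A"
      by (elim exE)
    hence 2: "A ^ M2 * (L D A - L D' A) = poly ([:- 1, 1:] ^ K * Q2) A"
      if "A \<noteq> 0" for A using that by (elim allE[of _ A]) (rule mp)
    have "\<exists>n l. \<forall>A. A \<noteq> 0 \<longrightarrow> A ^ n * L D A = poly l A"
      unfolding L_def by (rule laurent) simp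
    then obtain n l where "\<forall>A. A \<noteq> 0 \<longrightarrow> A ^ n * L D A = poly l A" by (elim exE)
    hence l: "A ^ n * L D A = poly l A" if "A \<noteq> 0" for A using that by (elim allE[of _ A]) (rule mp)
    have fac: "state_sum (r * e) 0 D q A = ?X D A * L D (A ^ r)" "state_sum (r * e) 0 D' q A = ?X D' A * L D' (A ^ r)"
      if "A \<noteq> 0" for A
      unfolding L_def using that
      by (simp_all add: state_sum_root[OF _ root] D state_sum_minus_one)
    \<comment> \<open>With X, X' the ADO sums and L, L' the second factors, (X - X') L = (X L - X'
      L') - X' (L - L'). Both brackets are multiples of (A - 1)^K up to powers of A, the last
      because B - 1 = A^r - 1 is divisible by A - 1. Clearing the powers of A turns the two sides
      into \<delta> U and (A - 1)^K V.\<close>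
    define U where "U = pcompose l (monom 1 r) * monom 1 (M1 + r * M2)"
    define V where "V = monom 1 (m + m' + r * (n + M2)) * Q1
      - monom 1 (m + M1 + r * n) * p' * (\<Sum>i<r. monom 1 i) ^ K * pcompose Q2 (monom 1 r)"
    have eq: "poly (\<delta> * U) A = poly ([:- 1, 1:] ^ K * V) A" if A: "A \<noteq> 0" for A
    proof -
      define B where "B = A ^ r"
      have B: "B \<noteq> 0" using A by (simp add: B_def)
      have "B - 1 = (A - 1) * (\<Sum>i<r. A ^ i)" unfolding B_def by (rule power_diff_1_eq)
      hence BK: "(B - 1) ^ K = (A - 1) ^ K * (\<Sum>i<r. A ^ i) ^ K" by (simp add: power_mult_distrib)
      have "poly (\<delta> * U) A = A ^ (m + m') * (?X D A - ?X D' A) * (B ^ n * L D B) * (A ^ M1 * B ^ M2)"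
        using \<delta>[OF A] l[OF B] by (simp add: U_def poly_pcompose poly_monom B_def power_add power_mult)
      also have "\<dots> = A ^ (m + m') * B ^ n * (B ^ M2 * (A ^ M1 * (?X D A * L D B - ?X D' A * L D' B)))
          - A ^ m * B ^ n * A ^ M1 * (A ^ m' * ?X D' A) * (B ^ M2 * (L D B - L D' B))"
        by (simp add: power_add algebra_simps)
      also have "\<dots> = A ^ (m + m') * B ^ n * (B ^ M2 * poly ([:- 1, 1:] ^ K * Q1) A)
          - A ^ m * B ^ n * A ^ M1 * poly p' A * poly ([:- 1, 1:] ^ K * Q2) B"
        unfolding p'[OF A] 2[OF B] 1[OF A, unfolded fac[OF A], folded B_def] ..
      also have "\<dots> = A ^ (m + m') * B ^ n * (B ^ M2 * ((A - 1) ^ K * poly Q1 A))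
          - A ^ m * B ^ n * A ^ M1 * poly p' A * ((B - 1) ^ K * poly Q2 B)" by simp
      also have "\<dots> = (A - 1) ^ K * (A ^ (m + m') * B ^ (n + M2) * poly Q1 A
          - A ^ (m + M1) * B ^ n * poly p' A * (\<Sum>i<r. A ^ i) ^ K * poly Q2 B)"
        unfolding BK by (simp only: power_add right_diff_distrib mult_ac)
      also have "\<dots> = poly ([:- 1, 1:] ^ K * V) A"
        by (simp add: V_def poly_pcompose poly_monom poly_sum B_def power_add power_mult)
      finally show ?thesis .
    qed
    \<comment> \<open>The extra factor A covers A = 0, where \<open>eq\<close> says nothing.\<close>
    have "poly ([:0, 1:] * (\<delta> * U - [:- 1, 1:] ^ K * V)) A = 0" for A
      using eq[of A] by (cases "A = 0") (simp_all only: poly_mult poly_diff, simp_all)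
    hence "[:0, 1:] * (\<delta> * U - [:- 1, 1:] ^ K * V) = 0" unfolding poly_all_0_iff_0[symmetric] by blast
    hence "\<delta> * U = [:- 1, 1:] ^ K * V" by simp
    hence dvd: "[:- 1, 1:] ^ K dvd \<delta> * U" by simp
    \<comment> \<open>\<open>U\<close> does not vanish at 1 and so contributes nothing to the order:
      this is where the value 1 of \<open>lstate_sum\<close> at 1 enters.\<close>
    have "poly U 1 = 1" using l[of 1] D(1,2)
      by (simp add: U_def poly_pcompose poly_monom L_def state_sum_minus_one lstate_sum_1 e_def)
    hence "order 1 U = 0" "U \<noteq> 0" by (auto intro: order_0I)
    moreover have "K \<le> order 1 (\<delta> * U)" using dvd \<open>\<delta> \<noteq> 0\<close> \<open>U \<noteq> 0\<close> order_divides[of 1 K "\<delta> * U"] by simp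
    ultimately show False using \<open>\<delta> \<noteq> 0\<close> by (simp add: order_mult K_def)
  qed
  thus ?thesis using \<delta>[OF A] A by simp
qed

section \<open>The primitive root of unity\<close>

lemma zeta_eq_cis: "zeta r = cis (pi / real r)"
  by (simp add: zeta_def cis_conv_exp)

lemma zeta_power: "zeta r ^ n = cis (real n * pi / real r)"
  by (simp add: zeta_eq_cis DeMoivre)

lemma zeta_power_r: "0 < r \<Longrightarrow> zeta r ^ r = - 1"
  by (simp add: zeta_power)

lemma zeta_primitive:
  assumes "0 < x" "x < r"
  shows "zeta r ^ (2 * x) \<noteq> 1"
proof
  assume "zeta r ^ (2 * x) = 1"
  hence "cos (real (2 * x) * pi / real r) = 1" unfolding zeta_power by (metis cis.simps(1) one_complex.simps(1))
  then consider n :: nat where "real (2 * x) * pi / real r = real n * 2 * pi"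
    | n :: nat where "real (2 * x) * pi / real r = - (real n * 2 * pi)"
    unfolding cos_one_2pi by blast
  thus False
  proof cases
    case 1
    hence "real x = real n * real r" using assms by (simp add: field_simps)
    hence "x = n * r" by (metis of_nat_eq_iff of_nat_mult)
    thus False using assms by (cases n) auto
  next
    case 2
    hence "pi * real x = pi * (- (real n * real r))" using assms by (simp add: field_simps)
    hence "real x = - (real n * real r)" unfolding mult_left_cancel[OF pi_neq_zero] .
    moreover have "0 \<le> real n * real r" by simp
    ultimately show False using assms by linarith
  qed
qed

lemma zeta_nonzero: "zeta r \<noteq> 0"
  by (simp add: zeta_def)

section \<open>Quantum factorials\<close>

lemma qint_Suc_gauss:
  fixes q :: "'a::field"
  assumes "q \<noteq> 0"
  shows "qint q (int (j + Suc m)) * q powi int j * gauss (q\<^sup>2) m j = qint q (int (Suc m)) * gauss (q\<^sup>2) (Suc m) j"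
proof -
  have brace: "qbrace q (int k) = q powi (- int k) * ((q\<^sup>2) ^ k - 1)" for k
    unfolding qbrace_def right_diff_distrib square_power
    by (subst powi_split[OF assms, of "int k" "- int k" "2 * int k"]) simp_all
  have "q powi (- int (j + Suc m)) * q powi int j = q powi (- int (Suc m))"
    by (rule powi_split[OF assms, symmetric]) simp
  moreover have "((q\<^sup>2) ^ (j + Suc m) - 1) * gauss (q\<^sup>2) m j = ((q\<^sup>2) ^ Suc m - 1) * gauss (q\<^sup>2) (Suc m) j"
    using gauss_absorb[of "q\<^sup>2" m j] by (simp add: algebra_simps del: power_Suc gauss.simps)
  moreover have "qbrace q (int (j + Suc m)) * q powi int j * gauss (q\<^sup>2) m j
      = (q powi (- int (j + Suc m)) * q powi int j) * (((q\<^sup>2) ^ (j + Suc m) - 1) * gauss (q\<^sup>2) m j)"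
    unfolding brace by (simp only: mult_ac)
  ultimately have "qbrace q (int (j + Suc m)) * q powi int j * gauss (q\<^sup>2) m j = qbrace q (int (Suc m)) * gauss (q\<^sup>2) (Suc m) j"
    unfolding brace[of "Suc m"] by (simp only: mult_ac)
  thus ?thesis by (simp add: qint_def)
qed

text \<open>The symmetric quantum binomial is the Gaussian one in base \<open>q\<^sup>2\<close> up
  to a power of \<open>q\<close>. Keeping [m]! on the right hand side avoids dividing by it, so no
  condition on the order of \<open>q\<close> arises.\<close>

lemma prod_qint_gauss:
  fixes q :: "'a::field"
  assumes "q \<noteq> 0"
  shows "(\<Prod>x<m. qint q (int j + int x + 1)) = qfact q m * (q powi (- (int m * int j)) * gauss (q\<^sup>2) m j)"
proof (induction m)
  case (Suc m)
  have "(\<Prod>x<Suc m. qint q (int j + int x + 1)) = qfact q m * (q powi (- (int m * int j)) * gauss (q\<^sup>2) m j) * qint q (int (j + Suc m))"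
    using Suc by (simp add: algebra_simps)
  also have "q powi (- (int m * int j)) = q powi (- (int (Suc m) * int j)) * q powi int j"
    by (rule powi_split[OF assms]) (simp add: algebra_simps)
  also have "qfact q m * (q powi (- (int (Suc m) * int j)) * q powi int j * gauss (q\<^sup>2) m j) * qint q (int (j + Suc m))
     = qfact q m * q powi (- (int (Suc m) * int j)) * (qint q (int (j + Suc m)) * q powi int j * gauss (q\<^sup>2) m j)"
    by (simp only: mult_ac)
  also have "\<dots> = qfact q (Suc m) * (q powi (- (int (Suc m) * int j)) * gauss (q\<^sup>2) (Suc m) j)"
    unfolding qint_Suc_gauss[OF assms] by (simp add: qfact_def mult_ac del: gauss.simps)
  finally show ?case .
qed (simp add: qfact_def)

lemma qfact_add: "qfact q (m + j) = qfact q j * (\<Prod>x<m. qint q (int j + int x + 1))"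
  by (induction m) (simp_all add: qfact_def add_ac mult_ac)

lemma qint_nonzero:
  fixes q :: "'a::field"
  assumes "q \<noteq> 0" "q ^ 2 \<noteq> 1" "q ^ (2 * k) \<noteq> 1"
  shows "qint q (int k) \<noteq> 0"
proof -
  have "qbrace q (int l) \<noteq> 0" if "q ^ (2 * l) \<noteq> 1" for l
  proof
    assume "qbrace q (int l) = 0"
    hence "q powi int l = q powi (- int l)" by (simp add: qbrace_def)
    hence "q powi int l * q powi int l = q powi int l * q powi (- int l)" by simp
    also have "\<dots> = 1" using assms(1) by (simp add: power_int_minus)
    finally show False using that by (simp add: mult_2 power_add)
  qed
  from this[of 1] this[of k] assms show ?thesis by (simp add: qint_def)
qed

lemma qfact_nonzero:
  fixes q :: "'a::field"
  assumes "q \<noteq> 0" "\<And>x. 0 < x \<Longrightarrow> x \<le> m \<Longrightarrow> q ^ (2 * x) \<noteq> 1"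
  shows "qfact q m \<noteq> 0"
proof (cases "m = 0")
  case False
  hence "q ^ 2 \<noteq> 1" using assms(2)[of 1] by simp
  thus ?thesis using qint_nonzero[OF assms(1)] assms(2) by (auto simp: qfact_def)
qed (simp add: qfact_def)

lemma qbinom_gauss:
  fixes q :: "'a::field"
  assumes "q \<noteq> 0" "\<And>x. 0 < x \<Longrightarrow> x \<le> m + j \<Longrightarrow> q ^ (2 * x) \<noteq> 1"
  shows "qbinom q (m + j) m = q powi (- (int m * int j)) * gauss (q\<^sup>2) m j"
proof -
  have "qfact q m \<noteq> 0" "qfact q j \<noteq> 0"
    by (rule qfact_nonzero[OF assms(1)]; use assms(2) in simp)+
  thus ?thesis by (simp add: qbinom_def qfact_add[of q m j] prod_qint_gauss[OF assms(1)])
qed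

abbreviation falling :: "'a::field \<Rightarrow> 'a \<Rightarrow> nat \<Rightarrow> nat \<Rightarrow> 'a" where
  "falling q A j m \<equiv> (\<Prod>x<m. q powi (- int j - int x) * A - q powi (int j + int x) * inverse A)"

text \<open>Each factor {\<alpha> - j - x} is A q^(-j-x) (1 - q^(2(j+x)) A^(-2)). The powers q^(-x)
  multiply to q^(-m(m-1)/2), which is exactly cancelled by the power of q in the R-matrix.\<close>

lemma th_eq_falling:
  fixes q A :: "'a::field"
  assumes q: "q \<noteq> 0" and A: "A \<noteq> 0"
  shows "th q A m j = A powi (- int m) * q ^ (m * (m - 1) div 2) * (q powi (- (int m * int j)) * gauss (q\<^sup>2) m j)
      * falling q A j m"
proof -
  have "q ^ (m * (m - 1) div 2) * falling q A j m
      = A ^ m * q powi (- (int m * int j)) * (\<Prod>x<m. 1 - q ^ (2 * (j + x)) * A powi (- 2))"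
  proof (induction m)
    case (Suc m)
    have tri: "Suc m * (Suc m - 1) div 2 = m * (m - 1) div 2 + m"
      by (cases m) (auto simp: algebra_simps)
    have "q ^ m * (q powi (- int j - int m) * A - q powi (int j + int m) * inverse A)
       = A * q powi (- int j) * (1 - q ^ (2 * (j + m)) * A powi (- 2))"
    proof -
      have 1: "q powi (- int j) = q powi int m * q powi (- int j - int m)" by (rule powi_split[OF q]) simp
      have 2: "q powi int m * q powi (int j + int m) = q powi (- int j) * q powi int (2 * (j + m))"
        by (rule powi_mult_eq[OF q]) simp
      have 3: "inverse A = A * A powi (- 2)" using A by (simp add: power_int_minus power2_eq_square)
      have "q ^ m * (q powi (- int j - int m) * A - q powi (int j + int m) * inverse A)
        = A * (q powi int m * q powi (- int j - int m)) - (q powi int m * q powi (int j + int m)) * (A * A powi (- 2))"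
        unfolding 3 power_int_of_nat by (simp only: algebra_simps)
      also have "\<dots> = A * q powi (- int j) - q powi (- int j) * q ^ (2 * (j + m)) * (A * A powi (- 2))"
        unfolding 2 1[symmetric] unfolding power_int_of_nat ..
      finally show ?thesis by (simp add: algebra_simps)
    qed
    note step = this
    have "q ^ (Suc m * (Suc m - 1) div 2) * falling q A j (Suc m)
      = (q ^ (m * (m - 1) div 2) * falling q A j m)
        * (q ^ m * (q powi (- int j - int m) * A - q powi (int j + int m) * inverse A))"
      unfolding tri power_add prod.lessThan_Suc by (simp only: mult_ac)
    also have "\<dots> = A ^ m * q powi (- (int m * int j)) * (\<Prod>x<m. 1 - q ^ (2 * (j + x)) * A powi (- 2))
        * (A * q powi (- int j) * (1 - q ^ (2 * (j + m)) * A powi (- 2)))" unfolding Suc step ..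
    also have "\<dots> = A ^ Suc m * (q powi (- (int m * int j)) * q powi (- int j)) * (\<Prod>x<Suc m. 1 - q ^ (2 * (j + x)) * A powi (- 2))"
      unfolding prod.lessThan_Suc power_Suc by (simp only: mult_ac)
    also have "q powi (- (int m * int j)) * q powi (- int j) = q powi (- (int (Suc m) * int j))"
      by (rule powi_split[OF q, symmetric]) (simp add: algebra_simps)
    finally show ?case .
  qed simp
  note falling = this
  have q2: "q powi (- 2 * int m * int j) = q powi (- (int m * int j)) * q powi (- (int m * int j))"
    by (rule powi_split[OF q]) simp
  have "A powi (- int m) * q ^ (m * (m - 1) div 2) * (q powi (- (int m * int j)) * gauss (q\<^sup>2) m j)
      * falling q A j m
    = A powi (- int m) * (q powi (- (int m * int j)) * gauss (q\<^sup>2) m j) *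
      (q ^ (m * (m - 1) div 2) * falling q A j m)"
    by (simp only: mult_ac)
  also have "\<dots> = (A powi (- int m) * A ^ m) * th q A m j"
    unfolding falling th_def q2 by (simp only: mult_ac)
  also have "A powi (- int m) * A ^ m = 1" using A by (simp add: power_int_minus)
  finally show ?thesis by simp
qed

section \<open>From Reshetikhin-Turaev data to crossing weights\<close>

lemma piece_op_eq_wt:
  "piece_op T = wt (\<lambda>a b i j. Rmat T (b, a) (i, j)) (\<lambda>a b i j. Rinv T (a, b) (j, i)) (pivotal T) (pivotal_inv T)"
proof (intro ext)
  fix e z x
  show "piece_op T e z x = wt (\<lambda>a b i j. Rmat T (b, a) (i, j)) (\<lambda>a b i j. Rinv T (a, b) (j, i)) (pivotal T) (pivotal_inv T) e z x"
    by (cases "(T, e, z, x)" rule: piece_op.cases) auto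
qed

text \<open>A two-sided inverse is unique: S' = S' (R S) = (S' R) S = S. So the choice made in
  \<open>Rinv\<close> agrees, on labels in range, with any inverse written down explicitly.\<close>

lemma Rinv_eqI:
  fixes T :: "'a::comm_ring_1 rt_data"
  defines "I \<equiv> {..<rt_dim T} \<times> {..<rt_dim T}"
  assumes S: "\<And>x y. x \<in> I \<Longrightarrow> y \<in> I \<Longrightarrow> (\<Sum>z\<in>I. Rmat T x z * S z y) = (if x = y then 1 else 0)"
    "\<And>x y. x \<in> I \<Longrightarrow> y \<in> I \<Longrightarrow> (\<Sum>z\<in>I. S x z * Rmat T z y) = (if x = y then 1 else 0)"
    and xy: "x \<in> I" "y \<in> I"
  shows "Rinv T x y = S x y"
proof -
  let ?P = "\<lambda>S. \<forall>x\<in>I. \<forall>y\<in>I. (\<Sum>z\<in>I. Rmat T x z * S z y) = (if x = y then 1 else 0) \<and>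
       (\<Sum>z\<in>I. S x z * Rmat T z y) = (if x = y then 1 else 0)"
  have fin: "finite I" by (simp add: I_def)
  have "Rinv T = Eps ?P" by (simp add: Rinv_def I_def Let_def)
  moreover have "?P S" using S by simp
  hence "?P (Eps ?P)" by (rule someI[of ?P])
  ultimately have inv: "?P (Rinv T)" by (simp only:)
  have "Rinv T x y = (\<Sum>z\<in>I. Rinv T x z * (if z = y then 1 else 0))"
    using xy fin by (simp add: if_distrib cong: if_cong)
  also have "\<dots> = (\<Sum>z\<in>I. Rinv T x z * (\<Sum>w\<in>I. Rmat T z w * S w y))"
    by (rule sum.cong[OF refl]) (use S(1) xy in simp)
  also have "\<dots> = (\<Sum>w\<in>I. (\<Sum>z\<in>I. Rinv T x z * Rmat T z w) * S w y)"
    unfolding sum_distrib_left sum_distrib_right by (subst sum.swap) (simp only: mult.assoc)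
  also have "\<dots> = (\<Sum>w\<in>I. (if x = w then 1 else 0) * S w y)"
    by (rule sum.cong[OF refl]) (use inv xy in simp)
  also have "\<dots> = S x y" using xy fin by (simp add: if_distrib[where f = "\<lambda>c. c * _"] cong: if_cong)
  finally show ?thesis .
qed

text \<open>\<open>P\<close> is R followed by the flip, so its inverse is the flip followed by the
  inverse of R; this explains the exchanged pairs \<open>(b, a)\<close> and
  \<open>(j, i)\<close>.\<close>

lemma Rinv_crossing:
  fixes T :: "'a::comm_ring_1 rt_data"
  defines "d \<equiv> rt_dim T"
  assumes R: "\<And>a b i j. a < d \<Longrightarrow> b < d \<Longrightarrow> i < d \<Longrightarrow> j < d \<Longrightarrow> Rmat T (b, a) (i, j) = P a b i j"
    and inv: "\<And>a b i j. a < d \<Longrightarrow> b < d \<Longrightarrow> i < d \<Longrightarrow> j < d \<Longrightarrow>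
        (\<Sum>c<d. \<Sum>e<d. P a b c e * N c e i j) = (if a = i \<and> b = j then 1 else 0)"
      "\<And>a b i j. a < d \<Longrightarrow> b < d \<Longrightarrow> i < d \<Longrightarrow> j < d \<Longrightarrow>
        (\<Sum>c<d. \<Sum>e<d. N a b c e * P c e i j) = (if a = i \<and> b = j then 1 else 0)"
    and lt: "a < d" "b < d" "i < d" "j < d"
  shows "Rinv T (a, b) (j, i) = N a b i j"
proof -
  define S where "S = (\<lambda>x y. N (fst x) (snd x) (snd y) (fst y))"
  have pairs: "(\<Sum>z\<in>{..<d} \<times> {..<d}. F z) = (\<Sum>c<d. \<Sum>e<d. F (c, e))" for F :: "nat \<times> nat \<Rightarrow> 'a"
    by (simp add: sum.cartesian_product)
  have "Rinv T (a, b) (j, i) = S (a, b) (j, i)"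
  proof (rule Rinv_eqI; fold d_def)
    fix x y assume "x \<in> {..<d} \<times> {..<d}" "y \<in> {..<d} \<times> {..<d}"
    then obtain k l i j where xy: "x = (k, l)" "y = (i, j)" "k < d" "l < d" "i < d" "j < d" by auto
    have "(\<Sum>z\<in>{..<d} \<times> {..<d}. Rmat T x z * S z y) = (\<Sum>c<d. \<Sum>e<d. P l k c e * N c e j i)"
      unfolding pairs by (intro sum.cong refl) (simp add: xy R S_def)
    also have "\<dots> = (if x = y then 1 else 0)" by (subst inv(1)) (use xy in auto)
    finally show "(\<Sum>z\<in>{..<d} \<times> {..<d}. Rmat T x z * S z y) = (if x = y then 1 else 0)" .
    have "(\<Sum>z\<in>{..<d} \<times> {..<d}. S x z * Rmat T z y) = (\<Sum>e<d. \<Sum>c<d. N k l c e * P c e i j)"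
      unfolding pairs by (intro sum.cong refl) (simp add: xy R S_def)
    also have "\<dots> = (\<Sum>c<d. \<Sum>e<d. N k l c e * P c e i j)" by (rule sum.swap)
    also have "\<dots> = (if x = y then 1 else 0)" by (subst inv(2)) (use xy in auto)
    finally show "(\<Sum>z\<in>{..<d} \<times> {..<d}. S x z * Rmat T z y) = (if x = y then 1 else 0)" .
  qed (use lt in auto)
  thus ?thesis by (simp add: S_def)
qed

lemma rt_scalar_eqI:
  assumes "0 < rt_dim T"
    "\<And>i j. i < rt_dim T \<Longrightarrow> j < rt_dim T \<Longrightarrow> rt_op T [Up] D [j] [i] = (if j = i then c else 0)"
  shows "rt_scalar T D = c"
  unfolding rt_scalar_def
proof (rule the_equality)
  fix c' assume "\<forall>i<rt_dim T. \<forall>j<rt_dim T. rt_op T [Up] D [j] [i] = (if j = i then c' else 0)"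
  hence "rt_op T [Up] D [0] [0] = c'" using assms(1) by auto
  thus "c' = c" using assms(2)[of 0 0] assms(1) by simp
qed (use assms in auto)

lemma mat_pow_shift:
  assumes "k < d" "i < d"
  shows "mat_pow d (\<lambda>j i. if i = Suc j then 1 else 0) m k i = (if i = k + m then 1 else 0 :: 'a::comm_ring_1)"
  using assms(1)
proof (induction m arbitrary: k)
  case (Suc m)
  have "mat_pow d (\<lambda>j i. if i = Suc j then 1 else 0) (Suc m) k i
     = (\<Sum>k'<d. if k' = Suc k then mat_pow d (\<lambda>j i. if i = Suc j then 1 else 0) m k' i else 0 :: 'a)"
    unfolding mat_pow.simps by (rule sum.cong) auto
  also have "\<dots> = (if i = k + Suc m then 1 else 0)"
    using Suc.IH[of "Suc k"] assms(2) by (cases "Suc k < d") auto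
  finally show ?case .
qed auto

section \<open>The modules defining the colored Jones polynomials\<close>

context
  fixes s :: "'a::field" and n :: nat
  assumes s: "s \<noteq> 0" and gen: "\<And>x. 0 < x \<Longrightarrow> (s\<^sup>2) ^ (2 * x) \<noteq> 1"
begin

lemma mat_pow_jones_F:
  assumes "l < n + 1" "j < n + 1"
  shows "mat_pow (n + 1) (jones_F (s\<^sup>2) n) m l j =
    (if l = j + m then \<Prod>x<m. qint (s\<^sup>2) (int j + int x + 1) * qint (s\<^sup>2) (int n - int j - int x) else 0)"
  using assms(1)
proof (induction m arbitrary: l)
  case (Suc m)
  have "mat_pow (n + 1) (jones_F (s\<^sup>2) n) (Suc m) l j
     = (\<Sum>k<n + 1. if l = Suc k then qint (s\<^sup>2) (int k + 1) * qint (s\<^sup>2) (int n - int k) * mat_pow (n + 1) (jones_F (s\<^sup>2) n) m k j else 0)"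
    unfolding mat_pow.simps by (rule sum.cong) (auto simp: jones_F_def)
  also have "\<dots> = (if l = j + Suc m then \<Prod>x<Suc m. qint (s\<^sup>2) (int j + int x + 1) * qint (s\<^sup>2) (int n - int j - int x) else 0)"
  proof (cases l)
    case (Suc k)
    thus ?thesis using Suc.IH[of k] Suc.prems by (auto simp: algebra_simps)
  qed auto
  finally show ?case .
qed auto

text \<open>The module of dimension n + 1 sits in the Verma module at A = q^n. From (n - 2a)(n - 2b)
  = n^2 - 2n(a + b) + 4ab the diagonal part is s^(n^2) A^(-(a+b)) q^(2ab), and the factor {1}^m
  turns the quantum integers [n - j - x] into {n - j - x}.\<close>

lemma jones_R_eq:
  assumes "a < n + 1" "b < n + 1" "i < n + 1" "j < n + 1"
  shows "jones_R s n (b, a) (i, j) = s powi (int n * int n) * cpos (s\<^sup>2) ((s\<^sup>2) ^ n) a b i j"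
proof -
  define q A where "q = s\<^sup>2" and "A = q ^ n"
  have q: "q \<noteq> 0" and A: "A \<noteq> 0" using s by (simp_all add: q_def A_def)
  have E: "jones_E = (\<lambda>j i. if i = Suc j then 1 else 0 :: 'a)" by (intro ext) (simp add: jones_E_def)
  define f where "f m = qbrace q 1 ^ m * q ^ (m * (m - 1) div 2) / qfact q m
      * (\<Prod>x<m. qint q (int j + int x + 1) * qint q (int n - int j - int x))" for m
  have R: "jones_R s n (b, a) (i, j) = s powi (jones_weight n b * jones_weight n a) *
      (\<Sum>m\<le>n. if i = b + m \<and> a = j + m then f m else 0)"
    unfolding jones_R_def prod.case E mat_pow_shift[OF assms(2,3)] mat_pow_jones_F[OF assms(1,4)]
    by (intro arg_cong2[of _ _ _ _ "(*)"] refl sum.cong) (simp add: f_def q_def)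
  show ?thesis
  proof (cases "j \<le> a \<and> a + b = i + j")
    case True
    define m where "m = a - j"
    have m: "a = j + m" "i = b + m" using True by (auto simp: m_def)
    have "(\<Sum>l\<le>n. if i = b + l \<and> a = j + l then f l else 0) = (\<Sum>l\<le>n. if l = m then f l else 0)"
      by (rule sum.cong[OF refl]) (use m in auto)
    also have "\<dots> = f m" using m assms by simp
    also have "f m = A powi int m * th q A m j"
    proof -
      have nz: "qfact q m \<noteq> 0" "qbrace q 1 \<noteq> 0"
      proof -
        show "qfact q m \<noteq> 0" by (rule qfact_nonzero[OF q]) (use gen in \<open>simp add: q_def\<close>)
        have "qint q (int 1) \<noteq> 0" by (rule qint_nonzero[OF q]) (use gen[of 1] in \<open>simp_all add: q_def\<close>)
        thus "qbrace q 1 \<noteq> 0" by (auto simp: qint_def)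
      qed
      have br: "qbrace q (int n - int j - int x) = q powi (- int j - int x) * A - q powi (int j + int x) * inverse A" for x
      proof -
        have "q powi (int n - int j - int x) = q powi (- int j - int x) * q powi int n"
          by (rule powi_split[OF q]) simp
        moreover have "q powi (- (int n - int j - int x)) = q powi (int j + int x) * q powi (- int n)"
          by (rule powi_split[OF q]) simp
        ultimately show ?thesis by (simp add: qbrace_def A_def power_int_minus)
      qed
      have "qbrace q 1 ^ m * (\<Prod>x<m. qint q (int n - int j - int x)) = (\<Prod>x<m. qbrace q 1 * qint q (int n - int j - int x))"
        by (simp add: prod.distrib)
      also have "\<dots> = falling q A j m"
        by (rule prod.cong[OF refl]) (use nz in \<open>simp add: qint_def br\<close>)
      finally have fal: "qbrace q 1 ^ m * (\<Prod>x<m. qint q (int n - int j - int x))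
          = falling q A j m" .
      have "f m = (qbrace q 1 ^ m * (\<Prod>x<m. qint q (int n - int j - int x))) * q ^ (m * (m - 1) div 2)
          * (q powi (- (int m * int j)) * gauss (q\<^sup>2) m j)"
        unfolding f_def prod.distrib prod_qint_gauss[OF q] using nz(1) by simp
      also have "\<dots> = (A powi int m * A powi (- int m)) * q ^ (m * (m - 1) div 2) * (q powi (- (int m * int j)) * gauss (q\<^sup>2) m j)
          * falling q A j m"
        unfolding fal using A by (simp add: power_int_minus)
      also have "\<dots> = A powi int m * th q A m j" unfolding th_eq_falling[OF q A] by (simp only: mult_ac)
      finally show ?thesis .
    qed
    finally have sum: "(\<Sum>l\<le>n. if i = b + l \<and> a = j + l then f l else 0) = A powi int m * th q A m j" .
    have "s powi (jones_weight n b * jones_weight n a) =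
      s powi (int n * int n) * (A powi (- (int a + int b)) * q powi (2 * int a * int b))"
    proof -
      have Aq: "A powi x = s powi (2 * int n * x)" "q powi x = s powi (2 * x)" for x
        by (simp_all add: A_def q_def power_int_power power_mult[symmetric])
      show ?thesis unfolding Aq mult.assoc[symmetric]
        by (rule powi_mult3_eq[OF s, symmetric]) (simp add: jones_weight_def algebra_simps)
    qed
    moreover have "A powi (- (int a + int b)) * A powi int m = A powi (- (int j + int b))"
      by (rule powi_split[OF A, symmetric]) (simp add: m)
    ultimately show ?thesis unfolding R sum using True
      by (simp add: cpos_def m_def q_def[symmetric] A_def[symmetric] mult_ac)
  next
    case False
    have "(\<Sum>m\<le>n. if i = b + m \<and> a = j + m then f m else 0) = 0"
      by (rule sum.neutral) (use False in auto)
    moreover have "cpos (s\<^sup>2) ((s\<^sup>2) ^ n) a b i j = 0" unfolding cpos_def by (rule if_not_P[OF False])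
    ultimately show ?thesis unfolding R by simp
  qed
qed

lemma jones_Rinv_eq:
  assumes "a < n + 1" "b < n + 1" "i < n + 1" "j < n + 1"
  shows "Rinv (jones_data s n) (a, b) (j, i) = inverse (s powi (int n * int n)) * cneg (s\<^sup>2) ((s\<^sup>2) ^ n) a b i j"
proof -
  define q A t where "q = s\<^sup>2" and "A = q ^ n" and "t = s powi (int n * int n)"
  have q: "q \<noteq> 0" and A: "A \<noteq> 0" and t: "t \<noteq> 0" using s by (simp_all add: q_def A_def t_def)
  have gen': "q ^ (2 * x) \<noteq> 1" if "0 < x" for x using gen[OF that] by (simp add: q_def)
  have dim: "rt_dim (jones_data s n) = n + 1" by (simp add: jones_data_def)
  have cancel: "t * x * (inverse t * y) = x * y" "inverse t * x * (t * y) = x * y" for x y using t by simp_all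
  have "Rinv (jones_data s n) (a, b) (j, i) = inverse t * cneg q A a b i j"
  proof (rule Rinv_crossing[where P = "\<lambda>a b i j. t * cpos q A a b i j" and N = "\<lambda>a b i j. inverse t * cneg q A a b i j"];
      (unfold dim cancel)?)
    fix a b i j assume lt: "a < n + 1" "b < n + 1" "i < n + 1" "j < n + 1"
    show "Rmat (jones_data s n) (b, a) (i, j) = t * cpos q A a b i j"
      using jones_R_eq[OF lt] by (simp add: jones_data_def q_def A_def t_def)
    show "(\<Sum>c<n + 1. \<Sum>e<n + 1. cpos q A a b c e * cneg q A c e i j) = (if a = i \<and> b = j then 1 else 0)"
      by (rule cpos_cneg_inverse[OF q A gen' lt])
    show "(\<Sum>c<n + 1. \<Sum>e<n + 1. cneg q A a b c e * cpos q A c e i j) = (if a = i \<and> b = j then 1 else 0)"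
      by (rule cneg_cpos_inverse[OF q A gen' lt])
  qed (use assms in simp_all)
  thus ?thesis by (simp add: q_def A_def t_def)
qed

lemma rt_scalar_jones_data:
  assumes D: "is_tangle [Up] D [Up]" "writhe D = 0"
  shows "rt_scalar (jones_data s n) D = state_sum (Suc n) 0 D (s\<^sup>2) ((s\<^sup>2) ^ n)"
proof (rule rt_scalar_eqI)
  define q A t where "q = s\<^sup>2" and "A = q ^ n" and "t = s powi (int n * int n)"
  have q: "q \<noteq> 0" and A: "A \<noteq> 0" and t: "t \<noteq> 0" using s by (simp_all add: q_def A_def t_def)
  fix i j assume ij: "i < rt_dim (jones_data s n)" "j < rt_dim (jones_data s n)"
  have dim: "rt_dim (jones_data s n) = n + 1" by (simp add: jones_data_def)
  have piv: "q powi jones_weight n i = 1 * (A * q powi (- 2 * int i))"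
     "q powi (- jones_weight n i) = inverse (1 * (A * q powi (- 2 * int i)))" for i
  proof -
    have "q powi jones_weight n i = q powi int n * q powi (- 2 * int i)"
      by (rule powi_split[OF q]) (simp add: jones_weight_def)
    thus 1: "q powi jones_weight n i = 1 * (A * q powi (- 2 * int i))" by (simp add: A_def)
    show "q powi (- jones_weight n i) = inverse (1 * (A * q powi (- 2 * int i)))"
      unfolding 1[symmetric] by (rule power_int_minus)
  qed
  have "rt_op (jones_data s n) [Up] D [j] [i] = pull_diagram (n + 1) (piece_op (jones_data s n)) D (entry [j]) [i]"
    using ij dim by (subst rt_op_eq_pull_diagram[OF D(1)]) (auto simp: index_lists_def)
  also have "\<dots> = pull_diagram (n + 1) (wt (\<lambda>a b i j. t * cpos q A a b i j) (\<lambda>a b i j. inverse t * cneg q A a b i j)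
      (\<lambda>i. 1 * (A * q powi (- 2 * int i))) (\<lambda>i. inverse (1 * (A * q powi (- 2 * int i))))) D (entry [j]) [i]"
  proof (rule pull_diagram_cong[OF D(1)])
    fix e z x assume zx: "z \<in> index_lists (n + 1) (length (tgt e))" "x \<in> index_lists (n + 1) (length (src e))"
    show "piece_op (jones_data s n) e z x = wt (\<lambda>a b i j. t * cpos q A a b i j) (\<lambda>a b i j. inverse t * cneg q A a b i j)
      (\<lambda>i. 1 * (A * q powi (- 2 * int i))) (\<lambda>i. inverse (1 * (A * q powi (- 2 * int i)))) e z x"
      unfolding piv[symmetric] piece_op_eq_wt using zx
      by (cases e) (auto simp: index_lists_def length_Suc_conv jones_Rinv_eq jones_R_eq q_def A_def t_def,
        auto simp: jones_data_def jones_R_eq power_int_minus)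
  qed (use ij dim in \<open>auto simp: index_lists_def\<close>)
  also have "\<dots> = pull_diagram (n + 1) (weights q A 1) D (entry [j]) [i]"
    unfolding pull_diagram_writhe[OF t] D(2) by simp
  \<comment> \<open>Dimension n + 1 fits A = q^n: no F^(m) leads from a label at most n to n +
    1.\<close>
  also have "\<dots> = (if j = i then pull_diagram (n + 1) (weights q A 1) D (entry [0]) [0] else 0)"
    by (rule pull_diagram_scalar[OF D(1) q A]) (use ij dim th_power_eq_0[OF q] in \<open>auto simp: A_def\<close>)
  finally show "rt_op (jones_data s n) [Up] D [j] [i] = (if j = i then state_sum (Suc n) 0 D (s\<^sup>2) ((s\<^sup>2) ^ n) else 0)"
    by (simp add: state_sum_def q_def A_def)
qed (simp add: jones_data_def)

end

lemma colored_jones_eq_state_sum: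
  assumes "is_tangle [Up] D [Up]" "writhe D = 0"
  shows "colored_jones n D = state_sum (Suc n) 0 D (fls_X\<^sup>2) ((fls_X\<^sup>2) ^ n)"
  unfolding colored_jones_def
proof (rule rt_scalar_jones_data[OF _ _ assms])
  fix x :: nat assume x: "0 < x"
  have "fls_nth ((fls_X :: rat fls) ^ (2 * (2 * x))) 0 = 0" using x by simp
  hence "(fls_X :: rat fls) ^ (2 * (2 * x)) \<noteq> 1" by (metis fls_one_nth zero_neq_one)
  thus "((fls_X :: rat fls)\<^sup>2) ^ (2 * x) \<noteq> 1" by (subst power_mult[symmetric])
qed simp

section \<open>Evaluating the ADO ring\<close>

text \<open>The crossing identities are proved over fields, and \<open>ado_ring\<close> is not one.
  Its elements are therefore compared through their values at nonzero complex arguments.\<close>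

definition laurent_eval :: "('a::comm_ring_1 \<Rightarrow> 'b::field) \<Rightarrow> 'b \<Rightarrow> (int \<Rightarrow>\<^sub>0 'a) \<Rightarrow> 'b" where
  "laurent_eval h u f = (\<Sum>k\<in>Poly_Mapping.keys f. h (Poly_Mapping.lookup f k) * u powi k)"

context
  fixes h :: "'a::comm_ring_1 \<Rightarrow> 'b::field" and u :: 'b
  assumes h_0: "h 0 = 0" and h_1: "h 1 = 1" and h_add: "\<And>x y. h (x + y) = h x + h y"
    and h_mult: "\<And>x y. h (x * y) = h x * h y" and u: "u \<noteq> 0"
begin

lemma laurent_eval_superset:
  assumes "finite S" "Poly_Mapping.keys f \<subseteq> S"
  shows "laurent_eval h u f = (\<Sum>k\<in>S. h (Poly_Mapping.lookup f k) * u powi k)"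
  unfolding laurent_eval_def
  by (rule sum.mono_neutral_left) (use assms in \<open>auto simp: in_keys_iff h_0\<close>)

lemma laurent_eval_0: "laurent_eval h u 0 = 0"
  by (simp add: laurent_eval_def)

lemma laurent_eval_add: "laurent_eval h u (f + g) = laurent_eval h u f + laurent_eval h u g"
proof -
  let ?S = "Poly_Mapping.keys f \<union> Poly_Mapping.keys g"
  have "laurent_eval h u (f + g) = (\<Sum>k\<in>?S. h (Poly_Mapping.lookup (f + g) k) * u powi k)"
    by (rule laurent_eval_superset) (auto simp: in_keys_iff lookup_add)
  also have "\<dots> = (\<Sum>k\<in>?S. h (Poly_Mapping.lookup f k) * u powi k) + (\<Sum>k\<in>?S. h (Poly_Mapping.lookup g k) * u powi k)"
    by (simp add: lookup_add h_add distrib_right sum.distrib)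
  also have "\<dots> = laurent_eval h u f + laurent_eval h u g"
    by (subst (1 2) laurent_eval_superset[of ?S]) auto
  finally show ?thesis .
qed

lemma laurent_eval_single: "laurent_eval h u (Poly_Mapping.single k c) = h c * u powi k"
  by (cases "c = 0") (simp_all add: laurent_eval_def h_0)

lemma laurent_eval_1: "laurent_eval h u 1 = 1"
  using laurent_eval_single[of 0 1] by (simp add: h_1)

lemma laurent_eval_sum: "laurent_eval h u (\<Sum>i\<in>I. f i) = (\<Sum>i\<in>I. laurent_eval h u (f i))"
  by (induction I rule: infinite_finite_induct) (simp_all add: laurent_eval_0 laurent_eval_add)

lemma sum_singles: "(\<Sum>k\<in>Poly_Mapping.keys f. Poly_Mapping.single k (Poly_Mapping.lookup f k)) = f"
  by (rule poly_mapping_eqI)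
     (auto simp: Poly_Mapping.lookup_sum lookup_single when_def in_keys_iff)

lemma laurent_eval_mult: "laurent_eval h u (f * g) = laurent_eval h u f * laurent_eval h u g"
proof -
  have "f * g = (\<Sum>k\<in>Poly_Mapping.keys f. \<Sum>l\<in>Poly_Mapping.keys g.
      Poly_Mapping.single (k + l) (Poly_Mapping.lookup f k * Poly_Mapping.lookup g l))"
    by (subst (1) sum_singles[of f, symmetric], subst (1) sum_singles[of g, symmetric])
       (simp add: sum_product mult_single)
  also have "laurent_eval h u \<dots> = (\<Sum>k\<in>Poly_Mapping.keys f. \<Sum>l\<in>Poly_Mapping.keys g.
      (h (Poly_Mapping.lookup f k) * u powi k) * (h (Poly_Mapping.lookup g l) * u powi l))"
    unfolding laurent_eval_sum laurent_eval_single h_mult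
    by (intro sum.cong refl) (simp add: power_int_add u mult_ac)
  also have "\<dots> = laurent_eval h u f * laurent_eval h u g"
    by (simp add: laurent_eval_def sum_product)
  finally show ?thesis .
qed

end

lemma laurent_coeffs_eq_0:
  fixes c :: "int \<Rightarrow> complex"
  assumes S: "finite S" and 0: "\<And>u. u \<noteq> 0 \<Longrightarrow> (\<Sum>k\<in>S. c k * u powi k) = 0" and k: "k \<in> S"
  shows "c k = 0"
proof -
  \<comment> \<open>Adding \<open>m\<close> makes all exponents in \<open>S\<close> nonnegative, so
    that a polynomial results.\<close>
  define m where "m = (\<Sum>k\<in>S. \<bar>k\<bar>)"
  have m: "0 \<le> l + m" if "l \<in> S" for l
    using member_le_sum[of l S abs] that S unfolding m_def by force
  define p where "p = (\<Sum>l\<in>S. monom (c l) (nat (l + m)))"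
  have "poly p u = 0" if "u \<noteq> 0" for u
  proof -
    have "poly p u = (\<Sum>l\<in>S. c l * u powi l) * u powi m"
      unfolding p_def poly_sum poly_monom sum_distrib_right
      by (rule sum.cong[OF refl]) (use m that in \<open>simp add: power_int_add power_int_def[symmetric] mult.assoc flip: power_int_of_nat\<close>)
    thus ?thesis using 0[OF that] by simp
  qed
  hence "poly ([:0, 1:] * p) u = 0" for u by (cases "u = 0") auto
  hence "[:0, 1:] * p = 0" unfolding poly_all_0_iff_0[symmetric] by blast
  hence "p = 0" by simp
  hence "0 = coeff p (nat (k + m))" by simp
  also have "\<dots> = (\<Sum>l\<in>S. if l = k then c l else 0)"
    unfolding p_def coeff_sum coeff_monom by (rule sum.cong[OF refl]) (use m k in \<open>auto simp: eq_nat_nat_iff\<close>)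
  also have "\<dots> = c k" using S k by simp
  finally show ?thesis by simp
qed

text \<open>\<open>t\<close> is the value of the formal symbol with exponent \<alpha>^2/2; it is
  chosen independently of \<open>A\<close>, as the symbol is formal.\<close>

definition ado_eval :: "complex \<Rightarrow> complex \<Rightarrow> ado_ring \<Rightarrow> complex" where
  "ado_eval t A = laurent_eval (laurent_eval (\<lambda>c. c) A) t"

context
  fixes t A :: complex
  assumes t: "t \<noteq> 0" and A: "A \<noteq> 0"
begin

lemma ado_eval_0: "ado_eval t A 0 = 0"
  unfolding ado_eval_def by (rule laurent_eval_0) (simp_all add: laurent_eval_0 laurent_eval_1 laurent_eval_add laurent_eval_mult A t)

lemma ado_eval_1: "ado_eval t A 1 = 1"
  unfolding ado_eval_def by (rule laurent_eval_1) (simp_all add: laurent_eval_0 laurent_eval_1 laurent_eval_add laurent_eval_mult A t)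

lemma ado_eval_add: "ado_eval t A (f + g) = ado_eval t A f + ado_eval t A g"
  unfolding ado_eval_def by (rule laurent_eval_add) (simp_all add: laurent_eval_0 laurent_eval_1 laurent_eval_add laurent_eval_mult A t)

lemma ado_eval_mult: "ado_eval t A (f * g) = ado_eval t A f * ado_eval t A g"
  unfolding ado_eval_def by (rule laurent_eval_mult) (simp_all add: laurent_eval_0 laurent_eval_1 laurent_eval_add laurent_eval_mult A t)

lemma ado_eval_diff: "ado_eval t A (f - g) = ado_eval t A f - ado_eval t A g"
  using ado_eval_add[of "f - g" g] by simp

lemma ado_eval_sum: "ado_eval t A (\<Sum>i\<in>I. f i) = (\<Sum>i\<in>I. ado_eval t A (f i))"
  by (induction I rule: infinite_finite_induct) (simp_all add: ado_eval_0 ado_eval_add)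

lemma ado_eval_prod: "ado_eval t A (\<Prod>i\<in>I. f i) = (\<Prod>i\<in>I. ado_eval t A (f i))"
  by (induction I rule: infinite_finite_induct) (simp_all add: ado_eval_1 ado_eval_mult)

lemma ado_eval_mon: "ado_eval t A (ado_mon c b z) = z * A powi b * t powi c"
proof -
  have 1: "laurent_eval (\<lambda>c. c) A (Poly_Mapping.single b z) = z * A powi b"
    by (rule laurent_eval_single) (simp_all add: A)
  show ?thesis unfolding ado_eval_def ado_mon_def 1[symmetric]
    by (rule laurent_eval_single) (simp_all add: laurent_eval_0 laurent_eval_1 laurent_eval_add laurent_eval_mult A t)
qed

lemma ado_eval_pull_diagram:
  "ado_eval t A (pull_diagram d W D \<phi> xs) = pull_diagram d (\<lambda>e z x. ado_eval t A (W e z x)) D (\<lambda>z. ado_eval t A (\<phi> z)) xs"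
proof (induction D arbitrary: xs)
  case (Cons \<sigma> D)
  obtain k e where \<sigma>: "\<sigma> = (k, e)" by force
  show ?case by (simp add: \<sigma> ado_eval_sum ado_eval_mult Cons)
qed simp

end

text \<open>Applied to the difference: for fixed \<open>A\<close> all coefficients in the outer
  variable vanish by \<open>laurent_coeffs_eq_0\<close>, and each of them is a Laurent polynomial to
  which the same lemma applies as \<open>A\<close> varies.\<close>

lemma ado_eval_inject:
  assumes "\<And>t A. t \<noteq> 0 \<Longrightarrow> A \<noteq> 0 \<Longrightarrow> ado_eval t A f = ado_eval t A g"
  shows "f = g"
proof -
  define F where "F = f - g"
  have F: "ado_eval t A F = 0" if "t \<noteq> 0" "A \<noteq> 0" for t A
    using assms[OF that] ado_eval_diff[OF that] by (simp add: F_def)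
  have "Poly_Mapping.lookup F k = 0" for k
  proof (cases "k \<in> Poly_Mapping.keys F")
    case True
    define G where "G = Poly_Mapping.lookup F k"
    have G: "laurent_eval (\<lambda>c. c) A G = 0" if A: "A \<noteq> 0" for A :: complex
      unfolding G_def
      by (rule laurent_coeffs_eq_0[where c = "\<lambda>k. laurent_eval (\<lambda>c. c) A (Poly_Mapping.lookup F k)", OF finite_keys _ True])
         (use F[OF _ A] in \<open>simp add: ado_eval_def laurent_eval_def[of _ _ F]\<close>)
    have "Poly_Mapping.lookup G l = 0" for l
    proof (cases "l \<in> Poly_Mapping.keys G")
      case True
      show ?thesis
        by (rule laurent_coeffs_eq_0[OF finite_keys _ True]) (use G in \<open>simp add: laurent_eval_def\<close>)
    qed (simp add: in_keys_iff)
    hence "G = 0" by (intro poly_mapping_eqI) simp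
    thus ?thesis by (simp add: G_def)
  qed (simp add: in_keys_iff)
  hence "F = 0" by (intro poly_mapping_eqI) simp
  thus ?thesis by (simp add: F_def)
qed

section \<open>The modules defining the ADO polynomials\<close>

context
  fixes r :: nat
  assumes r: "0 < r"
begin

lemmas zeta_root = r zeta_power_r[OF r] zeta_primitive

text \<open>Only the term n = i - b of the R-matrix survives. The factor A^(-(a+b)) of the diagonal
  part and the A^m from \<open>th_eq_falling\<close> combine to A^(-(j+b)); the factorials in
  \<open>qbinom\<close> are nonzero since m + j = a < r.\<close>

lemma ado_eval_R:
  assumes nz: "t \<noteq> 0" "A \<noteq> 0" and lt: "a < r" "b < r" "i < r" "j < r"
  shows "ado_eval t A (ado_R r (b, a) (i, j)) = t * cpos (zeta r) A a b i j"
proof -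
  note ev = ado_eval_0[OF nz] ado_eval_1[OF nz] ado_eval_mult[OF nz] ado_eval_sum[OF nz] ado_eval_diff[OF nz]
    ado_eval_prod[OF nz] ado_eval_mon[OF nz]
  define q where "q = zeta r"
  have q: "q \<noteq> 0" by (simp add: q_def zeta_nonzero)
  have E: "ado_E = (\<lambda>j i. if i = Suc j then 1 else 0)" by (intro ext) (simp add: ado_E_def)
  define f where "f m = q ^ (m * (m - 1) div 2) * ado_eval t A (ado_F r m a j)" for m
  have R: "ado_eval t A (ado_R r (b, a) (i, j)) = t * A powi (- (int b + int a)) * q ^ (2 * b * a) *
      (\<Sum>m<r. if i = b + m then f m else 0)"
    unfolding ado_R_def prod.case E mat_pow_shift[OF lt(2,3)] ado_HH_def ev
    by (rule arg_cong2[of _ _ _ _ "(*)"], simp add: q_def mult_ac, rule sum.cong) (auto simp: f_def q_def ev)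
  have br: "ado_eval t A (alpha_brace r k) = q powi k * A - q powi (- k) * inverse A" for k
    by (simp add: alpha_brace_def ev q_def power_int_minus)
  have neg: "- (- int j - int x) = int j + int x" for x by simp
  have fal: "ado_eval t A (alpha_falling r (- int j) m) = falling q A j m" for m
    unfolding alpha_falling_def ado_eval_prod[OF nz] br neg ..
  have sum: "(\<Sum>m<r. if i = b + m then f m else 0) = (if b \<le> i then f (i - b) else 0)"
  proof (cases "b \<le> i")
    case True
    have "(\<Sum>m<r. if i = b + m then f m else 0) = (\<Sum>m<r. if m = i - b then f m else 0)"
      by (rule sum.cong[OF refl]) (use True in auto)
    thus ?thesis using True lt by simp
  qed simp
  show ?thesis
  proof (cases "j \<le> a \<and> a + b = i + j")
    case True
    define m where "m = a - j"
    have m: "a = m + j" "i - b = m" "b \<le> i" using True by (auto simp: m_def)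
    have "qbinom q (m + j) m = q powi (- (int m * int j)) * gauss (q\<^sup>2) m j"
      by (rule qbinom_gauss[OF q]) (use zeta_primitive lt m in \<open>auto simp: q_def\<close>)
    hence "f m = q ^ (m * (m - 1) div 2) * (q powi (- (int m * int j)) * gauss (q\<^sup>2) m j) *
       falling q A j m"
      unfolding f_def ado_F_def using m lt by (simp add: ev fal q_def[symmetric])
    hence "A powi int m * th q A m j = (A powi int m * A powi (- int m)) * f m"
      unfolding th_eq_falling[OF q nz(2)] by (simp add: mult_ac)
    hence "f m = A powi int m * th q A m j" using nz by (simp add: power_int_minus)
    moreover have "A powi (- (int b + int a)) * A powi int m = A powi (- (int j + int b))"
      by (rule powi_split[OF nz(2), symmetric]) (simp add: m)
    moreover have "q ^ (2 * b * a) = q powi (2 * int a * int b)"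
      unfolding power_int_of_nat[symmetric] by (rule arg_cong[of _ _ "power_int q"]) simp
    ultimately show ?thesis unfolding R sum using True m
      by (simp add: cpos_def q_def[symmetric] mult_ac)
  next
    case False
    have "f (i - b) = 0" if "b \<le> i"
      unfolding f_def ado_F_def using False that by (auto simp: ev)
    moreover have "cpos (zeta r) A a b i j = 0" unfolding cpos_def by (rule if_not_P[OF False])
    ultimately show ?thesis unfolding R sum by simp
  qed
qed

text \<open>\<open>cneg\<close> at q = \<zeta> spelled out inside \<open>ado_ring\<close>: the
  inverse R-matrix has Laurent polynomial entries, and the first exponent -1 inverts the formal
  symbol.\<close>

definition ado_cneg :: "nat \<Rightarrow> nat \<Rightarrow> nat \<Rightarrow> nat \<Rightarrow> ado_ring" where
  "ado_cneg a b i j = (if i \<le> b \<and> a + b = i + j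
     then ado_mon (- 1) (int j + int b) ((- 1) ^ (b - i)
        * zeta r powi (- 2 * int i * int j - int (b - i) * (int (b - i) - 1))
        * (zeta r powi (- 2 * int (b - i) * int i) * gauss ((zeta r)\<^sup>2) (b - i) i))
       * (\<Prod>x<b - i. ado_mon 0 0 1 - ado_mon 0 (- 2) (zeta r ^ (2 * (i + x)))) else 0)"

lemma ado_eval_cneg:
  assumes nz: "t \<noteq> 0" "A \<noteq> 0"
  shows "ado_eval t A (ado_cneg a b i j) = inverse t * cneg (zeta r) A a b i j"
  unfolding ado_cneg_def cneg_def th_def
  by (simp add: ado_eval_0[OF nz] ado_eval_mult[OF nz] ado_eval_prod[OF nz] ado_eval_diff[OF nz] ado_eval_mon[OF nz]
      power_int_minus mult_ac)

text \<open>Evaluation cannot be moved directly through the choice in \<open>Rinv\<close>. So the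
  inverse identities are first lifted to \<open>ado_ring\<close> by \<open>ado_eval_inject\<close>,
  and uniqueness of inverses then identifies the entries.\<close>

lemma ado_Rinv_eq:
  assumes "a < r" "b < r" "i < r" "j < r"
  shows "Rinv (ado_data r) (a, b) (j, i) = ado_cneg a b i j"
proof -
  have dim: "rt_dim (ado_data r) = r" by (simp add: ado_data_def)
  show ?thesis
  proof (rule Rinv_crossing[where P = "\<lambda>a b i j. ado_R r (b, a) (i, j)"]; (unfold dim)?)
  fix a b i j assume lt: "a < r" "b < r" "i < r" "j < r"
  show "Rmat (ado_data r) (b, a) (i, j) = ado_R r (b, a) (i, j)" by (simp add: ado_data_def)
  have gen: "zeta r ^ (2 * x) \<noteq> 1" if "0 < x" "x < r" for x by (rule zeta_primitive[OF that])
  show "(\<Sum>c<r. \<Sum>e<r. ado_R r (b, a) (c, e) * ado_cneg c e i j) = (if a = i \<and> b = j then 1 else 0)"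
  proof (rule ado_eval_inject)
    fix t A :: complex assume nz: "t \<noteq> 0" "A \<noteq> 0"
    have "ado_eval t A (\<Sum>c<r. \<Sum>e<r. ado_R r (b, a) (c, e) * ado_cneg c e i j) = (\<Sum>c<r. \<Sum>e<r. cpos (zeta r) A a b c e * cneg (zeta r) A c e i j)"
      unfolding ado_eval_sum[OF nz] ado_eval_mult[OF nz] ado_eval_cneg[OF nz]
      by (intro sum.cong refl) (use nz lt ado_eval_R[OF nz] in simp)
    also have "\<dots> = (if a = i \<and> b = j then 1 else 0)"
      by (rule cpos_cneg_inverse[OF zeta_nonzero nz(2) gen lt])
    finally show "ado_eval t A (\<Sum>c<r. \<Sum>e<r. ado_R r (b, a) (c, e) * ado_cneg c e i j)
       = ado_eval t A (if a = i \<and> b = j then 1 else 0)"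
      by (simp add: ado_eval_0[OF nz] ado_eval_1[OF nz])
  qed
  show "(\<Sum>c<r. \<Sum>e<r. ado_cneg a b c e * ado_R r (e, c) (i, j)) = (if a = i \<and> b = j then 1 else 0)"
  proof (rule ado_eval_inject)
    fix t A :: complex assume nz: "t \<noteq> 0" "A \<noteq> 0"
    have "ado_eval t A (\<Sum>c<r. \<Sum>e<r. ado_cneg a b c e * ado_R r (e, c) (i, j)) = (\<Sum>c<r. \<Sum>e<r. cneg (zeta r) A a b c e * cpos (zeta r) A c e i j)"
      unfolding ado_eval_sum[OF nz] ado_eval_mult[OF nz] ado_eval_cneg[OF nz]
      by (intro sum.cong refl) (use nz lt ado_eval_R[OF nz] in simp)
    also have "\<dots> = (if a = i \<and> b = j then 1 else 0)"
      by (rule cneg_cpos_inverse[OF zeta_nonzero nz(2) gen lt])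
    finally show "ado_eval t A (\<Sum>c<r. \<Sum>e<r. ado_cneg a b c e * ado_R r (e, c) (i, j))
       = ado_eval t A (if a = i \<and> b = j then 1 else 0)"
      by (simp add: ado_eval_0[OF nz] ado_eval_1[OF nz])
  qed
qed (use assms in \<open>simp_all add: dim\<close>)
qed

lemma ado_eval_rt_op:
  assumes D: "is_tangle [Up] D [Up]" "writhe D = 0" and nz: "t \<noteq> 0" "A \<noteq> 0" and ij: "i < r" "j < r"
  shows "ado_eval t A (rt_op (ado_data r) [Up] D [j] [i]) = (if j = i then state_sum r (- int r) D (zeta r) A else 0)"
proof -
  define q p where "q = zeta r" and "p = A powi (- int r)"
  have q: "q \<noteq> 0" and p: "p \<noteq> 0" using nz by (simp_all add: q_def p_def zeta_nonzero)
  have dim: "rt_dim (ado_data r) = r" by (simp add: ado_data_def)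
  have piv: "ado_eval t A (ado_K_pow r (1 - int r) i) = p * (A * q powi (- 2 * int i))"
     "ado_eval t A (ado_K_pow r (int r - 1) i) = inverse (p * (A * q powi (- 2 * int i)))" for i
  proof -
    have "q powi (- 2 * int i * (1 - int r)) = q powi (- 2 * int i + 2 * int r * int i)"
      by (simp add: algebra_simps)
    also have "\<dots> = q powi (- 2 * int i)"
      unfolding q_def by (rule root_powi_even[OF zeta_root nz(2)])
    finally have 1: "q powi (- 2 * int i * (1 - int r)) = q powi (- 2 * int i)" .
    have 2: "A powi (1 - int r) = p * A"
      unfolding p_def using nz(2) by (simp add: power_int_diff power_int_minus field_simps)
    have 3: "ado_eval t A (ado_K_pow r (1 - int r) i) = q powi (- 2 * int i * (1 - int r)) * A powi (1 - int r)"
      by (simp add: ado_K_pow_def ado_eval_mon[OF nz] q_def)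
    show "ado_eval t A (ado_K_pow r (1 - int r) i) = p * (A * q powi (- 2 * int i))"
      unfolding 3 1 2 by (simp only: mult_ac)
    have "ado_eval t A (ado_K_pow r (int r - 1) i) = q powi (- (- 2 * int i * (1 - int r))) * A powi (- (1 - int r))"
      by (simp add: ado_K_pow_def ado_eval_mon[OF nz] q_def algebra_simps)
    also have "\<dots> = inverse (ado_eval t A (ado_K_pow r (1 - int r) i))"
      unfolding 3 power_int_minus by simp
    finally show "ado_eval t A (ado_K_pow r (int r - 1) i) = inverse (p * (A * q powi (- 2 * int i)))"
      unfolding 3 1 2 by (simp only: mult_ac)
  qed
  have "ado_eval t A (rt_op (ado_data r) [Up] D [j] [i]) =
      ado_eval t A (pull_diagram r (piece_op (ado_data r)) D (entry [j]) [i])"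
    using ij dim by (subst rt_op_eq_pull_diagram[OF D(1)]) (auto simp: index_lists_def)
  also have "\<dots> = pull_diagram r (\<lambda>e z x. ado_eval t A (piece_op (ado_data r) e z x)) D (\<lambda>z. ado_eval t A (entry [j] z)) [i]"
    by (rule ado_eval_pull_diagram[OF nz])
  also have "\<dots> = pull_diagram r (wt (\<lambda>a b i j. t * cpos q A a b i j) (\<lambda>a b i j. inverse t * cneg q A a b i j)
      (\<lambda>i. p * (A * q powi (- 2 * int i))) (\<lambda>i. inverse (p * (A * q powi (- 2 * int i))))) D (entry [j]) [i]"
  proof (rule pull_diagram_cong[OF D(1)])
    fix e z x assume zx: "z \<in> index_lists r (length (tgt e))" "x \<in> index_lists r (length (src e))"
    show "ado_eval t A (piece_op (ado_data r) e z x) = wt (\<lambda>a b i j. t * cpos q A a b i j) (\<lambda>a b i j. inverse t * cneg q A a b i j)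
      (\<lambda>i. p * (A * q powi (- 2 * int i))) (\<lambda>i. inverse (p * (A * q powi (- 2 * int i)))) e z x"
      unfolding piv(2)[symmetric] unfolding piv(1)[symmetric] unfolding piece_op_eq_wt q_def using zx
      by (cases e) (auto simp: index_lists_def length_Suc_conv ado_Rinv_eq ado_eval_cneg[OF nz] ado_eval_0[OF nz] ado_eval_1[OF nz],
        auto simp: ado_data_def ado_eval_R[OF nz] ado_eval_0[OF nz])
  qed (use ij in \<open>auto simp: index_lists_def ado_eval_0[OF nz] ado_eval_1[OF nz]\<close>)
  also have "\<dots> = pull_diagram r (weights q A p) D (entry [j]) [i]"
    unfolding pull_diagram_writhe[OF nz(1)] D(2) by simp
  also have "\<dots> = (if j = i then pull_diagram r (weights q A p) D (entry [0]) [0] else 0)"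
  proof (rule pull_diagram_scalar[OF D(1) q nz(2) p])
    \<comment> \<open>Residues n and j with sum r produce a carry, so \<open>th_root\<close> gives
      0: the F^(n) with n < r do not leave the span of the first r vectors.\<close>
    show "th q A n j = 0" if "n < r" "j < r" "n + j = r" for n j
      unfolding q_def using th_root[OF zeta_root nz(2), of n j] that by simp
  qed (use ij in auto)
  finally show ?thesis by (simp add: state_sum_def q_def p_def)
qed

lemma ado_eval_ADO:
  assumes D: "is_tangle [Up] D [Up]" "writhe D = 0" and nz: "t \<noteq> 0" "A \<noteq> 0"
  shows "ado_eval t A (ADO r D) = state_sum r (- int r) D (zeta r) A"
proof -
  have "ADO r D = rt_op (ado_data r) [Up] D [0] [0]"
    unfolding ADO_def
  proof (rule rt_scalar_eqI)
    fix i j assume "i < rt_dim (ado_data r)" "j < rt_dim (ado_data r)"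
    hence ij: "i < r" "j < r" by (simp_all add: ado_data_def)
    \<comment> \<open>All diagonal entries have the same values under evaluation, so they are equal
      in \<open>ado_ring\<close> itself, which is what \<open>rt_scalar\<close> asks for.\<close>
    show "rt_op (ado_data r) [Up] D [j] [i] = (if j = i then rt_op (ado_data r) [Up] D [0] [0] else 0)"
      by (rule ado_eval_inject) (simp add: ado_eval_rt_op[OF D _ _ ij] ado_eval_rt_op[OF D _ _ r r] ado_eval_0)
  qed (simp add: ado_data_def r)
  thus ?thesis using ado_eval_rt_op[OF D nz r r] by simp
qed

end

section \<open>From the colored Jones family to the ADO family\<close>

lemma ADO_determined:
  assumes D: "D \<in> zero_framed_knots" "D' \<in> zero_framed_knots"
    and J: "\<And>n. 1 \<le> n \<Longrightarrow> colored_jones n D = colored_jones n D'" and r: "1 \<le> r"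
  shows "ADO r D = ADO r D'"
proof (rule ado_eval_inject)
  have r': "0 < r" using r by simp
  have T: "is_tangle [Up] D [Up]" "one_component [Up] D" "writhe D = 0"
    "is_tangle [Up] D' [Up]" "one_component [Up] D'" "writhe D' = 0"
    using D by (simp_all add: zero_framed_knots_def)
  fix t A :: complex assume nz: "t \<noteq> 0" "A \<noteq> 0"
  have "state_sum r (- int r) D (zeta r) A = state_sum r (- int r) D' (zeta r) A"
    by (rule ado_state_sum_eq[OF _ T(1,2,4,5) r' zeta_power_r[OF r'] zeta_primitive nz(2)])
       (use J T in \<open>simp_all add: colored_jones_eq_state_sum\<close>)
  thus "ado_eval t A (ADO r D) = ado_eval t A (ADO r D')"
    using ado_eval_ADO[OF r' T(1,3) nz] ado_eval_ADO[OF r' T(4,6) nz] by simp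
qed

theorem mainTheorem1:
  shows "\<exists>\<Phi> :: (nat \<Rightarrow> rat fls) \<Rightarrow> (nat \<Rightarrow> ado_ring).
    \<forall>D \<in> zero_framed_knots.
      \<Phi> (\<lambda>n\<in>{1..}. colored_jones n D) = (\<lambda>r\<in>{1..}. ADO r D)"
proof -
  let ?J = "\<lambda>D. \<lambda>n\<in>{1..}. colored_jones n D"
  let ?ADO = "\<lambda>D. \<lambda>r\<in>{1..}. ADO r D"
  have "?ADO (inv_into zero_framed_knots ?J (?J D)) = ?ADO D" if D: "D \<in> zero_framed_knots" for D
  proof -
    \<comment> \<open>Any knot with the given Jones family may serve; \<open>ADO_determined\<close>
      shows that the choice does not affect the ADO family.\<close>
    define D' where "D' = inv_into zero_framed_knots ?J (?J D)"
    have D': "D' \<in> zero_framed_knots" "?J D' = ?J D"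
      unfolding D'_def using D by (auto intro: inv_into_into f_inv_into_f)
    have "colored_jones n D' = colored_jones n D" if "1 \<le> n" for n
      using fun_cong[OF D'(2), of n] that by simp
    hence "ADO r D' = ADO r D" if "1 \<le> r" for r by (rule ADO_determined[OF D'(1) D _ that])
    thus ?thesis unfolding D'_def[symmetric] by (intro ext) (simp add: restrict_def)
  qed
  thus ?thesis by (intro exI[of _ "\<lambda>f. ?ADO (inv_into zero_framed_knots ?J f)"] ballI)
qed

end
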